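(* Let $x,y,z$ be non-negative integers and let $\mathbf a=(a_1,\dots,a_m)$, $\mathbf b=(b_1,\dots,b_n)$ be two sequences of non-negative integers with $m\ge1$ and $a_1\ge1$. Put $\mu=2\lfloor\frac{m+1}{2}\rfloor$, $\mu'=2\lceil\frac{m-1}{2}\rceil$, $\nu=2\lfloor\frac{n+1}{2}\rfloor$, $\nu'=2\lceil\frac{n-1}{2}\rceil$, and $$\mathbf t^{+}=(0,a_1-1,a_2,\dots,a_{\mu-1},\,a_{\mu}+x+y+b_{\nu},\,b_{\nu-1},\dots,b_1),\qquad \mathbf t^{-}=(a_1,\dots,a_{\mu'},\,a_{\mu'+1}+x+y+b_{\nu'+1},\,b_{\nu'},\dots,b_1,z).$$ Then $$M(N^{(4)}_{x,y,z}(\mathbf a;\mathbf b))=\frac{M(N^{(4)}_{x+y,0,z}(\mathbf a;\mathbf b))\,M(N^{(4)}_{0,y,z}(\mathbf a;\mathbf b))}{M(N^{(4)}_{y,0,z}(\mathbf a;\mathbf b))}\cdot\frac{T(x+1,2a+b+2y+z-2,y)\,T(x+a+1,b+2y+z-2,y)}{T(1,2a+b+2y+z-2,y)\,T(a+1,b+2y+z-2,y)}$$ $$=2^{-y}\,Q(\mathbf t^{+})\,K'(\mathbf t^{-})\cdot\frac{(a-1)!}{(a+y-1)!}\cdot\frac{H_2(2o_a+2o_b-1)\,H_2(2e_a+2e_b+2z)}{H_2(2o_a+2o_b+2y-1)\,H_2(2e_a+2e_b+2y+2z)}\cdot\frac{H(2a+b+2y+z-1)\,H(b+y+z)}{H(2a+b+y+z-1)\,H(b+z)}$$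 $$\cdot\frac{T(x+1,2a+b+2y+z-2,y)\,T(x+a+1,b+2y+z-2,y)}{T(1,2a+b+2y+z-2,y)\,T(a+1,b+2y+z-2,y)}.$$
   Context: Lattice and tilings. For real $u,k$ let $[u;k]$ be the point of the plane with Cartesian coordinates $(u,\frac{\sqrt3}{2}k)$. The triangular lattice has as vertices all $[u;k]$ with $k\in\mathbb Z$, $u-k/2\in\mathbb Z$; its faces are unit equilateral triangles, up-pointing or down-pointing. A region is a finite union of unit triangles. A lozenge is the union of two unit triangles sharing an edge; it is vertical if that edge is horizontal. A tiling of a region is a covering of it by lozenges contained in it, without gaps or overlaps. $M(R)$ is the sum of the weights of all tilings of $R$, the weight of a tiling being the product of the weights of its lozenges; lozenges have weight $1$ unless stated otherwise; $M(\emptyset)=1$. Sequences. $a=\sum a_i$, $b=\sum b_j$; $o_a,e_a$ are the sums of the $a_i$ with $i$ odd, resp. even; $o_b,e_b$ likewise. $a_i=0$ for $i>m$, $b_j=0$ for $j>n$; an empty $\mathbf b$ is treated as the one-term sequence $(0)$. Functions. $H(n)=\prod_{i=0}^{n-1}i!$; $H_2(n)=\prod_{i=1}^{\lfloor n/2\rfloor}(n-2i)!$; for $n\ge0$, $(x)_n=x(x+1)\cdots(x+n-1)$ ($1$ for $n=0$); $T(x,n,m)=\prod_{i=0}^{m-1}(x+i)_{n-2i}$. Empty products are $1$. Quartered hexagons. For a sequence $\mathbf t=(t_1,\dots,t_{2l})$ of non-negative integers let $s_k=t_1+\dots+t_k$, $o_t=\sum_{i\text{ odd}}t_i$, $e_t=\sum_{i\text{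 even}}t_i$. $Q(\mathbf t)$: take the region bounded by the base from $[0;0]$ to $[o_t+e_t;0]$, the segment from $[o_t+e_t;0]$ to $[o_t;2e_t]$, the north side from $[o_t;2e_t]$ to $[0;2e_t]$, and the west zigzag through $[0;0],[-\frac12;1],[0;2],[-\frac12;3],\dots,[0;2e_t]$; remove from it, for each $1\le i\le l$, the up-pointing triangle with base from $[s_{2i-1};0]$ to $[s_{2i};0]$. $Q(\mathbf t)$ is the number of tilings of the resulting region. $K'(\mathbf t)$: if $e_t\ge1$, take the region bounded by the base from $[0;0]$ to $[o_t+e_t;0]$, the segment from $[o_t+e_t;0]$ to $[o_t+\frac12;2e_t-1]$, the north side from there to $[\frac12;2e_t-1]$, and the west zigzag through $[0;0],[\frac12;1],[0;2],[\frac12;3],\dots,[\frac12;2e_t-1]$; remove the same up-pointing triangles; give weight $\frac12$ to each vertical lozenge whose two western (left) sides both lie on the west zigzag. $K'(\mathbf t)$ is $M$ of this weighted region; if $e_t=0$, $K'(\mathbf t)=1$. The region $N^{(4)}_{x,y,z}(\mathbf a;\mathbf b)$ ($a_1\ge1$). Let $L=x+y+a+b$, $A=2(y+o_a+o_b)-2$, $B=2(y+z+e_a+e_b)-1$, and let $\ell$ be the line $k=0$. Upper part: bounded by $\ell$ between $[1;0]$ and $[L;0]$, the segment from $[L;0]$ to $[L-\frac A2;A]$, the horizontal north side at height $k=A$, and the west zigzag through the points $[\alpha(k);k]$, $0\le k\le A$, with $\alpha(k)=1$ for $k$ even and $\frac12$ for $k$ odd. Lower part (empty if $B=-1$): bounded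 by $\ell$ between $[0;0]$ and $[L;0]$, the segments from $[L;0]$ to $[L+\frac z2;-z]$ and from there to $[L+z-\frac B2;-B]$, the horizontal south side at $k=-B$, and the west zigzag through $[\beta(k);-k]$, $0\le k\le B$, with $\beta(k)=0$ for $k$ even and $\frac12$ for $k$ odd. The region is the union of the two parts (lozenges may cross $\ell$) after removing: (i) from the upper part, everything at points $[u;k]$ with $u<a_1-k/2$ (the up-pointing half triangle); (ii) for $2\le i\le m$, the triangle of side $a_i$ having a side on $\ell$ from $[a_1+\dots+a_{i-1};0]$ to $[a_1+\dots+a_i;0]$, down-pointing (below $\ell$) if $i$ is even, up-pointing (above $\ell$) if $i$ is odd; (iii) for $1\le j\le n$, the triangle of side $b_j$ having a side on $\ell$ from $[L-b_1-\dots-b_j;0]$ to $[L-b_1-\dots-b_{j-1};0]$, up-pointing (above $\ell$) if $j$ is odd, down-pointing (below $\ell$) if $j$ is even. Each vertical lozenge whose two western (left) sides both lie on the lower west zigzag has weight $\frac12$; all others have weight $1$. *)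

theory Defs
  imports Complex_Main "HOL-Library.Disjoint_Sets"
begin

text \<open>
  A vertex is a pair of integers \<open>(i, k)\<close>, standing for the point \<open>[i + k/2; k]\<close>, i.e. the point
  with Cartesian coordinates \<open>(i + k/2, (sqrt 3 / 2) * k)\<close>. In these skew coordinates the condition
  \<open>u - k/2 \<in> \<int>\<close> on the lattice points \<open>[u; k]\<close> holds automatically. A unit triangle is represented
  by the set of its three vertices, and a region by the set of unit triangles it is the union of.
\<close>

type_synonym vertex = "int \<times> int"
type_synonym face = "vertex set"
type_synonym region = "face set"
type_synonym lozenge = "face set"

definition abscissa :: "vertex \<Rightarrow> real" where
  "abscissa p = of_int (fst p) + of_int (snd p) / 2"

abbreviation height :: "vertex \<Rightarrow> int" where
  "height p \<equiv> snd p"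

definition up_face :: "int \<Rightarrow> int \<Rightarrow> face" where
  "up_face i k = {(i, k), (i + 1, k), (i, k + 1)}"

definition down_face :: "int \<Rightarrow> int \<Rightarrow> face" where
  "down_face i k = {(i, k), (i + 1, k), (i + 1, k - 1)}"

definition is_face :: "face \<Rightarrow> bool" where
  "is_face t \<longleftrightarrow> (\<exists>i k. t = up_face i k \<or> t = down_face i k)"

text \<open>Two unit triangles share an edge iff they have exactly two common vertices.\<close>

definition is_lozenge :: "lozenge \<Rightarrow> bool" where
  "is_lozenge l \<longleftrightarrow> (\<exists>s t. is_face s \<and> is_face t \<and> card (s \<inter> t) = 2 \<and> l = {s, t})"

definition tilings :: "region \<Rightarrow> lozenge set set" where
  "tilings R = {P. partition_on R P \<and> (\<forall>l\<in>P. is_lozenge l)}"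

definition weighted_count :: "(lozenge \<Rightarrow> real) \<Rightarrow> region \<Rightarrow> real" where
  "weighted_count w R = (\<Sum>P\<in>tilings R. \<Prod>l\<in>P. w l)"

lemma finite_tilings:
  assumes "finite R"
  shows "finite (tilings R)"
proof (rule finite_subset)
  show "tilings R \<subseteq> Pow (Pow R)"
    by (auto simp: tilings_def partition_on_def)
  show "finite (Pow (Pow R))"
    using assms by simp
qed

lemma weighted_count_empty: "weighted_count w {} = 1"
proof -
  have "tilings {} = {{}}"
    by (auto simp: tilings_def partition_on_def)
  then show ?thesis
    by (simp add: weighted_count_def)
qed

text \<open>
  The unit triangles contained in the part of the plane between the heights \<open>k0\<close> and \<open>k1\<close> that lies
  between the path through the points \<open>[lo k; k]\<close> and the path through the points \<open>[hi k; k]\<close>. Both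
  paths are straight between consecutive integral heights, so that this part of the plane is convex
  between two such heights; hence it contains a unit triangle as soon as it contains its vertices.
\<close>

definition faces_between :: "(int \<Rightarrow> real) \<Rightarrow> (int \<Rightarrow> real) \<Rightarrow> int \<Rightarrow> int \<Rightarrow> region" where
  "faces_between lo hi k0 k1 =
     {t. is_face t \<and> (\<forall>p\<in>t. k0 \<le> height p \<and> height p \<le> k1 \<and>
                            lo (height p) \<le> abscissa p \<and> abscissa p \<le> hi (height p))}"

text \<open>The triangles of side \<open>s\<close> having a side from \<open>[u; 0]\<close> to \<open>[u + s; 0]\<close>.\<close>

definition up_triangle :: "nat \<Rightarrow> nat \<Rightarrow> region" where
  "up_triangle u s = faces_between (\<lambda>k. u + k / 2) (\<lambda>k. u + s - k / 2) 0 (int s)"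

definition down_triangle :: "nat \<Rightarrow> nat \<Rightarrow> region" where
  "down_triangle u s = faces_between (\<lambda>k. u - k / 2) (\<lambda>k. u + s + k / 2) (- int s) 0"

text \<open>Zigzags are sets of unit edges, so that a side of a lozenge lies on one iff it is an element.\<close>

definition zigzag :: "(int \<Rightarrow> real) \<Rightarrow> int \<Rightarrow> int \<Rightarrow> vertex set set" where
  "zigzag c k0 k1 =
     {{p, q} | p q. k0 \<le> height p \<and> height q \<le> k1 \<and> height q = height p + 1 \<and>
                    abscissa p = c (height p) \<and> abscissa q = c (height q)}"

text \<open>
  Weight 1/2 for the vertical lozenges with both western sides on \<open>Z\<close>, weight 1 otherwise. The western
  sides of the vertical lozenge with horizontal diagonal from \<open>(i, k)\<close> to \<open>(i + 1, k)\<close> join \<open>(i, k)\<close>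
  to the top vertex \<open>(i, k + 1)\<close> and to the bottom vertex \<open>(i + 1, k - 1)\<close>.
\<close>

definition half_weight :: "vertex set set \<Rightarrow> lozenge \<Rightarrow> real" where
  "half_weight Z l =
     (if \<exists>i k. l = {up_face i k, down_face i k} \<and>
               {(i, k), (i, k + 1)} \<in> Z \<and> {(i, k), (i + 1, k - 1)} \<in> Z
      then 1 / 2 else 1)"

lemma finite_faces_between: "finite (faces_between lo hi k0 k1)"
proof -
  define V where
    "V = (\<Union>k\<in>{k0..k1}. {p. height p = k \<and> lo k \<le> abscissa p \<and> abscissa p \<le> hi k})"
  have "finite {p. height p = k \<and> lo k \<le> abscissa p \<and> abscissa p \<le> hi k}" for k
  proof (rule finite_subset)
    show "{p. height p = k \<and> lo k \<le> abscissa p \<and> abscissa p \<le> hi k}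
            \<subseteq> {\<lceil>lo k - k / 2\<rceil>..\<lfloor>hi k - k / 2\<rfloor>} \<times> {k}"
      by (auto simp: abscissa_def ceiling_le_iff le_floor_iff)
  qed simp
  then have "finite V"
    by (simp add: V_def)
  moreover have "faces_between lo hi k0 k1 \<subseteq> Pow V"
    by (auto simp: faces_between_def V_def)
  ultimately show ?thesis
    by (meson finite_Pow_iff finite_subset)
qed

text \<open>A sequence is a list; its terms are numbered from 1 and are 0 beyond the end of the list.\<close>

definition seq_term :: "nat list \<Rightarrow> nat \<Rightarrow> nat" where
  "seq_term xs i = (if 1 \<le> i \<and> i \<le> length xs then xs ! (i - 1) else 0)"

definition partial_sum :: "nat list \<Rightarrow> nat \<Rightarrow> nat" where
  "partial_sum xs k = (\<Sum>i=1..k. seq_term xs i)"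

definition odd_sum :: "nat list \<Rightarrow> nat" where
  "odd_sum xs = (\<Sum>i | i \<in> {1..length xs} \<and> odd i. seq_term xs i)"

definition even_sum :: "nat list \<Rightarrow> nat" where
  "even_sum xs = (\<Sum>i | i \<in> {1..length xs} \<and> even i. seq_term xs i)"

text \<open>The number of terms, where the empty sequence is treated as the one-term sequence \<open>(0)\<close>.\<close>

definition num_terms :: "nat list \<Rightarrow> nat" where
  "num_terms xs = (if xs = [] then 1 else length xs)"

definition H_fun :: "nat \<Rightarrow> real" where
  "H_fun n = (\<Prod>i<n. fact i)"

definition H2_fun :: "nat \<Rightarrow> real" where
  "H2_fun n = (\<Prod>i=1..n div 2. fact (n - 2 * i))"

text \<open>Only used when \<open>2 * (m - 1) \<le> n\<close> or \<open>m = 0\<close>, so that the subtraction is never truncated.\<close>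

definition T_fun :: "real \<Rightarrow> nat \<Rightarrow> nat \<Rightarrow> real" where
  "T_fun x n m = (\<Prod>i<m. pochhammer (x + real i) (n - 2 * i))"

definition dents :: "nat list \<Rightarrow> region" where
  "dents t = (\<Union>i\<in>{1..length t div 2}.
                up_triangle (partial_sum t (2 * i - 1)) (seq_term t (2 * i)))"

definition Q_region :: "nat list \<Rightarrow> region" where
  "Q_region t =
     faces_between (\<lambda>k. if even k then 0 else - 1 / 2)
                   (\<lambda>k. odd_sum t + even_sum t - k / 2)
                   0 (2 * int (even_sum t)) - dents t"

definition Q_count :: "nat list \<Rightarrow> nat" where
  "Q_count t = card (tilings (Q_region t))"

definition K_west :: "int \<Rightarrow> real" where
  "K_west k = (if even k then 0 else 1 / 2)"

definition K_region :: "nat list \<Rightarrow> region" where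
  "K_region t =
     faces_between K_west (\<lambda>k. odd_sum t + even_sum t - k / 2)
                   0 (2 * int (even_sum t) - 1) - dents t"

definition K_count :: "nat list \<Rightarrow> real" where
  "K_count t =
     (if even_sum t = 0 then 1
      else weighted_count (half_weight (zigzag K_west 0 (2 * int (even_sum t) - 1))) (K_region t))"

definition N4_L :: "nat \<Rightarrow> nat \<Rightarrow> nat list \<Rightarrow> nat list \<Rightarrow> nat" where
  "N4_L x y as bs = x + y + sum_list as + sum_list bs"

definition N4_A :: "nat \<Rightarrow> nat list \<Rightarrow> nat list \<Rightarrow> int" where
  "N4_A y as bs = 2 * (int y + int (odd_sum as) + int (odd_sum bs)) - 2"

definition N4_B :: "nat \<Rightarrow> nat \<Rightarrow> nat list \<Rightarrow> nat list \<Rightarrow> int" where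
  "N4_B y z as bs = 2 * (int y + int z + int (even_sum as) + int (even_sum bs)) - 1"

text \<open>The last set removes the up-pointing half triangle at the western end of the line \<open>k = 0\<close>.\<close>

definition N4_upper :: "nat \<Rightarrow> nat \<Rightarrow> nat list \<Rightarrow> nat list \<Rightarrow> region" where
  "N4_upper x y as bs =
     faces_between (\<lambda>k. if even k then 1 else 1 / 2) (\<lambda>k. N4_L x y as bs - k / 2)
                   0 (N4_A y as bs)
     - {t. \<exists>p\<in>t. abscissa p < seq_term as 1 - height p / 2}"

text \<open>
  Heights are non-positive in the lower part: the points \<open>[\<beta>(k); -k]\<close> of its west zigzag are the
  points \<open>[N4_west h; h]\<close> with \<open>h = -k\<close>.
\<close>

definition N4_west :: "int \<Rightarrow> real" where
  "N4_west h = (if even h then 0 else 1 / 2)"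

definition N4_lower :: "nat \<Rightarrow> nat \<Rightarrow> nat \<Rightarrow> nat list \<Rightarrow> nat list \<Rightarrow> region" where
  "N4_lower x y z as bs =
     faces_between N4_west
                   (\<lambda>h. if - h \<le> int z then N4_L x y as bs - h / 2 else N4_L x y as bs + z + h / 2)
                   (- N4_B y z as bs) 0"

definition a_removed :: "nat list \<Rightarrow> region" where
  "a_removed as =
     (\<Union>i\<in>{2..length as}.
        if even i then down_triangle (partial_sum as (i - 1)) (seq_term as i)
        else up_triangle (partial_sum as (i - 1)) (seq_term as i))"

definition b_removed :: "nat \<Rightarrow> nat list \<Rightarrow> region" where
  "b_removed L bs =
     (\<Union>j\<in>{1..length bs}.
        if odd j then up_triangle (L - partial_sum bs j) (seq_term bs j)
        else down_triangle (L - partial_sum bs j) (seq_term bs j))"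

definition N4_region :: "nat \<Rightarrow> nat \<Rightarrow> nat \<Rightarrow> nat list \<Rightarrow> nat list \<Rightarrow> region" where
  "N4_region x y z as bs =
     (N4_upper x y as bs \<union> N4_lower x y z as bs) - a_removed as - b_removed (N4_L x y as bs) bs"

definition N4_count :: "nat \<Rightarrow> nat \<Rightarrow> nat \<Rightarrow> nat list \<Rightarrow> nat list \<Rightarrow> real" where
  "N4_count x y z as bs =
     weighted_count (half_weight (zigzag N4_west (- N4_B y z as bs) 0)) (N4_region x y z as bs)"

definition t_plus :: "nat \<Rightarrow> nat \<Rightarrow> nat list \<Rightarrow> nat list \<Rightarrow> nat list" where
  "t_plus x y as bs =
     (let \<mu> = 2 * nat \<lfloor>(real (num_terms as) + 1) / 2\<rfloor>;
          \<nu> = 2 * nat \<lfloor>(real (num_terms bs) + 1) / 2\<rfloor>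
      in [0, seq_term as 1 - 1] @ map (seq_term as) [2..<\<mu>]
         @ [seq_term as \<mu> + x + y + seq_term bs \<nu>]
         @ map (seq_term bs) (rev [1..<\<nu>]))"

definition t_minus :: "nat \<Rightarrow> nat \<Rightarrow> nat \<Rightarrow> nat list \<Rightarrow> nat list \<Rightarrow> nat list" where
  "t_minus x y z as bs =
     (let \<mu>' = 2 * nat \<lceil>(real (num_terms as) - 1) / 2\<rceil>;
          \<nu>' = 2 * nat \<lceil>(real (num_terms bs) - 1) / 2\<rceil>
      in map (seq_term as) [1..<\<mu>' + 1]
         @ [seq_term as (\<mu>' + 1) + x + y + seq_term bs (\<nu>' + 1)]
         @ map (seq_term bs) (rev [1..<\<nu>' + 1]) @ [z])"

end

(* Read a tiling row by row. In a trapezoid with one zigzag side, the sets of vertical lozenges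
   cut by consecutive horizontal lines interlace, and summing a Vandermonde product in the
   variables (c/2)^2 over the sets interlacing a given one yields a Vandermonde product again
   (expand determinants in bases of central factorials, whose sums telescope). Hence the weighted
   number of tilings of such a trapezoid is a Vandermonde product of the positions U removed from
   its base. This evaluates Q and K'.

   Cutting N^(4) along the line l writes M as the sum, over the set S of the y positions at which
   lozenges cross l, of the products of two trapezoid values in which U consists of S and of the
   dents above, resp. below l. The factors involving S depend on the union of all dents only, and
   this union consists of two runs of consecutive positions, one on either side of the gap: what is
   left is a discrete Selberg sum. Evaluating a sum over pairs of interlacing sets in its two orders
   moves a fixed position from the left run to the right one, or trades an element of S for one
   when the left run is empty; iterating gives the closed form. The first identity compares the
   product formula at (x, y), (x + y, 0), (0, y) and (y, 0), since Q and K' depend on x + y only. *)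

theory Submission
  imports Defs "Jordan_Normal_Form.Determinant"
begin

section \<open>Weighted perfect matchings\<close>

text \<open>Measure the abscissa c/2 from the zigzag. A central difference turns even polynomials
  into odd ones and odd into even, so two kinds of product alternate from row to row:
  \<open>vdm\<close> for an odd number of rows and \<open>ovdm\<close>, with an extra factor c/2 per
  position, for an even number. The wall provides the starting value of the telescoping sums. A wall
  at column 1 starts them at 0, where odd functions vanish. A wall at column 0 starts them at -1,
  and weight 1/2 on column 0 is exactly what replaces that value by 0. Hence \<open>lo = 0\<close>
  and \<open>lo = 1\<close> lead to the same formula. Along k = 0 the upper part has an even and the
  lower part an odd number of rows. The summand is therefore a product of one \<open>ovdm\<close>
  and one \<open>vdm\<close>: it contains the square of \<open>vdm S\<close>, and each dent position
  contributes one factor per element of \<open>S\<close>, no matter on which side the dent lies. The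
  left run has a - 1 positions and starts at 2 in doubled coordinates because the upper part begins
  at [1;0], so that position 0 exists only below the line.\<close>

definition matching_sum :: "'a set set \<Rightarrow> ('a set \<Rightarrow> real) \<Rightarrow> 'a set \<Rightarrow> real" where
  "matching_sum E w R = (\<Sum>P | partition_on R P \<and> P \<subseteq> E. \<Prod>l\<in>P. w l)"

lemma finite_matchings: "finite R \<Longrightarrow> finite {P. partition_on R P \<and> P \<subseteq> E}"
  by (rule finite_subset[of _ "Pow (Pow R)"]) (auto simp: partition_on_def)

lemma matching_sum_empty [simp]: "matching_sum E w {} = 1"
proof -
  have "{P. partition_on {} P \<and> P \<subseteq> E} = {{}}"
    by (auto simp: partition_on_def)
  then show ?thesis
    by (simp add: matching_sum_def)
qed

lemma partition_on_image:
  assumes "partition_on R P" "inj_on h R"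
  shows "partition_on (h ` R) ((`) h ` P)"
proof -
  have "partition_on (h ` R) ((`) h ` P - {{}})"
    by (rule partition_on_inj_image[OF assms])
  moreover have "{} \<notin> (`) h ` P"
    using partition_onD3[OF assms(1)] by auto
  ultimately show ?thesis by simp
qed

text \<open>Serves all changes of coordinates: the coding of unit triangles by pairs, the shift of a
  quartered hexagon by one unit and the reflection of the lower part.\<close>

lemma matching_sum_image:
  assumes inj: "inj_on h R"
    and E: "\<And>l. l \<subseteq> R \<Longrightarrow> l \<noteq> {} \<Longrightarrow> h ` l \<in> E' \<longleftrightarrow> l \<in> E"
    and w: "\<And>l. l \<subseteq> R \<Longrightarrow> l \<in> E \<Longrightarrow> w' (h ` l) = w l"
  shows "matching_sum E' w' (h ` R) = matching_sum E w R"
proof -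
  let ?A = "{P. partition_on R P \<and> P \<subseteq> E}"
  let ?B = "{P. partition_on (h ` R) P \<and> P \<subseteq> E'}"
  define g where "g = inv_into R h"
  have hg: "inj_on g (h ` R)" "g ` h ` R = R"
    unfolding g_def using inj inv_into_image_cancel[OF inj subset_refl] by (auto simp: inj_on_inv_into)
  have gh: "g ` (h ` l) = l" if "l \<subseteq> R" for l
    unfolding g_def using that inj by (meson inv_into_image_cancel)
  have hg': "h ` (g ` l) = l" if "l \<subseteq> h ` R" for l
    unfolding g_def using that by (meson image_inv_into_cancel)
  have pR: "l \<subseteq> S" if "partition_on S P" "l \<in> P" for l S and P :: "'z set set"
    using that by (auto simp: partition_on_def)
  have injp: "inj_on ((`) h) P" if "P \<in> ?A" for P
  proof (rule inj_onI)
    fix l m assume "l \<in> P" "m \<in> P" "h ` l = h ` m"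
    moreover from this have "l \<subseteq> R" "m \<subseteq> R" using pR[of R P] that by blast+
    ultimately show "l = m" by (metis gh)
  qed
  show ?thesis
    unfolding matching_sum_def
  proof (rule sum.reindex_bij_witness[of _ "\<lambda>P. (`) h ` P" "\<lambda>P. (`) g ` P"])
    fix P assume P: "P \<in> ?B"
    then have sub: "l \<subseteq> h ` R" if "l \<in> P" for l using pR that by blast
    show hgP: "(`) h ` (`) g ` P = P"
      using hg' sub by (simp add: image_image)
    have p1: "partition_on R ((`) g ` P)"
      using partition_on_image[of "h ` R" P g] P hg by auto
    moreover have "(`) g ` P \<subseteq> E"
    proof
      fix l assume l: "l \<in> (`) g ` P"
      then have "l \<subseteq> R" "l \<noteq> {}" using p1 by (auto simp: partition_on_def)
      moreover have "h ` l \<in> E'" using l P hgP by blast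
      ultimately show "l \<in> E" using E by blast
    qed
    ultimately show gP: "(`) g ` P \<in> ?A" by simp
    have "prod w' P = prod w' ((`) h ` (`) g ` P)" by (simp only: hgP)
    also have "\<dots> = (\<Prod>l\<in>(`) g ` P. w' (h ` l))"
      by (subst prod.reindex[OF injp[OF gP]]) simp
    also have "\<dots> = prod w ((`) g ` P)"
    proof (rule prod.cong[OF refl])
      fix l assume "l \<in> (`) g ` P"
      then have "l \<subseteq> R" "l \<in> E" using gP pR[OF p1] by auto
      then show "w' (h ` l) = w l" by (rule w)
    qed
    finally show "prod w ((`) g ` P) = prod w' P" by simp
  next
    fix P assume P: "P \<in> ?A"
    then have sub: "l \<subseteq> R" if "l \<in> P" for l using pR that by blast
    show "(`) g ` (`) h ` P = P"
      using gh sub by (simp add: image_image)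
    have "partition_on (h ` R) ((`) h ` P)"
      using partition_on_image P inj by auto
    moreover have "(`) h ` P \<subseteq> E'"
    proof
      fix l assume "l \<in> (`) h ` P"
      then obtain m where m: "m \<in> P" "l = h ` m" by auto
      moreover have "m \<noteq> {}" "m \<in> E" using P m by (auto simp: partition_on_def)
      ultimately show "l \<in> E'" using E sub by blast
    qed
    ultimately show "(`) h ` P \<in> ?B" by simp
  qed
qed

text \<open>A partition is determined by the crossing pairs that it uses and by its blocks inside
  each of the two sides. \<open>X\<close> indexes the possible crossing pairs, with
  \<open>f s\<close> in \<open>A\<close> and \<open>g s\<close> in \<open>B\<close>. This one cut
  gives the row recursion, the cut along k = 0 and the removal of forced pairs.\<close>

lemma matching_sum_split:
  assumes finA: "finite A" and finB: "finite B" and AB: "A \<inter> B = {}"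
    and injf: "inj_on f X" and injg: "inj_on g X" and fA: "f ` X \<subseteq> A" and gB: "g ` X \<subseteq> B"
    and cross: "\<And>l. l \<in> E \<Longrightarrow> l \<subseteq> A \<union> B \<Longrightarrow> l \<subseteq> A \<or> l \<subseteq> B \<or> (\<exists>s\<in>X. l = {f s, g s})"
    and crossE: "\<And>s. s \<in> X \<Longrightarrow> {f s, g s} \<in> E"
  shows "matching_sum E w (A \<union> B) =
    (\<Sum>S\<in>Pow X. (\<Prod>s\<in>S. w {f s, g s}) * matching_sum E w (A - f ` S) * matching_sum E w (B - g ` S))"
proof -
  define PM where "PM R = {P. partition_on R P \<and> P \<subseteq> E}" for R
  define cr where "cr S = (\<lambda>s. {f s, g s}) ` S" for S
  have finX: "finite X" using finA injf fA by (metis finite_subset finite_image_iff)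
  have disjfg: "f s \<noteq> g t" if "s \<in> X" "t \<in> X" for s t using that fA gB AB by blast
  have injcr: "inj_on (\<lambda>s. {f s, g s}) X"
    using disjfg injf by (auto simp: inj_on_def doubleton_eq_iff)
  have Ucr: "\<Union> (cr S) = f ` S \<union> g ` S" for S by (auto simp: cr_def)
  have PMD: "l \<subseteq> R" "l \<noteq> {}" "l \<in> E" "\<Union>P = R" if "P \<in> PM R" "l \<in> P" for P R l
    using that by (auto simp: PM_def partition_on_def)
  have PMdis: "l = m" if "P \<in> PM R" "l \<in> P" "m \<in> P" "x \<in> l" "x \<in> m" for P R l m x
    using that by (auto simp: PM_def partition_on_def disjoint_def)
  have crA: "\<not> l \<subseteq> A" "\<not> l \<subseteq> B" if "l \<in> cr X" for l
    using that fA gB AB by (auto simp: cr_def)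
  have crmono: "cr S \<subseteq> cr X" if "S \<subseteq> X" for S using that by (auto simp: cr_def)
  have *: "(\<Prod>s\<in>S. w {f s, g s}) * matching_sum E w (A - f ` S) * matching_sum E w (B - g ` S) =
      (\<Sum>(P, Q)\<in>PM (A - f ` S) \<times> PM (B - g ` S). (\<Prod>s\<in>S. w {f s, g s}) * prod w P * prod w Q)" for S
    unfolding matching_sum_def PM_def[symmetric] sum.cartesian_product[symmetric]
    by (simp add: sum_distrib_left[symmetric] sum_distrib_right[symmetric])
  have fin: "finite (PM R)" if "finite R" for R
    unfolding PM_def by (rule finite_matchings[OF that])
  have "(\<Sum>S\<in>Pow X. (\<Prod>s\<in>S. w {f s, g s}) * matching_sum E w (A - f ` S) * matching_sum E w (B - g ` S))
     = (\<Sum>(S, P, Q)\<in>(SIGMA S:Pow X. PM (A - f ` S) \<times> PM (B - g ` S)).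
          (\<Prod>s\<in>S. w {f s, g s}) * prod w P * prod w Q)"
    unfolding * by (subst sum.Sigma) (use finX finA finB fin in \<open>auto simp: case_prod_unfold\<close>)
  also have "\<dots> = (\<Sum>P\<in>PM (A \<union> B). prod w P)"
  \<comment> \<open>A block inside one side and a crossing pair can never be confused, since
    \<open>A\<close> and \<open>B\<close> are disjoint; this makes the two maps mutually
    inverse.\<close>
  proof (rule sum.reindex_bij_witness[of _
        "\<lambda>P. ({s\<in>X. {f s, g s} \<in> P}, {l\<in>P. l \<subseteq> A}, {l\<in>P. l \<subseteq> B})"
        "\<lambda>(S, P, Q). cr S \<union> P \<union> Q"])
    fix t assume "t \<in> (SIGMA S:Pow X. PM (A - f ` S) \<times> PM (B - g ` S))"
    then obtain S P Q where t: "t = (S, P, Q)" and S: "S \<subseteq> X"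
      and P: "P \<in> PM (A - f ` S)" and Q: "Q \<in> PM (B - g ` S)" by auto
    have PA: "l \<subseteq> A" "l \<noteq> {}" "l \<inter> f ` S = {}" if "l \<in> P" for l using PMD[OF P that] by auto
    have QB: "l \<subseteq> B" "l \<noteq> {}" "l \<inter> g ` S = {}" if "l \<in> Q" for l using PMD[OF Q that] by auto
    have UP: "\<Union>P = A - f ` S" using P by (auto simp: PM_def partition_on_def)
    have UQ: "\<Union>Q = B - g ` S" using Q by (auto simp: PM_def partition_on_def)
    have crS: "\<not> l \<subseteq> A" "\<not> l \<subseteq> B" if "l \<in> cr S" for l using crA crmono[OF S] that by auto
    have nA: "\<not> l \<subseteq> A" if "l \<in> Q" for l using QB[OF that] AB by blast
    have nB: "\<not> l \<subseteq> B" if "l \<in> P" for l using PA[OF that] AB by blast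
    have dis1: "cr S \<inter> P = {}" "(cr S \<union> P) \<inter> Q = {}"
    proof -
      show "cr S \<inter> P = {}" using crS(1) PA(1) by (auto simp del: subset_iff)
      show "(cr S \<union> P) \<inter> Q = {}"
      proof (intro equals0I)
        fix l assume "l \<in> (cr S \<union> P) \<inter> Q"
        then show False using crS(2)[of l] QB(1)[of l] PA(1)[of l] nA[of l] by auto
      qed
    qed
    have e1: "{s\<in>X. {f s, g s} \<in> cr S \<union> P \<union> Q} = S"
    proof -
      have "{f s, g s} \<notin> P \<union> Q" if "s \<in> X" for s
      proof -
        have "{f s, g s} \<in> cr X" using that by (auto simp: cr_def)
        from crA[OF this] show ?thesis using PA(1)[of "{f s, g s}"] QB(1)[of "{f s, g s}"] by auto
      qed
      moreover have "{f s, g s} \<in> cr S \<longleftrightarrow> s \<in> S" if "s \<in> X" for s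
        using that injcr S unfolding cr_def by (auto simp: inj_on_def)
      ultimately show ?thesis using S by auto
    qed
    have e2: "{l \<in> cr S \<union> P \<union> Q. l \<subseteq> A} = P" using PA(1) nA crS(1) by auto
    have e3: "{l \<in> cr S \<union> P \<union> Q. l \<subseteq> B} = Q" using QB(1) nB crS(2) by auto
    show "(\<lambda>P. ({s\<in>X. {f s, g s} \<in> P}, {l\<in>P. l \<subseteq> A}, {l\<in>P. l \<subseteq> B}))
        ((\<lambda>(S, P, Q). cr S \<union> P \<union> Q) t) = t"
      using e1 e2 e3 by (simp add: t)
    have "partition_on (A \<union> B) (cr S \<union> P \<union> Q)"
    proof (rule partition_onI)
      show "\<Union> (cr S \<union> P \<union> Q) = A \<union> B"
      proof -
        have "f ` S \<subseteq> A" "g ` S \<subseteq> B" using S fA gB by blast+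
        then show ?thesis using Ucr[of S] UP UQ by (simp only: Union_Un_distrib) blast
      qed
      show "{} \<notin> cr S \<union> P \<union> Q"
        using PA(2)[of "{}"] QB(2)[of "{}"] by (auto simp: cr_def)
      fix p q assume pq: "p \<in> cr S \<union> P \<union> Q" "q \<in> cr S \<union> P \<union> Q" "p \<noteq> q"
      have i1: "p \<inter> q = {}" if pq: "p \<in> cr S" "q \<in> cr S" "p \<noteq> q" for p q
      proof -
        obtain s s' where s: "p = {f s, g s}" "q = {f s', g s'}" "s \<in> S" "s' \<in> S" "s \<noteq> s'"
          using pq unfolding cr_def by blast
        moreover have "s \<in> X" "s' \<in> X" using s S by auto
        moreover from this have "f s \<noteq> f s'" "g s \<noteq> g s'"
          using injf injg s(5) by (auto dest: inj_onD)
        ultimately show ?thesis using disjfg[of s s'] disjfg[of s' s] by auto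
      qed
      have i2: "p \<inter> q = {}" if "p \<in> P" "q \<in> P" "p \<noteq> q" for p q using that PMdis[OF P] by blast
      have i3: "p \<inter> q = {}" if "p \<in> Q" "q \<in> Q" "p \<noteq> q" for p q using that PMdis[OF Q] by blast
      have i4: "p \<inter> q = {}" if "p \<in> cr S" "q \<in> P" for p q
      proof -
        from that(1) obtain s where "s \<in> S" "p = {f s, g s}" by (auto simp: cr_def)
        moreover from this have "g s \<in> B" using S gB by blast
        ultimately show ?thesis using PA[OF that(2)] AB by blast
      qed
      have i5: "p \<inter> q = {}" if "p \<in> cr S" "q \<in> Q" for p q
      proof -
        from that(1) obtain s where "s \<in> S" "p = {f s, g s}" by (auto simp: cr_def)
        moreover from this have "f s \<in> A" using S fA by blast
        ultimately show ?thesis using QB[OF that(2)] AB by blast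
      qed
      have i6: "p \<inter> q = {}" if "p \<in> P" "q \<in> Q" for p q
        using that PA[of p] QB[of q] AB by auto
      show "disjnt p q" unfolding disjnt_def
        using pq i1 i2 i3 i4[of p q] i4[of q p] i5[of p q] i5[of q p] i6[of p q] i6[of q p]
        by (elim UnE) (simp_all add: Int_commute)
    qed
    moreover have "cr S \<union> P \<union> Q \<subseteq> E"
      using P Q S crossE by (auto simp: PM_def cr_def)
    ultimately show "(\<lambda>(S, P, Q). cr S \<union> P \<union> Q) t \<in> PM (A \<union> B)" by (simp add: t PM_def)
    have finP: "finite P" "finite Q" "finite (cr S)"
      using P Q finA finB finX S by (auto simp: PM_def cr_def intro: finite_elements finite_subset)
    have "prod w (cr S \<union> P \<union> Q) = prod w (cr S) * prod w P * prod w Q"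
      using dis1 finP by (simp add: prod.union_disjoint)
    also have "prod w (cr S) = (\<Prod>s\<in>S. w {f s, g s})"
      unfolding cr_def using inj_on_subset[OF injcr S] by (simp add: prod.reindex)
    finally show "prod w ((\<lambda>(S, P, Q). cr S \<union> P \<union> Q) t) =
        (case t of (S, P, Q) \<Rightarrow> (\<Prod>s\<in>S. w {f s, g s}) * prod w P * prod w Q)"
      by (simp add: t)
  next
    fix P assume P: "P \<in> PM (A \<union> B)"
    let ?S = "{s\<in>X. {f s, g s} \<in> P}"
    have sub: "l \<subseteq> A \<or> l \<subseteq> B \<or> (\<exists>s\<in>X. l = {f s, g s})" if "l \<in> P" for l
      using cross PMD[OF P that] by blast
    show "(\<lambda>(S, P, Q). cr S \<union> P \<union> Q) (?S, {l\<in>P. l \<subseteq> A}, {l\<in>P. l \<subseteq> B}) = P"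
      using sub by (auto simp: cr_def)
    have UP: "\<Union>P = A \<union> B" using P by (auto simp: PM_def partition_on_def)
    have dis: "disjnt l m" if "l \<in> P" "m \<in> P" "l \<noteq> m" for l m
      using PMdis[OF P that(1,2)] that(3) by (auto simp: disjnt_def)
    have "partition_on (A - f ` ?S) {l\<in>P. l \<subseteq> A}"
    proof (rule partition_onI)
      show "\<Union>{l\<in>P. l \<subseteq> A} = A - f ` ?S"
      proof (intro equalityI subsetI)
        fix x assume "x \<in> \<Union>{l\<in>P. l \<subseteq> A}"
        then obtain l where l: "l \<in> P" "l \<subseteq> A" "x \<in> l" by auto
        have "x \<notin> f ` ?S"
        proof
          assume "x \<in> f ` ?S"
          then obtain s where s: "s \<in> X" "{f s, g s} \<in> P" "x = f s" by auto
          then have "l = {f s, g s}" using PMdis[OF P l(1) s(2)] l(3) by auto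
          then show False using l(2) s(1) gB AB by auto
        qed
        then show "x \<in> A - f ` ?S" using l by auto
      next
        fix x assume x: "x \<in> A - f ` ?S"
        then obtain l where l: "l \<in> P" "x \<in> l" using UP by auto
        then have "l \<subseteq> A" using sub[OF l(1)] x AB gB by auto
        then show "x \<in> \<Union>{l\<in>P. l \<subseteq> A}" using l by auto
      qed
    qed (use PMD(2)[OF P] dis in auto)
    moreover have "partition_on (B - g ` ?S) {l\<in>P. l \<subseteq> B}"
    proof (rule partition_onI)
      show "\<Union>{l\<in>P. l \<subseteq> B} = B - g ` ?S"
      proof (intro equalityI subsetI)
        fix x assume "x \<in> \<Union>{l\<in>P. l \<subseteq> B}"
        then obtain l where l: "l \<in> P" "l \<subseteq> B" "x \<in> l" by auto
        have "x \<notin> g ` ?S"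
        proof
          assume "x \<in> g ` ?S"
          then obtain s where s: "s \<in> X" "{f s, g s} \<in> P" "x = g s" by auto
          then have "l = {f s, g s}" using PMdis[OF P l(1) s(2)] l(3) by auto
          then show False using l(2) s(1) fA AB by auto
        qed
        then show "x \<in> B - g ` ?S" using l by auto
      next
        fix x assume x: "x \<in> B - g ` ?S"
        then obtain l where l: "l \<in> P" "x \<in> l" using UP by auto
        then have "l \<subseteq> B" using sub[OF l(1)] x AB fA by auto
        then show "x \<in> \<Union>{l\<in>P. l \<subseteq> B}" using l by auto
      qed
    qed (use PMD(2)[OF P] dis in auto)
    moreover have "P \<subseteq> E" using P by (simp add: PM_def)
    ultimately show "(?S, {l\<in>P. l \<subseteq> A}, {l\<in>P. l \<subseteq> B}) \<in> (SIGMA S:Pow X. PM (A - f ` S) \<times> PM (B - g ` S))"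
      by (auto simp: PM_def)
  qed
  finally show ?thesis by (simp add: matching_sum_def PM_def)
qed

lemma matching_sum_zero:
  assumes "x \<in> R" "\<And>l. l \<in> E \<Longrightarrow> l \<subseteq> R \<Longrightarrow> x \<notin> l"
  shows "matching_sum E w R = 0"
proof -
  have "{P. partition_on R P \<and> P \<subseteq> E} = {}"
    using assms by (force simp: partition_on_def)
  then show ?thesis unfolding matching_sum_def by (simp only: sum.empty)
qed

text \<open>Split off the single cell \<open>x\<close>, with one potential crossing, indexed by the
  unit type. Without the crossing \<open>x\<close> would have to be covered inside
  \<open>{x}\<close>, which is impossible because its only block also contains
  \<open>y\<close>.\<close>

lemma matching_sum_forced:
  assumes fin: "finite R" and xy: "x \<in> R" "y \<in> R" "x \<noteq> y" and E: "{x, y} \<in> E"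
    and uniq: "\<And>l. l \<in> E \<Longrightarrow> x \<in> l \<Longrightarrow> l \<subseteq> R \<Longrightarrow> l = {x, y}"
  shows "matching_sum E w R = w {x, y} * matching_sum E w (R - {x, y})"
proof -
  have R: "{x} \<union> (R - {x}) = R" using xy by auto
  have z: "matching_sum E w {x} = 0"
  proof (rule matching_sum_zero[of x])
    fix l assume "l \<in> E" "l \<subseteq> {x}"
    then show "x \<notin> l" using uniq[of l] xy by auto
  qed simp
  have "matching_sum E w ({x} \<union> (R - {x})) = (\<Sum>S\<in>Pow {()}. (\<Prod>s\<in>S. w {(\<lambda>_. x) s, (\<lambda>_. y) s}) *
     matching_sum E w ({x} - (\<lambda>_. x) ` S) * matching_sum E w ((R - {x}) - (\<lambda>_. y) ` S))"
  proof (rule matching_sum_split)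
    fix l assume l: "l \<in> E" "l \<subseteq> {x} \<union> (R - {x})"
    show "l \<subseteq> {x} \<or> l \<subseteq> R - {x} \<or> (\<exists>s\<in>{()}. l = {x, y})"
      using uniq[OF l(1)] l(2) R by blast
  qed (use fin xy E in auto)
  also have "Pow {()} = {{}, {()}}" by auto
  finally have "matching_sum E w R = w {x, y} * matching_sum E w (R - {x} - {y})"
    using xy(1) by (simp add: z insert_absorb)
  moreover have "R - {x} - {y} = R - {x, y}" by auto
  ultimately show ?thesis by simp
qed

text \<open>Uniqueness is only demanded inside the full region. It survives the removal of earlier
  pairs, because a smaller region admits fewer blocks.\<close>

lemma matching_sum_forced_set:
  assumes "finite X" "finite R" "inj_on f X" "inj_on g X" "f ` X \<subseteq> R" "g ` X \<subseteq> R" "f ` X \<inter> g ` X = {}"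
    and "\<And>x. x \<in> X \<Longrightarrow> {f x, g x} \<in> E \<and> w {f x, g x} = 1"
    and "\<And>x l. x \<in> X \<Longrightarrow> l \<in> E \<Longrightarrow> f x \<in> l \<Longrightarrow> l \<subseteq> R \<Longrightarrow> l = {f x, g x}"
  shows "matching_sum E w R = matching_sum E w (R - f ` X - g ` X)"
  using assms
proof (induction X arbitrary: R rule: finite_induct)
  case empty
  then show ?case by simp
next
  case (insert x X)
  have fg: "f x \<noteq> g x" using insert.prems(6) by auto
  have "matching_sum E w R = w {f x, g x} * matching_sum E w (R - {f x, g x})"
    by (rule matching_sum_forced) (use insert.prems fg in auto)
  also have "\<dots> = matching_sum E w (R - {f x, g x})"
    using insert.prems(7)[of x] by simp
  also have "\<dots> = matching_sum E w (R - {f x, g x} - f ` X - g ` X)"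
  proof (rule insert.IH)
    have "f x \<notin> f ` X" "g x \<notin> g ` X"
      using insert.prems(2,3) insert.hyps(2) by (auto simp: inj_on_def)
    then show "f ` X \<subseteq> R - {f x, g x}" "g ` X \<subseteq> R - {f x, g x}"
      using insert.prems(4-6) by blast+
  next
    fix x' l assume "x' \<in> X" "l \<in> E" "f x' \<in> l" "l \<subseteq> R - {f x, g x}"
    then show "l = {f x', g x'}" using insert.prems(8)[of x' l] by auto
  qed (use insert.prems in auto)
  also have "R - {f x, g x} - f ` X - g ` X = R - f ` insert x X - g ` insert x X" by auto
  finally show ?case .
qed

section \<open>Interlacing sets\<close>

definition below :: "int set \<Rightarrow> int \<Rightarrow> nat" where
  "below W x = card {w\<in>W. w < x}"

text \<open>Counting functions instead of enumerations: adding or deleting an extreme point then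
  becomes arithmetic with \<open>below\<close>. The parity condition reflects that the positions in
  consecutive rows are offset by half a unit.\<close>

definition interlacing :: "int set \<Rightarrow> int set set" where
  "interlacing W = {T. finite W \<and> finite T \<and> card W = Suc (card T) \<and> (\<forall>t\<in>T. \<forall>w\<in>W. odd (t - w)) \<and>
     (\<forall>x\<in>W. below T x = below W x) \<and> (\<forall>x\<in>T. below W x = Suc (below T x))}"

lemma below_step: "finite W \<Longrightarrow> below W (x + 1) = below W x + (if x \<in> W then 1 else 0)"
proof -
  assume fin: "finite W"
  have "{w\<in>W. w < x + 1} = {w\<in>W. w < x} \<union> (if x \<in> W then {x} else {})"
    by (auto simp: order_le_less)
  then show ?thesis using fin by (auto simp: below_def)
qed

lemma below_all: "(\<And>w. w \<in> W \<Longrightarrow> w < x) \<Longrightarrow> below W x = card W"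
  unfolding below_def by (rule arg_cong[of _ _ card]) auto

lemma below_none: "(\<And>w. w \<in> W \<Longrightarrow> x \<le> w) \<Longrightarrow> below W x = 0"
  unfolding below_def by (auto simp: card_eq_0_iff dest: leD)

lemma below_insert: "finite W \<Longrightarrow> v \<notin> W \<Longrightarrow> below (insert v W) x = below W x + (if v < x then 1 else 0)"
proof -
  assume fin: "finite W" and v: "v \<notin> W"
  have "{w\<in>insert v W. w < x} = (if v < x then insert v {w\<in>W. w < x} else {w\<in>W. w < x})" by auto
  then show ?thesis using fin v by (auto simp: below_def)
qed

lemma below_pos_iff: "finite W \<Longrightarrow> 0 < below W x \<longleftrightarrow> (\<exists>w\<in>W. w < x)"
  by (auto simp: below_def card_gt_0_iff)

lemma interlacing_ranges:
  assumes "T \<in> interlacing W" "t \<in> T"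
  obtains w w' where "w \<in> W" "w' \<in> W" "w < t" "t < w'"
proof -
  have fin: "finite W" "finite T" and b: "below W t = Suc (below T t)" and c: "card W = Suc (card T)"
    using assms by (auto simp: interlacing_def)
  obtain w where w: "w \<in> W" "w < t" using below_pos_iff[OF fin(1), of t] b by auto
  have "below T t < card T"
    unfolding below_def using fin assms(2) by (intro psubset_card_mono) auto
  then have "below W t \<noteq> card W" using b c by simp
  then obtain w' where w': "w' \<in> W" "\<not> w' < t" using below_all[of W t] by blast
  \<comment> \<open>Counting gives only \<open>t \<le> w'\<close>; opposite parity excludes
    equality.\<close>
  have "odd (t - w')" using assms w' by (auto simp: interlacing_def)
  then have "t \<noteq> w'" by auto
  with w w' show ?thesis by (intro that[of w w']) auto
qed

lemma interlacing_between:
  assumes T: "T \<in> interlacing W" and w: "w \<in> W" "w' \<in> W" "w < w'" "\<And>v. v \<in> W \<Longrightarrow> w < v \<Longrightarrow> w' \<le> v"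
  shows "\<exists>!t. t \<in> T \<and> w < t \<and> t < w'"
proof -
  have fin: "finite W" "finite T" using T by (auto simp: interlacing_def)
  have "{v\<in>W. v < w'} = insert w {v\<in>W. v < w}" using w by force
  then have "below W w' = Suc (below W w)" using fin by (simp add: below_def)
  then have "below T w' = Suc (below T w)" using T w by (auto simp: interlacing_def)
  moreover have eq: "{t\<in>T. t < w'} = {t\<in>T. t < w} \<union> {t\<in>T. w \<le> t \<and> t < w'}" using w(3) by auto
  have "below T w' = below T w + card {t\<in>T. w \<le> t \<and> t < w'}"
    unfolding below_def eq by (rule card_Un_disjoint) (use fin in auto)
  ultimately have "card {t\<in>T. w \<le> t \<and> t < w'} = 1" by simp
  moreover have "w \<notin> T" using T w by (auto simp: interlacing_def)
  then have "{t\<in>T. w \<le> t \<and> t < w'} = {t\<in>T. w < t \<and> t < w'}" by (auto simp: order_le_less)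
  ultimately have "card {t\<in>T. w < t \<and> t < w'} = 1" by simp
  then obtain t where "{t\<in>T. w < t \<and> t < w'} = {t}" by (rule card_1_singletonE)
  then show ?thesis by (intro ex1I[of _ t]) blast+
qed

text \<open>An interlacing set is an independent choice of one point in each gap of
  \<open>W\<close>. Sums over interlacing sets thereby become sums over a product set, to which the
  multilinearity of the determinant applies.\<close>

lemma interlacing_enum:
  fixes w :: "nat \<Rightarrow> int"
  assumes mono: "\<And>i j. i < j \<Longrightarrow> j \<le> n \<Longrightarrow> w i < w j" and par: "\<And>i. i \<le> n \<Longrightarrow> even (w i - w 0)"
  defines "I \<equiv> (\<lambda>i. {t. w i < t \<and> t < w (Suc i) \<and> odd (t - w i)})"
  shows "bij_betw (\<lambda>g. g ` {..<n}) (PiE {..<n} I) (interlacing (w ` {..n}))"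
proof -
  have mono': "w i \<le> w j" if "i \<le> j" "j \<le> n" for i j using mono[of i j] that by (cases "i = j") auto
  have injw: "inj_on w {..n}"
    using mono by (intro linorder_inj_onI) (force)+
  have wiff: "w i < w j \<longleftrightarrow> i < j" if "i \<le> n" "j \<le> n" for i j
    using mono[of i j] mono'[of j i] that by force
  have gI: "w i < g i" "g i < w (Suc i)" "odd (g i - w i)" if "g \<in> PiE {..<n} I" "i < n" for g i
    using that by (auto simp: I_def PiE_iff)
  have glt: "g i < w j \<longleftrightarrow> i < j" if "g \<in> PiE {..<n} I" "i < n" "j \<le> n" for g i j
    using gI[OF that(1,2)] mono'[of "Suc i" j] mono'[of j i] that by force
  have gmono: "g i < g j" if "g \<in> PiE {..<n} I" "i < j" "j < n" for g i j
    using gI[OF that(1,3)] glt[of g i j] that by force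
  have ginj: "inj_on g {..<n}" if "g \<in> PiE {..<n} I" for g
    using gmono[OF that] by (intro linorder_inj_onI) (force)+
  have uniq: "g i = x" if "g \<in> PiE {..<n} I" "i < n" and x: "x \<in> g ` {..<n}" and "w i < x" "x < w (Suc i)" for g i x
  proof -
    obtain j where j: "j < n" "x = g j" using x by auto
    have "j < Suc i" using glt[of g j "Suc i"] that j by auto
    moreover have "\<not> j < i" using glt[of g j i] that j by auto
    ultimately have "j = i" by simp
    then show ?thesis using j by simp
  qed
  show ?thesis
  proof (rule bij_betw_imageI)
    show "inj_on (\<lambda>g. g ` {..<n}) (PiE {..<n} I)"
    proof (rule inj_onI)
      fix g h assume gh: "g \<in> PiE {..<n} I" "h \<in> PiE {..<n} I" "g ` {..<n} = h ` {..<n}"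
      have "g i = h i" if "i < n" for i
        using uniq[OF gh(1) that, of "h i"] gI[OF gh(2) that] gh(3) that by auto
      then show "g = h" using gh by (intro PiE_ext[of _ _ I]) auto
    qed
    show "(\<lambda>g. g ` {..<n}) ` PiE {..<n} I = interlacing (w ` {..n})"
    proof (intro equalityI subsetI)
      fix T assume "T \<in> (\<lambda>g. g ` {..<n}) ` PiE {..<n} I"
      then obtain g where g: "g \<in> PiE {..<n} I" and T: "T = g ` {..<n}" by auto
      have cT: "card T = n" using ginj[OF g] by (simp add: T card_image)
      have cW: "card (w ` {..n}) = Suc n" using injw by (simp add: card_image)
      have bT: "below T (w i) = i" if "i \<le> n" for i
      proof -
        have "{t\<in>T. t < w i} = g ` {..<i}" using glt[OF g] that by (auto simp: T)
        then show ?thesis using that card_image[OF inj_on_subset[OF ginj[OF g]]] by (simp add: below_def subset_iff)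
      qed
      have bW: "below (w ` {..n}) (w i) = i" if "i \<le> n" for i
      proof -
        have "{v\<in>w ` {..n}. v < w i} = w ` {..<i}" using wiff that by auto
        then show ?thesis using that card_image[OF inj_on_subset[OF injw]] by (simp add: below_def subset_iff)
      qed
      have bW': "below (w ` {..n}) (g i) = Suc i" if "i < n" for i
      proof -
        have "w j < g i \<longleftrightarrow> j \<le> i" if "j \<le> n" for j
          using glt[OF g \<open>i < n\<close> that] gI[OF g \<open>i < n\<close>] mono'[of j i] \<open>i < n\<close> that
          by (metis not_le less_le_trans nless_le not_less_eq_eq less_imp_le le_less_trans)
        then have "{v\<in>w ` {..n}. v < g i} = w ` {..i}" using that by auto
        then show ?thesis using that card_image[OF inj_on_subset[OF injw]] by (simp add: below_def subset_iff)
      qed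
      have bT': "below T (g i) = i" if "i < n" for i
      proof -
        have "g j < g i \<longleftrightarrow> j < i" if "j < n" for j
          using gmono[OF g, of i j] gmono[OF g, of j i] \<open>i < n\<close> that by (metis less_asym nat_neq_iff order_less_irrefl)
        then have "{t\<in>T. t < g i} = g ` {..<i}" using that by (auto simp: T)
        then show ?thesis using that card_image[OF inj_on_subset[OF ginj[OF g]]] by (simp add: below_def subset_iff)
      qed
      have "odd (g i - w j)" if "i < n" "j \<le> n" for i j
      proof -
        have "g i - w j = (g i - w i) + (w i - w 0) - (w j - w 0)" by simp
        then show ?thesis using gI(3)[OF g that(1)] par[of i] par[of j] that by (simp only: odd_add even_diff) auto
      qed
      then show "T \<in> interlacing (w ` {..n})"
        using cT cW bT bW bT' bW' by (auto simp: interlacing_def T)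
    next
      fix T assume T: "T \<in> interlacing (w ` {..n})"
      have ex: "\<exists>!t. t \<in> T \<and> w i < t \<and> t < w (Suc i)" if "i < n" for i
        by (rule interlacing_between[OF T]) (use that wiff mono' mono in \<open>auto simp: Suc_le_eq\<close>)
      define g where "g = (\<lambda>i\<in>{..<n}. THE t. t \<in> T \<and> w i < t \<and> t < w (Suc i))"
      have g: "g i \<in> T \<and> w i < g i \<and> g i < w (Suc i)" if "i < n" for i
        using theI'[OF ex[OF that]] that by (simp add: g_def)
      have odd: "odd (t - w i)" if "t \<in> T" "i \<le> n" for t i using T that by (auto simp: interlacing_def)
      have gP: "g \<in> PiE {..<n} I" using g odd by (auto simp: I_def PiE_iff g_def)
      have "finite T" "card T = n"
        using T injw by (auto simp: interlacing_def card_image)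
      moreover have "g ` {..<n} \<subseteq> T" using g by auto
      moreover have "card (g ` {..<n}) = n" using ginj[OF gP] by (simp add: card_image)
      ultimately have "g ` {..<n} = T" by (metis card_subset_eq)
      then show "T \<in> (\<lambda>g. g ` {..<n}) ` PiE {..<n} I" using gP by auto
    qed
  qed
qed

text \<open>Both sides say that the points of \<open>S\<close> and \<open>V\<close> alternate,
  starting with \<open>S\<close> and ending with \<open>V\<close>. The outer points
  \<open>lo\<close> and \<open>hi\<close> only supply the additional element that the definition
  requires. This symmetry allows a double sum to be evaluated in two orders.\<close>

lemma interlacing_dual:
  assumes fin: "finite S" "finite V" and lo: "\<And>x. x \<in> S \<union> V \<Longrightarrow> lo < x" and hi: "\<And>x. x \<in> S \<union> V \<Longrightarrow> x < hi"
    and odd: "\<And>s. s \<in> S \<Longrightarrow> odd (s - lo)" "\<And>s. s \<in> S \<Longrightarrow> even (s - hi)"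
      "\<And>v. v \<in> V \<Longrightarrow> even (v - lo)" "\<And>v. v \<in> V \<Longrightarrow> odd (v - hi)"
  shows "S \<in> interlacing (insert lo V) \<longleftrightarrow> V \<in> interlacing (insert hi S)"
proof -
  have nin: "lo \<notin> V" "hi \<notin> S" "lo \<notin> S" "hi \<notin> V" using lo hi by blast+
  have par: "odd (s - v)" "odd (v - s)" if "s \<in> S" "v \<in> V" for s v
    using odd(1)[OF that(1)] odd(3)[OF that(2)] by presburger+
  have lo': "lo < x" "x < hi" if "x \<in> S \<or> x \<in> V" for x using lo hi that by auto
  have b: "below S lo = 0" "below V lo = 0" "below S hi = card S" "below V hi = card V"
    using lo' by (auto intro!: below_none below_all less_imp_le)
  show ?thesis
    unfolding interlacing_def
    using fin nin par odd b lo' by (auto simp: below_insert less_imp_le[THEN leD])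
qed

text \<open>Here both sides say that the points alternate, starting and ending with
  \<open>S\<close>, so that \<open>V\<close> has one point fewer.\<close>

lemma interlacing_dual':
  assumes fin: "finite S" "finite V" and lo: "\<And>x. x \<in> S \<union> V \<Longrightarrow> lo < x" and hi: "\<And>x. x \<in> S \<union> V \<Longrightarrow> x < hi"
    and lohi: "lo < hi"
    and odd: "\<And>s. s \<in> S \<Longrightarrow> odd (s - lo)" "\<And>s. s \<in> S \<Longrightarrow> odd (s - hi)"
      "\<And>v. v \<in> V \<Longrightarrow> even (v - lo)"
  shows "S \<in> interlacing (insert lo (insert hi V)) \<longleftrightarrow> V \<in> interlacing S"
proof -
  have nin: "lo \<notin> V" "hi \<notin> S" "lo \<notin> S" "hi \<notin> V" "lo \<noteq> hi" using lo hi lohi by blast+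
  have par: "odd (s - v)" "odd (v - s)" if "s \<in> S" "v \<in> V" for s v
    using odd(1)[OF that(1)] odd(3)[OF that(2)] by presburger+
  have lo': "lo < x" "x < hi" if "x \<in> S \<or> x \<in> V" for x using lo hi that by auto
  have b: "below S lo = 0" "below V lo = 0" "below S hi = card S" "below V hi = card V"
    using lo' by (auto intro!: below_none below_all less_imp_le)
  have i: "below (insert lo (insert hi V)) x = Suc (below V x)" if "x \<in> S \<or> x \<in> V" for x
    using lo'[OF that] fin nin by (simp add: below_insert)
  have "below (insert lo (insert hi V)) lo = 0" "below (insert lo (insert hi V)) hi = Suc (card V)"
    using fin nin b lohi by (simp_all add: below_insert)
  note i = i this
  have "\<forall>t\<in>S. \<forall>w\<in>insert lo (insert hi V). odd (t - w)" "\<forall>t\<in>V. \<forall>w\<in>S. odd (t - w)"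
    using par odd by blast+
  note p = this
  show ?thesis
  proof
    assume "S \<in> interlacing (insert lo (insert hi V))"
    then have a: "card (insert lo (insert hi V)) = Suc (card S)"
      "\<forall>x\<in>insert lo (insert hi V). below S x = below (insert lo (insert hi V)) x"
      "\<forall>x\<in>S. below (insert lo (insert hi V)) x = Suc (below S x)"
      unfolding interlacing_def by blast+
    show "V \<in> interlacing S"
      unfolding interlacing_def mem_Collect_eq by (intro conjI p fin) (use a i fin nin in auto)
  next
    assume "V \<in> interlacing S"
    then have a: "card S = Suc (card V)" "\<forall>x\<in>S. below V x = below S x"
      "\<forall>x\<in>V. below S x = Suc (below V x)"
      unfolding interlacing_def by blast+
    show "S \<in> interlacing (insert lo (insert hi V))"
      unfolding interlacing_def mem_Collect_eq by (intro conjI p fin) (use a i b fin nin in auto)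
  qed
qed

text \<open>The gap between \<open>w\<close> and \<open>w + 2\<close> contains a single position of
  the right parity, so its point is forced.\<close>

lemma interlacing_peel_left:
  assumes V: "finite V" "w + 2 \<in> V" "\<And>v. v \<in> V \<Longrightarrow> w + 2 \<le> v"
  shows "interlacing (insert w V) = insert (w + 1) ` interlacing V"
proof (intro equalityI subsetI)
  have wV: "w \<notin> V" using V(3) by force
  fix T assume T: "T \<in> interlacing (insert w V)"
  have "\<exists>!t. t \<in> T \<and> w < t \<and> t < w + 2"
    by (rule interlacing_between[OF T]) (use V in auto)
  then obtain t where "t \<in> T" "w < t" "t < w + 2" by auto
  moreover from this have "t = w + 1" by simp
  ultimately have w1: "w + 1 \<in> T" by simp
  have ge: "w + 1 \<le> t" if t: "t \<in> T" for t
    by (rule interlacing_ranges[OF T t]) (use V(3) in force)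
  define T' where "T' = T - {w + 1}"
  have TT': "T = insert (w + 1) T'" "w + 1 \<notin> T'" using w1 by (auto simp: T'_def)
  have fin: "finite T'" using T by (simp add: T'_def interlacing_def)
  have ge': "w + 1 < x" if "x \<in> V" for x using V(3)[OF that] by simp
  have ge2: "w + 1 < x" "w < x" if "x \<in> T'" for x using ge[of x] that by (auto simp: T'_def)
  have i: "below (insert w V) x = Suc (below V x)" "below (insert (w + 1) T') x = Suc (below T' x)"
    if "x \<in> V \<or> x \<in> T'" for x
    using ge'[of x] ge2[of x] V(1) wV fin TT'(2) that by (auto simp: below_insert)
  have "T' \<in> interlacing V"
    using T V(1) wV fin TT'(2) i unfolding TT'(1) interlacing_def by auto
  then show "T \<in> insert (w + 1) ` interlacing V" using TT' by auto
next
  have wV: "w \<notin> V" using V(3) by force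
  fix T assume "T \<in> insert (w + 1) ` interlacing V"
  then obtain T' where T': "T' \<in> interlacing V" and T: "T = insert (w + 1) T'" by auto
  have ge: "w + 2 < t" if t: "t \<in> T'" for t
    by (rule interlacing_ranges[OF T' t]) (use V(3) in force)
  then have n: "w + 1 \<notin> T'" by force
  have fin: "finite T'" using T' by (simp add: interlacing_def)
  have parT: "odd (t - v)" if "t \<in> T'" "v \<in> V" for t v
    using T' that unfolding interlacing_def by blast
  \<comment> \<open>The parity of \<open>V\<close> is not assumed. It is read off from any point of
    \<open>T'\<close>; if there is none, \<open>V\<close> is the singleton
    \<open>{w + 2}\<close>.\<close>
  have par: "even (v - w)" if "v \<in> V" for v
  proof (cases "T' = {}")
    case True
    then have "card V = 1" using T' by (simp add: interlacing_def)
    then have "v = w + 2" using V(2) that by (auto simp: card_1_singleton_iff)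
    then show ?thesis by simp
  next
    case False
    then obtain t where "t \<in> T'" by auto
    then have "odd (t - v)" "odd (t - (w + 2))" using parT that V(2) by blast+
    then show ?thesis by presburger
  qed
  have par': "odd (w + 1 - v)" if "v \<in> V" for v using par[OF that] by presburger
  have par2: "odd (t - w)" if "t \<in> T'" for t
  proof -
    have "odd (t - (w + 2))" using parT that V(2) by blast
    then show ?thesis by presburger
  qed
  have b: "below T' (w + 1) = 0" "below T' w = 0" "below V (w + 1) = 0" "below V w = 0"
    by (auto intro!: below_none dest!: ge V(3))
  have ge3: "w + 1 < x" "w < x" if "x \<in> V \<or> x \<in> T'" for x using ge[of x] V(3)[of x] that by auto
  show "T \<in> interlacing (insert w V)"
    using T' V(1) wV fin n b par' par2 ge3 unfolding T interlacing_def
    by (auto simp: below_insert)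
qed

lemma interlacing_peel_right:
  assumes V: "finite V" "w - 2 \<in> V" "\<And>v. v \<in> V \<Longrightarrow> v \<le> w - 2"
  shows "interlacing (insert w V) = insert (w - 1) ` interlacing V"
proof (intro equalityI subsetI)
  have wV: "w \<notin> V" using V(3) by force
  fix T assume T: "T \<in> interlacing (insert w V)"
  have "\<exists>!t. t \<in> T \<and> w - 2 < t \<and> t < w"
    by (rule interlacing_between[OF T]) (use V in force)+
  then obtain t where "t \<in> T" "w - 2 < t" "t < w" by auto
  moreover from this have "t = w - 1" by simp
  ultimately have w1: "w - 1 \<in> T" by simp
  have le: "t \<le> w - 1" if t: "t \<in> T" for t
    by (rule interlacing_ranges[OF T t]) (use V(3) in force)
  define T' where "T' = T - {w - 1}"
  have TT': "T = insert (w - 1) T'" "w - 1 \<notin> T'" using w1 by (auto simp: T'_def)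
  have fin: "finite T'" using T by (simp add: T'_def interlacing_def)
  have le': "x < w - 1" "x < w" "\<not> w - 1 < x" "\<not> w < x" if "x \<in> V \<or> x \<in> T'" for x
    using V(3)[of x] le[of x] that by (force simp: T'_def)+
  show "T \<in> insert (w - 1) ` interlacing V"
  proof -
    have "T' \<in> interlacing V"
      using T V(1) wV fin TT'(2) le' unfolding TT'(1) interlacing_def
      by (auto simp: below_insert split: if_splits)
    then show ?thesis using TT' by auto
  qed
next
  have wV: "w \<notin> V" using V(3) by force
  fix T assume "T \<in> insert (w - 1) ` interlacing V"
  then obtain T' where T': "T' \<in> interlacing V" and T: "T = insert (w - 1) T'" by auto
  have le: "t < w - 2" if t: "t \<in> T'" for t
    by (rule interlacing_ranges[OF T' t]) (use V(3) in force)
  then have n: "w - 1 \<notin> T'" by force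
  have fin: "finite T'" using T' by (simp add: interlacing_def)
  have parT: "odd (t - v)" if "t \<in> T'" "v \<in> V" for t v
    using T' that unfolding interlacing_def by blast
  have par: "even (v - w)" if "v \<in> V" for v
  proof (cases "T' = {}")
    case True
    then have "card V = 1" using T' by (simp add: interlacing_def)
    then have "v = w - 2" using V(2) that by (auto simp: card_1_singleton_iff)
    then show ?thesis by simp
  next
    case False
    then obtain t where "t \<in> T'" by auto
    then have "odd (t - v)" "odd (t - (w - 2))" using parT that V(2) by blast+
    then show ?thesis by presburger
  qed
  have par': "odd (w - 1 - v)" if "v \<in> V" for v using par[OF that] by presburger
  have par2: "odd (t - w)" if "t \<in> T'" for t
  proof -
    have "odd (t - (w - 2))" using parT that V(2) by blast
    then show ?thesis by presburger
  qed
  have b: "below T' (w - 1) = card T'" "below T' w = card T'" "below V (w - 1) = card V" "below V w = card V"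
    by (auto intro!: below_all dest!: le V(3))
  have le3: "\<not> w - 1 < x" "\<not> w < x" if "x \<in> V \<or> x \<in> T'" for x using le[of x] V(3)[of x] that by auto
  show "T \<in> interlacing (insert w V)"
    using T' V(1) wV fin n b par' par2 le3 unfolding T interlacing_def
    by (auto simp: below_insert)
qed

section \<open>Vandermonde determinants over interlacing sets\<close>

definition newton :: "(nat \<Rightarrow> real) \<Rightarrow> nat \<Rightarrow> real \<Rightarrow> real" where
  "newton \<alpha> j x = (\<Prod>r<j. x - \<alpha> r)"

lemma newton_Suc [simp]: "newton \<alpha> (Suc j) x = newton \<alpha> j x * (x - \<alpha> j)"
  by (simp add: newton_def)

lemma newton_0 [simp]: "newton \<alpha> 0 x = 1"
  by (simp add: newton_def)

text \<open>What counts is the leading coefficient 1: the transition matrix between two Newton bases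
  is unitriangular and leaves determinants unchanged.\<close>

lemma newton_change_basis:
  "\<exists>c. (\<forall>x. newton \<alpha> j x = (\<Sum>k\<le>j. c k * newton \<beta> k x)) \<and> c j = (1::real)"
proof (induction j)
  case 0
  show ?case by (intro exI[of _ "\<lambda>_. 1"]) simp
next
  case (Suc j)
  then obtain c where c: "\<And>x. newton \<alpha> j x = (\<Sum>k\<le>j. c k * newton \<beta> k x)" "c j = 1" by auto
  \<comment> \<open>The coefficients come from
    \<open>x - \<alpha> j = (x - \<beta> k) + (\<beta> k - \<alpha> j)\<close>: the first summand
    raises the degree of a basis element by one, the second is a constant.\<close>
  define d where "d k = (if k = 0 then 0 else c (k - 1)) + (if k \<le> j then c k * (\<beta> k - \<alpha> j) else 0)" for k
  have "newton \<alpha> (Suc j) x = (\<Sum>k\<le>Suc j. d k * newton \<beta> k x)" for x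
  proof -
    have "newton \<alpha> (Suc j) x = (\<Sum>k\<le>j. c k * newton \<beta> k x * (x - \<alpha> j))"
      by (simp only: newton_Suc c(1) sum_distrib_right)
    also have "\<dots> = (\<Sum>k\<le>j. c k * newton \<beta> (Suc k) x + c k * (\<beta> k - \<alpha> j) * newton \<beta> k x)"
      by (intro sum.cong refl) (simp add: algebra_simps)
    also have "\<dots> = (\<Sum>k\<le>j. c k * newton \<beta> (Suc k) x) + (\<Sum>k\<le>j. c k * (\<beta> k - \<alpha> j) * newton \<beta> k x)"
      by (rule sum.distrib)
    also have "(\<Sum>k\<le>j. c k * newton \<beta> (Suc k) x) = (\<Sum>k\<le>Suc j. (if k = 0 then 0 else c (k - 1)) * newton \<beta> k x)"
      by (simp only: sum.atMost_Suc_shift) simp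
    also have "(\<Sum>k\<le>j. c k * (\<beta> k - \<alpha> j) * newton \<beta> k x) =
        (\<Sum>k\<le>Suc j. (if k \<le> j then c k * (\<beta> k - \<alpha> j) else 0) * newton \<beta> k x)"
      by (simp only: sum.atMost_Suc) simp
    finally show ?thesis
      by (simp only: d_def distrib_right sum.distrib)
  qed
  moreover have "d (Suc j) = 1" by (simp add: d_def c)
  ultimately show ?case by blast
qed

text \<open>Pass to the Newton basis whose nodes are the points \<open>x\<close> themselves. There
  the matrix is lower triangular, as \<open>newton x k (x i)\<close> contains the factor
  \<open>x i - x i\<close> for \<open>i < k\<close>, and its diagonal is the Vandermonde
  product.\<close>

lemma det_newton:
  fixes x :: "nat \<Rightarrow> real"
  shows "det (mat n n (\<lambda>(i, j). newton \<alpha> j (x i))) = (\<Prod>j<n. \<Prod>i<j. x j - x i)"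
proof -
  obtain c where c: "\<And>j y. newton \<alpha> j y = (\<Sum>k\<le>j. c j k * newton x k y)" "\<And>j. c j j = 1"
    using newton_change_basis[of \<alpha> _ x] by metis
  let ?M = "mat n n (\<lambda>(i, k). newton x k (x i))"
  let ?C = "mat n n (\<lambda>(k, j). if k \<le> j then c j k else 0)"
  have "mat n n (\<lambda>(i, j). newton \<alpha> j (x i)) = ?M * ?C"
  proof (rule eq_matI)
    fix i j assume "i < dim_row (?M * ?C)" "j < dim_col (?M * ?C)"
    then have ij: "i < n" "j < n" by auto
    have "(\<Sum>k<n. newton x k (x i) * (if k \<le> j then c j k else 0)) = (\<Sum>k\<le>j. c j k * newton x k (x i))"
      using ij by (intro sum.mono_neutral_cong_right) auto
    then show "mat n n (\<lambda>(i, j). newton \<alpha> j (x i)) $$ (i, j) = (?M * ?C) $$ (i, j)"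
      using ij c(1) by (simp add: scalar_prod_def lessThan_atLeast0)
  qed auto
  then have "det (mat n n (\<lambda>(i, j). newton \<alpha> j (x i))) = det ?M * det ?C"
    by (simp add: det_mult[of _ n])
  also have "det ?C = 1"
  proof -
    have "det ?C = prod_list (diag_mat ?C)"
      by (rule det_upper_triangular[of _ n]) (auto simp: upper_triangular_def)
    also have "\<dots> = 1" by (simp add: prod_list_diag_prod c(2))
    finally show ?thesis .
  qed
  also have "det ?M = prod_list (diag_mat ?M)"
    by (rule det_lower_triangular[of n]) (auto simp: newton_def intro!: prod_zero)
  also have "\<dots> = (\<Prod>j<n. \<Prod>i<j. x j - x i)"
    by (simp add: prod_list_diag_prod newton_def lessThan_atLeast0)
  finally show ?thesis by simp
qed

section \<open>Row operations and multilinearity of determinants\<close>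

lemma det_row_differences:
  fixes f :: "nat \<Rightarrow> nat \<Rightarrow> real"
  shows "det (mat n n (\<lambda>(i, j). f i j - (if i = 0 then 0 else f (i - 1) j))) = det (mat n n (\<lambda>(i, j). f i j))"
proof -
  let ?L = "mat n n (\<lambda>(i, k). if k = i then 1 else if Suc k = i then - 1 else 0 :: real)"
  let ?F = "mat n n (\<lambda>(i, j). f i j)"
  have "mat n n (\<lambda>(i, j). f i j - (if i = 0 then 0 else f (i - 1) j)) = ?L * ?F"
  proof (rule eq_matI)
    fix i j assume "i < dim_row (?L * ?F)" "j < dim_col (?L * ?F)"
    then have ij: "i < n" "j < n" by auto
    have "(\<Sum>k<n. (if k = i then 1 else if Suc k = i then - 1 else 0) * f k j) =
        (\<Sum>k<n. (if k = i then f k j else 0) + (if Suc k = i then - f k j else 0))"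
      by (intro sum.cong) auto
    also have "\<dots> = (\<Sum>k<n. if k = i then f k j else 0) + (\<Sum>k<n. if Suc k = i then - f k j else 0)"
      by (rule sum.distrib)
    also have "(\<Sum>k<n. if k = i then f k j else 0) = f i j" using ij by simp
    also have "(\<Sum>k<n. if Suc k = i then - f k j else 0) = - (if i = 0 then 0 else f (i - 1) j)"
    proof (cases i)
      case (Suc i')
      then have "(\<Sum>k<n. if Suc k = i then - f k j else 0) = (\<Sum>k<n. if k = i' then - f k j else 0)"
        by (intro sum.cong) auto
      then show ?thesis using ij Suc by simp
    qed simp
    finally show "mat n n (\<lambda>(i, j). f i j - (if i = 0 then 0 else f (i - 1) j)) $$ (i, j) = (?L * ?F) $$ (i, j)"
      using ij by (simp add: scalar_prod_def lessThan_atLeast0)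
  qed auto
  then have "det (mat n n (\<lambda>(i, j). f i j - (if i = 0 then 0 else f (i - 1) j))) = det ?L * det ?F"
    by (simp add: det_mult[of _ n])
  also have "det ?L = prod_list (diag_mat ?L)"
    by (rule det_lower_triangular[of n]) auto
  also have "\<dots> = 1" by (simp add: prod_list_diag_prod)
  finally show ?thesis by simp
qed

text \<open>Row differences turn the constant column into the first unit vector. So a Vandermonde
  determinant of n + 1 points is a determinant of size n whose rows belong to the n gaps between
  them.\<close>

lemma det_bordered:
  fixes f :: "nat \<Rightarrow> nat \<Rightarrow> real"
  assumes "\<And>i. f i 0 = 1"
  shows "det (mat n n (\<lambda>(i, j). f (Suc i) (Suc j) - f i (Suc j))) = det (mat (Suc n) (Suc n) (\<lambda>(i, j). f i j))"
proof -
  let ?A = "mat (Suc n) (Suc n) (\<lambda>(i, j). f i j - (if i = 0 then 0 else f (i - 1) j))"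
  have "det ?A = (\<Sum>i<Suc n. ?A $$ (i, 0) * cofactor ?A i 0)"
    by (rule laplace_expansion_column[of _ "Suc n"]) auto
  also have "\<dots> = cofactor ?A 0 0"
    by (subst sum.lessThan_Suc_shift) (simp add: assms)
  also have "\<dots> = det (mat_delete ?A 0 0)"
    by (simp add: cofactor_def)
  also have "mat_delete ?A 0 0 = mat n n (\<lambda>(i, j). f (Suc i) (Suc j) - f i (Suc j))"
    by (rule eq_matI) (auto simp: mat_delete_def)
  finally show ?thesis by (simp only: det_row_differences)
qed

lemma det_scale_rows:
  "det (mat n n (\<lambda>(i, j). c i * f i j)) = (\<Prod>i<n. c i) * det (mat n n (\<lambda>(i, j). f i j :: real))"
  by (auto simp: det_def sum_distrib_left prod.distrib lessThan_atLeast0 permutes_in_image[where S = "{0..<n}"]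
      intro!: sum.cong simp: mult_ac intro: prod.cong)

lemma det_scale_cols:
  "det (mat n n (\<lambda>(i, j). d j * f i j)) = (\<Prod>j<n. d j) * det (mat n n (\<lambda>(i, j). f i j :: real))"
proof -
  let ?F = "mat n n (\<lambda>(i, j). f i j)"
  have "det (mat n n (\<lambda>(i, j). d j * f i j)) = det (transpose_mat (mat n n (\<lambda>(i, j). d j * f i j)))"
    by (rule det_transpose[symmetric, of _ n]) simp
  also have "transpose_mat (mat n n (\<lambda>(i, j). d j * f i j)) = mat n n (\<lambda>(i, j). d i * f j i)"
    by (rule eq_matI) auto
  also have "det \<dots> = (\<Prod>j<n. d j) * det (mat n n (\<lambda>(i, j). f j i))"
    by (rule det_scale_rows)
  also have "mat n n (\<lambda>(i, j). f j i) = transpose_mat ?F"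
    by (rule eq_matI) auto
  also have "det \<dots> = det ?F"
    by (rule det_transpose[of _ n]) simp
  finally show ?thesis .
qed

lemma det_sum_rows:
  fixes a :: "'b \<Rightarrow> nat \<Rightarrow> real"
  assumes "\<And>i. i < n \<Longrightarrow> finite (I i)"
  shows "det (mat n n (\<lambda>(i, j). \<Sum>t\<in>I i. a t j)) = (\<Sum>g\<in>PiE {..<n} I. det (mat n n (\<lambda>(i, j). a (g i) j)))"
proof -
  have "det (mat n n (\<lambda>(i, j). \<Sum>t\<in>I i. a t j)) =
      (\<Sum>p | p permutes {0..<n}. signof p * (\<Prod>i<n. \<Sum>t\<in>I i. a t (p i)))"
    by (auto simp: det_def lessThan_atLeast0 intro!: sum.cong prod.cong)
  also have "\<dots> = (\<Sum>p | p permutes {0..<n}. \<Sum>g\<in>PiE {..<n} I. signof p * (\<Prod>i<n. a (g i) (p i)))"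
    using assms by (intro sum.cong refl, subst prod_sum_PiE) (auto simp: sum_distrib_left)
  also have "\<dots> = (\<Sum>g\<in>PiE {..<n} I. \<Sum>p | p permutes {0..<n}. signof p * (\<Prod>i<n. a (g i) (p i)))"
    by (rule sum.swap)
  also have "\<dots> = (\<Sum>g\<in>PiE {..<n} I. det (mat n n (\<lambda>(i, j). a (g i) j)))"
    by (auto simp: det_def lessThan_atLeast0 intro!: sum.cong prod.cong)
  finally show ?thesis .
qed

text \<open>In the next four lemmas \<open>newton (\<lambda>r. (r + 1 / 2)\<^sup>2) j\<close> and \<open>newton (\<lambda>r. (r + 1)\<^sup>2) j\<close> are central factorials,
  which central differences map to one another.\<close>

lemma newton_half_shift:
  "newton (\<lambda>r. (real r + 1 / 2)\<^sup>2) (Suc j) ((u + 1 / 2)\<^sup>2) = u * (u + j + 1) * newton (\<lambda>r. (real r + 1)\<^sup>2) j (u\<^sup>2)"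
  "newton (\<lambda>r. (real r + 1 / 2)\<^sup>2) (Suc j) ((u - 1 / 2)\<^sup>2) = u * (u - j - 1) * newton (\<lambda>r. (real r + 1)\<^sup>2) j (u\<^sup>2)"
proof (induction j)
  case 0
  {
    case 1
    show ?case by (simp add: power2_eq_square algebra_simps)
  next
    case 2
    show ?case by (simp add: power2_eq_square algebra_simps)
  }
next
  case (Suc j)
  {
    case 1
    show ?case
    proof -
      have "u * (u + j + 1) * p * ((u + 1 / 2)\<^sup>2 - (real (Suc j) + 1 / 2)\<^sup>2) =
          u * (u + Suc j + 1) * (p * (u\<^sup>2 - (real j + 1)\<^sup>2))" for p
        by (simp add: power2_eq_square field_simps)
      then show ?thesis
        by (simp only: newton_Suc[of _ "Suc j"] Suc.IH(1)) (simp only: newton_Suc)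
    qed
  next
    case 2
    show ?case
    proof -
      have "u * (u - j - 1) * p * ((u - 1 / 2)\<^sup>2 - (real (Suc j) + 1 / 2)\<^sup>2) =
          u * (u - Suc j - 1) * (p * (u\<^sup>2 - (real j + 1)\<^sup>2))" for p
        by (simp add: power2_eq_square field_simps)
      then show ?thesis
        by (simp only: newton_Suc[of _ "Suc j"] Suc.IH(2)) (simp only: newton_Suc)
    qed
  }
qed

lemma newton_half_difference:
  "newton (\<lambda>r. (real r + 1 / 2)\<^sup>2) (Suc j) ((u + 1 / 2)\<^sup>2) - newton (\<lambda>r. (real r + 1 / 2)\<^sup>2) (Suc j) ((u - 1 / 2)\<^sup>2)
   = 2 * (j + 1) * (u * newton (\<lambda>r. (real r + 1)\<^sup>2) j (u\<^sup>2))"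
  unfolding newton_half_shift by (simp add: algebra_simps)

lemma newton_int_shift:
  "(u + 1 / 2) * newton (\<lambda>r. (real r + 1)\<^sup>2) j ((u + 1 / 2)\<^sup>2) = (u + j + 1 / 2) * newton (\<lambda>r. (real r + 1 / 2)\<^sup>2) j (u\<^sup>2)"
  "(u - 1 / 2) * newton (\<lambda>r. (real r + 1)\<^sup>2) j ((u - 1 / 2)\<^sup>2) = (u - j - 1 / 2) * newton (\<lambda>r. (real r + 1 / 2)\<^sup>2) j (u\<^sup>2)"
proof (induction j)
  case (Suc j)
  {
    case 1
    show ?case
    proof -
      have "(u + j + 1 / 2) * p * ((u + 1 / 2)\<^sup>2 - (real j + 1)\<^sup>2) =
          (u + Suc j + 1 / 2) * (p * (u\<^sup>2 - (real j + 1 / 2)\<^sup>2))" for p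
        by (simp add: power2_eq_square field_simps)
      then show ?thesis
        by (simp only: newton_Suc mult.assoc[symmetric] Suc.IH(1))
    qed
  next
    case 2
    show ?case
    proof -
      have "(u - j - 1 / 2) * p * ((u - 1 / 2)\<^sup>2 - (real j + 1)\<^sup>2) =
          (u - Suc j - 1 / 2) * (p * (u\<^sup>2 - (real j + 1 / 2)\<^sup>2))" for p
        by (simp add: power2_eq_square field_simps)
      then show ?thesis
        by (simp only: newton_Suc mult.assoc[symmetric] Suc.IH(2))
    qed
  }
qed simp_all

lemma newton_int_difference:
  "(u + 1 / 2) * newton (\<lambda>r. (real r + 1)\<^sup>2) j ((u + 1 / 2)\<^sup>2) - (u - 1 / 2) * newton (\<lambda>r. (real r + 1)\<^sup>2) j ((u - 1 / 2)\<^sup>2)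
   = (2 * j + 1) * newton (\<lambda>r. (real r + 1 / 2)\<^sup>2) j (u\<^sup>2)"
  unfolding newton_int_shift by (simp add: algebra_simps)

section \<open>Sums of Vandermonde products over interlacing sets\<close>

lemma finite_int_between: "finite {t::int. w < t \<and> t < w' \<and> P t}"
  by (rule finite_subset[of _ "{w<..<w'}"]) auto

text \<open>The points of opposite parity between \<open>w\<close> and \<open>w'\<close> are the
  midpoints of the steps of length 2 leading from \<open>w\<close> to \<open>w'\<close>.\<close>

lemma sum_telescope_step2:
  fixes w w' :: int and F :: "int \<Rightarrow> real"
  assumes "\<And>t. f t = F (t + 1) - F (t - 1)" "w \<le> w'" "even (w' - w)"
  shows "(\<Sum>t | w < t \<and> t < w' \<and> odd (t - w). f t) = F w' - F w"
proof -
  obtain m where m: "w' = w + 2 * int m"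
  proof -
    obtain k where k: "w' - w = 2 * k" using assms(3) by (elim evenE)
    then show ?thesis using assms(2) by (intro that[of "nat k"]) simp
  qed
  have "(\<Sum>t | w < t \<and> t < w + 2 * int m \<and> odd (t - w). f t) = F (w + 2 * int m) - F w"
  proof (induction m)
    case 0
    have "{t. w < t \<and> t < w + 2 * int 0 \<and> odd (t - w)} = {}" by auto
    then show ?case by (simp only: sum.empty) simp
  next
    case (Suc m)
    have "{t. w < t \<and> t < w + 2 * int (Suc m) \<and> odd (t - w)} =
        insert (w + 2 * int m + 1) {t. w < t \<and> t < w + 2 * int m \<and> odd (t - w)}"
    proof (intro equalityI subsetI)
      fix t assume "t \<in> {t. w < t \<and> t < w + 2 * int (Suc m) \<and> odd (t - w)}"
      then have t: "w < t" "t < w + 2 * int m + 2" "odd (t - w)" by auto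
      then have "t \<noteq> w + 2 * int m" by auto
      with t show "t \<in> insert (w + 2 * int m + 1) {t. w < t \<and> t < w + 2 * int m \<and> odd (t - w)}" by force
    qed auto
    moreover have "w + 2 * int m + 1 \<notin> {t. w < t \<and> t < w + 2 * int m \<and> odd (t - w)}" by simp
    ultimately show ?case
      using Suc.IH assms(1)[of "w + 2 * int m + 1"] by (simp add: finite_int_between algebra_simps)
  qed
  then show ?thesis by (simp add: m)
qed

text \<open>\<open>p\<close> is a doubled abscissa. The square makes every polynomial in
  \<open>lam\<close> invariant under reflection in the vertical line through 0, as the zigzag wall
  demands.\<close>

definition lam :: "int \<Rightarrow> real" where
  "lam p = (p / 2)\<^sup>2"

definition vdm :: "int set \<Rightarrow> real" where
  "vdm U = (\<Prod>q\<in>U. \<Prod>p\<in>{p\<in>U. p < q}. lam q - lam p)"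

text \<open>The determinant of the odd powers of p/2 for increasing p, as \<open>vdm\<close> is that
  of the even powers.\<close>

definition ovdm :: "int set \<Rightarrow> real" where
  "ovdm U = (\<Prod>p\<in>U. p / 2) * vdm U"

lemma vdm_enum:
  fixes w :: "nat \<Rightarrow> int"
  assumes "\<And>i j. i < j \<Longrightarrow> j < n \<Longrightarrow> w i < w j"
  shows "vdm (w ` {..<n}) = (\<Prod>j<n. \<Prod>i<j. lam (w j) - lam (w i))"
proof -
  have inj: "inj_on w {..<n}" using assms by (intro linorder_inj_onI) force+
  have "{p \<in> w ` {..<n}. p < w j} = w ` {..<j}" if "j < n" for j
  proof -
    have "w i < w j \<longleftrightarrow> i < j" if "i < n" for i
      using assms[of i j] assms[of j i] that \<open>j < n\<close> by (cases i j rule: linorder_cases) auto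
    then show ?thesis using that by auto
  qed
  then have "vdm (w ` {..<n}) = (\<Prod>j<n. \<Prod>p\<in>w ` {..<j}. lam (w j) - lam p)"
    unfolding vdm_def by (simp add: prod.reindex[OF inj])
  also have "\<dots> = (\<Prod>j<n. \<Prod>i<j. lam (w j) - lam (w i))"
    by (intro prod.cong refl, subst prod.reindex) (auto intro: inj_on_subset[OF inj])
  finally show ?thesis .
qed

lemma finite_enum:
  fixes W :: "int set"
  assumes "finite W" "card W = n"
  obtains w :: "nat \<Rightarrow> int" where "\<And>i j. i < j \<Longrightarrow> j < n \<Longrightarrow> w i < w j" "W = w ` {..<n}"
proof
  let ?l = "sorted_list_of_set W"
  show "?l ! i < ?l ! j" if "i < j" "j < n" for i j
    using that assms by (intro sorted_wrt_nth_less[OF strict_sorted_list_of_set]) auto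
  show "W = (\<lambda>i. ?l ! i) ` {..<n}"
    using assms by (metis lessThan_atLeast0 list.set_map map_nth set_sorted_list_of_set length_sorted_list_of_set set_upt)
qed

text \<open>Bordering expresses \<open>vdm W\<close> by differences of even central factorials over
  the gaps. Each difference is a sum of odd central factorials over one gap, with the factor 2 (j +
  1) in column j. Expanding row by row gives the sum over \<open>T\<close>, and the column factors
  multiply to \<open>2 ^ n * fact n\<close>.\<close>

lemma sum_ovdm_interlacing:
  assumes fin: "finite W" and card: "card W = Suc n" and par: "\<And>v w. v \<in> W \<Longrightarrow> w \<in> W \<Longrightarrow> even (v - w)"
  shows "(\<Sum>T\<in>interlacing W. ovdm T) = vdm W / (2 ^ n * fact n)"
proof -
  obtain w where w: "\<And>i j. i < j \<Longrightarrow> j < Suc n \<Longrightarrow> w i < w j" "W = w ` {..<Suc n}"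
    using finite_enum[OF fin card] by metis
  have parw: "even (w i - w j)" if "i \<le> n" "j \<le> n" for i j
    using that by (intro par) (auto simp: w(2))
  have mono: "w i < w j" if "i < j" "j \<le> n" for i j using w(1) that by simp
  define I where "I = (\<lambda>i. {t. w i < t \<and> t < w (Suc i) \<and> odd (t - w i)})"
  have bij: "bij_betw (\<lambda>g. g ` {..<n}) (PiE {..<n} I) (interlacing W)"
    unfolding I_def w(2) lessThan_Suc_atMost by (rule interlacing_enum) (rule mono parw; simp)+
  have gmono: "g i < g j" if g: "g \<in> PiE {..<n} I" and ij: "i < j" "j < n" for g i j
  proof -
    have "g i < w (Suc i)" "w j < g j" using g ij by (auto simp: I_def PiE_iff)
    moreover have "w (Suc i) \<le> w j" using mono[of "Suc i" j] ij by (cases "Suc i = j") auto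
    ultimately show ?thesis by simp
  qed
  have ginj: "inj_on g {..<n}" if "g \<in> PiE {..<n} I" for g
    using gmono[OF that] by (intro linorder_inj_onI) force+
  define Q where "Q = newton (\<lambda>r. (real r + 1 / 2)\<^sup>2)"
  define P where "P = newton (\<lambda>r. (real r + 1)\<^sup>2)"
  \<comment> \<open>The central difference at u = t/2: the doubled abscissae \<open>t + 1\<close>
    and \<open>t - 1\<close> are u + 1/2 and u - 1/2.\<close>
  have step: "2 * (real j + 1) * (t / 2 * P j (lam t)) = Q (Suc j) (lam (t + 1)) - Q (Suc j) (lam (t - 1))" for t :: int and j
    using newton_half_difference[of j "t / 2"] by (simp add: P_def Q_def lam_def add_divide_distrib diff_divide_distrib)
  have tel: "(\<Sum>t\<in>I i. 2 * (real j + 1) * (t / 2 * P j (lam t))) = Q (Suc j) (lam (w (Suc i))) - Q (Suc j) (lam (w i))"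
    if "i < n" for i j
    unfolding I_def
    by (rule sum_telescope_step2[OF step]) (use mono[of i "Suc i"] parw[of "Suc i" i] that in auto)
  have "vdm W = det (mat (Suc n) (Suc n) (\<lambda>(i, j). Q j (lam (w i))))"
    unfolding w(2) Q_def by (subst vdm_enum[OF w(1)]) (auto simp: det_newton)
  also have "\<dots> = det (mat n n (\<lambda>(i, j). Q (Suc j) (lam (w (Suc i))) - Q (Suc j) (lam (w i))))"
    by (rule det_bordered[symmetric]) (simp add: Q_def)
  also have "mat n n (\<lambda>(i, j). Q (Suc j) (lam (w (Suc i))) - Q (Suc j) (lam (w i))) =
      mat n n (\<lambda>(i, j). \<Sum>t\<in>I i. 2 * (real j + 1) * (t / 2 * P j (lam t)))"
    by (rule eq_matI) (simp_all only: index_mat dim_row_mat dim_col_mat prod.case tel)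
  also have "det \<dots> = (\<Sum>g\<in>PiE {..<n} I. det (mat n n (\<lambda>(i, j). 2 * (real j + 1) * (g i / 2 * P j (lam (g i))))))"
    by (rule det_sum_rows) (auto simp: I_def finite_int_between)
  also have "\<dots> = (\<Sum>g\<in>PiE {..<n} I. (\<Prod>j<n. 2 * (real j + 1)) * ovdm (g ` {..<n}))"
  proof (rule sum.cong[OF refl])
    fix g assume g: "g \<in> PiE {..<n} I"
    have "det (mat n n (\<lambda>(i, j). 2 * (real j + 1) * (g i / 2 * P j (lam (g i))))) =
        (\<Prod>j<n. 2 * (real j + 1)) * ((\<Prod>i<n. g i / 2) * det (mat n n (\<lambda>(i, j). P j (lam (g i)))))"
      by (simp only: det_scale_cols[of n "\<lambda>j. 2 * (real j + 1)"] det_scale_rows[of n "\<lambda>i. g i / 2"])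
    also have "det (mat n n (\<lambda>(i, j). P j (lam (g i)))) = vdm (g ` {..<n})"
      unfolding P_def det_newton by (rule vdm_enum[symmetric]) (use gmono[OF g] in auto)
    also have "(\<Prod>i<n. g i / 2) * vdm (g ` {..<n}) = ovdm (g ` {..<n})"
      unfolding ovdm_def by (subst prod.reindex[OF ginj[OF g]]) simp
    finally show "det (mat n n (\<lambda>(i, j). 2 * (real j + 1) * (g i / 2 * P j (lam (g i))))) =
        (\<Prod>j<n. 2 * (real j + 1)) * ovdm (g ` {..<n})" .
  qed
  also have "\<dots> = (\<Prod>j<n. 2 * (real j + 1)) * (\<Sum>T\<in>interlacing W. ovdm T)"
    by (simp add: sum_distrib_left sum.reindex_bij_betw[OF bij, symmetric])
  also have "(\<Prod>j<n. 2 * (real j + 1)) = 2 ^ n * fact n"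
    by (induction n) (auto simp: algebra_simps)
  finally show ?thesis by (simp add: field_simps)
qed

lemma sum_vdm_interlacing_wall:
  fixes lo :: int
  assumes fin: "finite U" and lo: "lo = 0 \<or> lo = 1" and U: "\<And>u. u \<in> U \<Longrightarrow> lo \<le> u \<and> odd (u - lo)"
  shows "(\<Sum>V\<in>interlacing (insert (lo - 1) U). (\<Prod>v\<in>V. if v = 0 then 1 / 2 else 1) * vdm V)
    = ovdm U / (\<Prod>j<card U. 2 * real j + 1)"
proof -
  define n where "n = card U"
  obtain u where u: "\<And>i j. i < j \<Longrightarrow> j < n \<Longrightarrow> u i < u j" "U = u ` {..<n}"
    using finite_enum[OF fin n_def[symmetric]] by metis
  define w where "w i = (if i = 0 then lo - 1 else u (i - 1))" for i
  have uU: "lo \<le> u i" "odd (u i - lo)" if "i < n" for i using U[of "u i"] that u(2) by auto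
  have mono: "w i < w j" if "i < j" "j \<le> n" for i j
  proof -
    have "j - 1 < n" using that by simp
    from uU(1)[OF this] u(1)[of "i - 1" "j - 1"] that show ?thesis by (auto simp: w_def)
  qed
  have par0: "even (w i - w 0)" if "i \<le> n" for i
    using uU(2)[of "i - 1"] that by (auto simp: w_def)
  have parw: "even (w i - w j)" if "i \<le> n" "j \<le> n" for i j
    using par0[OF that(1)] par0[OF that(2)] by presburger
  have W: "insert (lo - 1) U = w ` {..n}"
  proof -
    have "w ` Suc ` {..<n} = u ` {..<n}"
      unfolding image_image by (intro image_cong) (auto simp: w_def)
    moreover have "w 0 = lo - 1" by (simp add: w_def)
    ultimately show ?thesis
      unfolding lessThan_Suc_atMost[symmetric] lessThan_Suc_eq_insert_0 u(2) by simp
  qed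
  define I where "I = (\<lambda>i. {t. w i < t \<and> t < w (Suc i) \<and> odd (t - w i)})"
  have bij: "bij_betw (\<lambda>g. g ` {..<n}) (PiE {..<n} I) (interlacing (insert (lo - 1) U))"
    unfolding I_def W by (rule interlacing_enum) (rule mono parw; simp)+
  have gmono: "g i < g j" if g: "g \<in> PiE {..<n} I" and ij: "i < j" "j < n" for g i j
  proof -
    have "g i < w (Suc i)" "w j < g j" using g ij by (auto simp: I_def PiE_iff)
    moreover have "w (Suc i) \<le> w j" using mono[of "Suc i" j] ij by (cases "Suc i = j") auto
    ultimately show ?thesis by simp
  qed
  have ginj: "inj_on g {..<n}" if "g \<in> PiE {..<n} I" for g
    using gmono[OF that] by (intro linorder_inj_onI) force+
  define Q where "Q = newton (\<lambda>r. (real r + 1 / 2)\<^sup>2)"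
  define P where "P = newton (\<lambda>r. (real r + 1)\<^sup>2)"
  define R where "R j t = t / 2 * P j (lam t)" for j and t :: int
  define om where "om t = (if t = 0 then 1 / 2 else 1 :: real)" for t :: int
  have Rneg: "R j (- t) = - R j t" for j t by (simp add: R_def lam_def)
  have step: "(2 * real j + 1) * Q j (lam t) = R j (t + 1) - R j (t - 1)" for t :: int and j
    using newton_int_difference[of "t / 2" j] by (simp add: P_def Q_def R_def lam_def add_divide_distrib diff_divide_distrib)
  have tel: "(\<Sum>t\<in>I i. (2 * real j + 1) * Q j (lam t)) = R j (w (Suc i)) - R j (w i)"
    if "i < n" for i j
    unfolding I_def
    by (rule sum_telescope_step2[OF step]) (use mono[of i "Suc i"] parw[of "Suc i" i] that in auto)
  have finI: "finite (I i)" for i by (simp add: I_def finite_int_between)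
  have omsum: "(\<Sum>t\<in>I i. (2 * real j + 1) * (om t * Q j (lam t))) =
      R j (u i) - (if i = 0 then 0 else R j (u (i - 1)))" if "i < n" for i j
  \<comment> \<open>Position 0, the only one with a weight, can occur only in the first gap, and
    there only if \<open>lo = 0\<close>.\<close>
  proof (cases "i = 0 \<and> lo = 0")
    case False
    have "i - 1 < n" using that by simp
    then have "t > 0" if "t \<in> I i" for t
      using that False uU(1)[of "i - 1"] lo by (auto simp: I_def w_def split: if_splits)
    then have "(\<Sum>t\<in>I i. (2 * real j + 1) * (om t * Q j (lam t))) = (\<Sum>t\<in>I i. (2 * real j + 1) * Q j (lam t))"
      by (intro sum.cong refl) (force simp: om_def)
    also have "\<dots> = R j (u i) - R j (w i)" by (simp add: tel[OF that] w_def)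
    also have "R j (w i) = (if i = 0 then 0 else R j (u (i - 1)))"
      using False lo by (auto simp: w_def R_def)
    finally show ?thesis .
  next
    case True
    then have wi: "w i = - 1" "w (Suc i) = u i" by (auto simp: w_def)
    \<comment> \<open>For \<open>lo = 0\<close> the point \<open>u i\<close> is odd and
      non-negative, hence positive, so the first gap does contain 0.\<close>
    have zero: "0 \<in> I i" using uU[of i] that True wi by (cases "u i = 0") (auto simp: I_def)
    have "(\<Sum>t\<in>I i. (2 * real j + 1) * (om t * Q j (lam t))) =
        (\<Sum>t\<in>I i - {0}. (2 * real j + 1) * (om t * Q j (lam t))) + (2 * real j + 1) * (1 / 2 * Q j (lam 0))"
      by (subst sum.remove[OF finI zero]) (simp add: om_def)
    also have "(\<Sum>t\<in>I i - {0}. (2 * real j + 1) * (om t * Q j (lam t))) =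
        (\<Sum>t\<in>I i - {0}. (2 * real j + 1) * Q j (lam t))"
      by (intro sum.cong refl) (simp add: om_def)
    also have "\<dots> = (R j (u i) - R j (- 1)) - (2 * real j + 1) * Q j (lam 0)"
      using tel[OF that, of j] wi by (subst (asm) sum.remove[OF finI zero]) simp
    also have "(2 * real j + 1) * (1 / 2 * Q j (lam 0)) = (2 * real j + 1) * Q j (lam 0) / 2" by simp
    also have "(2 * real j + 1) * Q j (lam 0) = R j 1 - R j (- 1)" using step[of j 0] by simp
    also have "R j (- 1) = - R j 1" by (rule Rneg)
    finally show ?thesis using True by simp
  qed
  have "ovdm U = (\<Prod>i<n. u i / 2) * det (mat n n (\<lambda>(i, j). P j (lam (u i))))"
    unfolding ovdm_def u(2) P_def det_newton
    by (subst vdm_enum[OF u(1)], simp_all, subst prod.reindex)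
      (use u(1) in \<open>auto intro!: linorder_inj_onI\<close>, force)
  also have "\<dots> = det (mat n n (\<lambda>(i, j). R j (u i)))"
    by (simp only: R_def det_scale_rows[of n "\<lambda>i. u i / 2"])
  also have "\<dots> = det (mat n n (\<lambda>(i, j). R j (u i) - (if i = 0 then 0 else R j (u (i - 1)))))"
    by (rule det_row_differences[symmetric])
  also have "mat n n (\<lambda>(i, j). R j (u i) - (if i = 0 then 0 else R j (u (i - 1)))) =
      mat n n (\<lambda>(i, j). \<Sum>t\<in>I i. (2 * real j + 1) * (om t * Q j (lam t)))"
    by (rule eq_matI) (auto simp: omsum)
  also have "det \<dots> = (\<Sum>g\<in>PiE {..<n} I. det (mat n n (\<lambda>(i, j). (2 * real j + 1) * (om (g i) * Q j (lam (g i))))))"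
    by (rule det_sum_rows) (rule finI)
  also have "\<dots> = (\<Sum>g\<in>PiE {..<n} I. (\<Prod>j<n. 2 * real j + 1) * ((\<Prod>v\<in>g ` {..<n}. om v) * vdm (g ` {..<n})))"
  proof (rule sum.cong[OF refl])
    fix g assume g: "g \<in> PiE {..<n} I"
    have "det (mat n n (\<lambda>(i, j). (2 * real j + 1) * (om (g i) * Q j (lam (g i))))) =
        (\<Prod>j<n. 2 * real j + 1) * ((\<Prod>i<n. om (g i)) * det (mat n n (\<lambda>(i, j). Q j (lam (g i)))))"
      by (simp only: det_scale_cols[of n "\<lambda>j. 2 * real j + 1"] det_scale_rows[of n "\<lambda>i. om (g i)"])
    also have "det (mat n n (\<lambda>(i, j). Q j (lam (g i)))) = vdm (g ` {..<n})"
      unfolding Q_def det_newton by (rule vdm_enum[symmetric]) (use gmono[OF g] in auto)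
    also have "(\<Prod>i<n. om (g i)) = (\<Prod>v\<in>g ` {..<n}. om v)"
      by (subst prod.reindex[OF ginj[OF g]]) simp
    finally show "det (mat n n (\<lambda>(i, j). (2 * real j + 1) * (om (g i) * Q j (lam (g i))))) =
        (\<Prod>j<n. 2 * real j + 1) * ((\<Prod>v\<in>g ` {..<n}. om v) * vdm (g ` {..<n}))" .
  qed
  also have "\<dots> = (\<Prod>j<n. 2 * real j + 1) *
      (\<Sum>V\<in>interlacing (insert (lo - 1) U). (\<Prod>v\<in>V. om v) * vdm V)"
    by (simp add: sum_distrib_left sum.reindex_bij_betw[OF bij, symmetric])
  finally have "ovdm U = (\<Prod>j<n. 2 * real j + 1) *
      (\<Sum>V\<in>interlacing (insert (lo - 1) U). (\<Prod>v\<in>V. om v) * vdm V)" .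
  moreover have "(\<Prod>j<n. 2 * real j + 1) > 0" by (intro prod_pos) auto
  ultimately show ?thesis by (simp add: om_def n_def field_simps)
qed

section \<open>A discrete Selberg sum\<close>

lemma lam_mono: "0 \<le> p \<Longrightarrow> p < q \<Longrightarrow> lam p < lam q"
  unfolding lam_def by (rule power_strict_mono) auto

lemma vdm_empty [simp]: "vdm {} = 1"
  by (simp add: vdm_def)

lemma ovdm_empty [simp]: "ovdm {} = 1"
  by (simp add: ovdm_def)

lemma vdm_pos: "(\<And>u. u \<in> U \<Longrightarrow> 0 \<le> u) \<Longrightarrow> 0 < vdm U"
  unfolding vdm_def by (intro prod_pos ballI) (auto intro: lam_mono)

lemma ovdm_pos: "(\<And>u. u \<in> U \<Longrightarrow> 0 < u) \<Longrightarrow> 0 < ovdm U"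
  unfolding ovdm_def by (intro mult_pos_pos prod_pos vdm_pos ballI) (auto simp: less_imp_le)

text \<open>The absolute value makes the factor independent of the place of \<open>b\<close> in the
  order; non-negativity ensures that \<open>lam\<close> preserves that order.\<close>

lemma vdm_insert:
  assumes fin: "finite A" and b: "b \<notin> A" "0 \<le> b" and A: "\<And>a. a \<in> A \<Longrightarrow> 0 \<le> a"
  shows "vdm (insert b A) = vdm A * (\<Prod>a\<in>A. \<bar>lam b - lam a\<bar>)"
proof -
  have "(\<Prod>p\<in>{p \<in> insert b A. p < q}. lam q - lam p) =
      (\<Prod>p\<in>{p\<in>A. p < q}. lam q - lam p) * (if b < q then lam q - lam b else 1)" if "q \<in> A" for q
  proof -
    have "{p \<in> insert b A. p < q} = (if b < q then insert b {p\<in>A. p < q} else {p\<in>A. p < q})" by auto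
    then show ?thesis using fin b by simp
  qed
  then have "vdm (insert b A) = (\<Prod>p\<in>{p \<in> insert b A. p < b}. lam b - lam p) *
      (vdm A * (\<Prod>q\<in>A. if b < q then lam q - lam b else 1))"
    using fin b by (simp add: vdm_def prod.distrib)
  also have "{p \<in> insert b A. p < b} = {p\<in>A. p < b}" by auto
  also have "(\<Prod>p\<in>{p\<in>A. p < b}. lam b - lam p) = (\<Prod>q\<in>A. if q < b then lam b - lam q else 1)"
    by (rule prod.inter_filter[OF fin])
  also have "(\<Prod>q\<in>A. if q < b then lam b - lam q else 1) * (vdm A * (\<Prod>q\<in>A. if b < q then lam q - lam b else 1)) =
      vdm A * (\<Prod>q\<in>A. (if q < b then lam b - lam q else 1) * (if b < q then lam q - lam b else 1))"
    by (simp add: prod.distrib)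
  also have "(\<Prod>q\<in>A. (if q < b then lam b - lam q else 1) * (if b < q then lam q - lam b else 1)) =
      (\<Prod>q\<in>A. \<bar>lam b - lam q\<bar>)"
  proof (rule prod.cong[OF refl])
    fix q assume q: "q \<in> A"
    then have "q \<noteq> b" using b by auto
    then have "q < b \<or> b < q" by linarith
    then show "(if q < b then lam b - lam q else 1) * (if b < q then lam q - lam b else 1) = \<bar>lam b - lam q\<bar>"
      using lam_mono[of q b] lam_mono[of b q] A[OF q] b(2) by auto
  qed
  finally show ?thesis .
qed

lemma vdm_union:
  assumes "finite A" "finite B" "A \<inter> B = {}" "\<And>a. a \<in> A \<union> B \<Longrightarrow> 0 \<le> a"
  shows "vdm (A \<union> B) = vdm A * vdm B * (\<Prod>b\<in>B. \<Prod>a\<in>A. \<bar>lam b - lam a\<bar>)"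
  using assms(2,3,4)
proof (induction B rule: finite_induct)
  case (insert b B)
  have "vdm (A \<union> insert b B) = vdm (insert b (A \<union> B))" by simp
  also have "\<dots> = vdm (A \<union> B) * (\<Prod>a\<in>A \<union> B. \<bar>lam b - lam a\<bar>)"
    by (rule vdm_insert) (use insert assms(1) in auto)
  also have "vdm (A \<union> B) = vdm A * vdm B * (\<Prod>b\<in>B. \<Prod>a\<in>A. \<bar>lam b - lam a\<bar>)"
    using insert by auto
  also have "(\<Prod>a\<in>A \<union> B. \<bar>lam b - lam a\<bar>) = (\<Prod>a\<in>A. \<bar>lam b - lam a\<bar>) * (\<Prod>a\<in>B. \<bar>lam b - lam a\<bar>)"
    by (rule prod.union_disjoint) (use insert assms(1) in auto)
  also have "vdm A * vdm B * (\<Prod>b\<in>B. \<Prod>a\<in>A. \<bar>lam b - lam a\<bar>) *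
      ((\<Prod>a\<in>A. \<bar>lam b - lam a\<bar>) * (\<Prod>a\<in>B. \<bar>lam b - lam a\<bar>)) =
      vdm A * (vdm B * (\<Prod>a\<in>B. \<bar>lam b - lam a\<bar>)) * (\<Prod>b\<in>insert b B. \<Prod>a\<in>A. \<bar>lam b - lam a\<bar>)"
    using insert.hyps by simp
  also have "vdm B * (\<Prod>a\<in>B. \<bar>lam b - lam a\<bar>) = vdm (insert b B)"
    by (rule vdm_insert[symmetric]) (use insert in auto)
  finally show ?case .
qed simp

text \<open>The density of a discrete Selberg integral in the variables \<open>lam s\<close>, with
  exponent 2 on the Vandermonde product; \<open>K\<close> contains the fixed nodes, on which the
  one-particle factors depend.\<close>

definition selberg_weight :: "int set \<Rightarrow> int set \<Rightarrow> real" where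
  "selberg_weight K S = (\<Prod>s\<in>S. s / 2 * (\<Prod>k\<in>K. \<bar>lam s - lam k\<bar>)) * (vdm S)\<^sup>2"

lemma selberg_weight_empty [simp]: "selberg_weight K {} = 1"
  by (simp add: selberg_weight_def)

text \<open>A fixed node meets each \<open>s\<close> exactly once, in the first factor if it lies in
  \<open>A\<close> and in the second if it lies in \<open>B\<close>. Hence only the union of the two
  sets interacts with \<open>S\<close>.\<close>

lemma ovdm_vdm_selberg:
  assumes "finite A" "finite B" "finite S" "A \<inter> B = {}" "A \<inter> S = {}" "B \<inter> S = {}"
    "\<And>x. x \<in> A \<union> B \<union> S \<Longrightarrow> 0 \<le> x"
  shows "ovdm (A \<union> S) * vdm (B \<union> S) = ovdm A * vdm B * selberg_weight (A \<union> B) S"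
proof -
  have "selberg_weight (A \<union> B) S = (\<Prod>s\<in>S. s / 2) * (\<Prod>s\<in>S. \<Prod>k\<in>A. \<bar>lam s - lam k\<bar>) *
      (\<Prod>s\<in>S. \<Prod>k\<in>B. \<bar>lam s - lam k\<bar>) * (vdm S)\<^sup>2"
  proof -
    have "(\<Prod>k\<in>A \<union> B. \<bar>lam s - lam k\<bar>) = (\<Prod>k\<in>A. \<bar>lam s - lam k\<bar>) * (\<Prod>k\<in>B. \<bar>lam s - lam k\<bar>)" for s
      using assms by (simp add: prod.union_disjoint)
    then show ?thesis unfolding selberg_weight_def by (simp only: prod.distrib mult.assoc)
  qed
  moreover have "vdm (A \<union> S) = vdm A * vdm S * (\<Prod>s\<in>S. \<Prod>k\<in>A. \<bar>lam s - lam k\<bar>)"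
    "vdm (B \<union> S) = vdm B * vdm S * (\<Prod>s\<in>S. \<Prod>k\<in>B. \<bar>lam s - lam k\<bar>)"
    by (rule vdm_union; use assms in auto)+
  moreover have "(\<Prod>p\<in>A \<union> S. p / 2) = (\<Prod>p\<in>A. p / 2) * (\<Prod>p\<in>S. real_of_int p / 2)"
    by (rule prod.union_disjoint) (use assms in auto)
  ultimately show ?thesis
    unfolding ovdm_def by (simp add: power2_eq_square)
qed

text \<open>The doubled abscissae of the n consecutive unit segments that form the base of a
  dent.\<close>

definition run :: "int \<Rightarrow> nat \<Rightarrow> int set" where
  "run c n = {x. c \<le> x \<and> x < c + 2 * int n \<and> even (x - c)}"

lemma run_0 [simp]: "run c 0 = {}"
  by (auto simp: run_def)

lemma finite_run [simp]: "finite (run c n)"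
  by (rule finite_subset[of _ "{c..c + 2 * int n}"]) (auto simp: run_def)

lemma run_Suc_left: "run c (Suc n) = insert c (run (c + 2) n)"
proof (rule Set.set_eqI)
  show "x \<in> run c (Suc n) \<longleftrightarrow> x \<in> insert c (run (c + 2) n)" for x
    unfolding run_def insert_iff mem_Collect_eq of_nat_Suc by presburger
qed

lemma run_Suc_right: "run c (Suc n) = insert (c + 2 * int n) (run c n)"
proof (rule Set.set_eqI)
  show "x \<in> run c (Suc n) \<longleftrightarrow> x \<in> insert (c + 2 * int n) (run c n)" for x
    unfolding run_def insert_iff mem_Collect_eq of_nat_Suc by presburger
qed

lemma run_D:
  assumes "x \<in> run c n"
  shows "c \<le> x" "x \<le> c + 2 * int n - 2" "even (x - c)"
  using assms unfolding run_def mem_Collect_eq by presburger+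

lemma run_parity: "v \<in> run c n \<Longrightarrow> w \<in> run c n \<Longrightarrow> even (v - w)"
  unfolding run_def mem_Collect_eq by presburger

lemma run_eq_image: "run c n = (\<lambda>i. c + 2 * int i) ` {..<n}"
  by (induction n) (auto simp: run_Suc_right lessThan_Suc)

lemma card_run [simp]: "card (run c n) = n"
  unfolding run_eq_image by (subst card_image) (auto simp: inj_on_def)

lemma interlacing_singleton: "interlacing {c} = {{}}"
  by (auto simp: interlacing_def below_def card_eq_0_iff)

text \<open>Inside a run every gap holds a single position, so the interlacing points there are
  forced. Only the last point of the run still takes part in a genuine choice.\<close>

lemma interlacing_run_left:
  assumes "finite V" "\<And>v. v \<in> V \<Longrightarrow> c + 2 * int m < v"
  shows "interlacing (run c (Suc m) \<union> V) = (\<union>) (run (c + 1) m) ` interlacing (insert (c + 2 * int m) V)"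
  using assms(2)
proof (induction m arbitrary: c)
  case 0
  show ?case by (simp add: run_Suc_left)
next
  case (Suc m)
  have "interlacing (run c (Suc (Suc m)) \<union> V) = interlacing (insert c (run (c + 2) (Suc m) \<union> V))"
    by (simp add: run_Suc_left[of c])
  also have "\<dots> = insert (c + 1) ` interlacing (run (c + 2) (Suc m) \<union> V)"
  proof (rule interlacing_peel_left)
    show "finite (run (c + 2) (Suc m) \<union> V)" using assms(1) by simp
    show "c + 2 \<in> run (c + 2) (Suc m) \<union> V" by (simp add: run_def)
    show "c + 2 \<le> v" if "v \<in> run (c + 2) (Suc m) \<union> V" for v
      using that Suc.prems[of v] by (auto simp: run_def)
  qed
  also have "interlacing (run (c + 2) (Suc m) \<union> V) =
      (\<union>) (run (c + 2 + 1) m) ` interlacing (insert (c + 2 + 2 * int m) V)"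
    by (rule Suc.IH) (use Suc.prems in \<open>auto simp: algebra_simps\<close>)
  also have "insert (c + 1) ` (\<union>) (run (c + 2 + 1) m) ` interlacing (insert (c + 2 + 2 * int m) V) =
      (\<union>) (run (c + 1) (Suc m)) ` interlacing (insert (c + 2 * int (Suc m)) V)"
    by (simp add: image_image run_Suc_left algebra_simps)
  finally show ?case .
qed

lemma interlacing_run_right:
  assumes "finite V" "\<And>v. v \<in> V \<Longrightarrow> v < d"
  shows "interlacing (V \<union> run d (Suc m)) = (\<lambda>T. T \<union> run (d + 1) m) ` interlacing (insert d V)"
proof (induction m)
  case 0
  show ?case by (simp add: run_Suc_left)
next
  case (Suc m)
  have "interlacing (V \<union> run d (Suc (Suc m))) = interlacing (insert (d + 2 * int (Suc m)) (V \<union> run d (Suc m)))"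
    by (simp add: run_Suc_right[of d "Suc m"])
  also have "\<dots> = insert (d + 2 * int (Suc m) - 1) ` interlacing (V \<union> run d (Suc m))"
  proof (rule interlacing_peel_right)
    show "finite (V \<union> run d (Suc m))" using assms(1) by simp
    show "d + 2 * int (Suc m) - 2 \<in> V \<union> run d (Suc m)" by (simp add: run_def)
    show "v \<le> d + 2 * int (Suc m) - 2" if "v \<in> V \<union> run d (Suc m)" for v
      using that assms(2)[of v] run_D(2)[of v d "Suc m"] by auto
  qed
  also have "\<dots> = (\<lambda>T. T \<union> run (d + 1) (Suc m)) ` interlacing (insert d V)"
    unfolding Suc.IH image_image run_Suc_right[of "d + 1"] Un_insert_right by (simp add: algebra_simps)
  finally show ?case .
qed

text \<open>The summation formula in the case of a unique interlacing set. It lets the prefactors of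
  two evaluations of one sum be compared without computing either Vandermonde product.\<close>

lemma vdm_run_ovdm: "vdm (run c (Suc m)) = 2 ^ m * fact m * ovdm (run (c + 1) m)"
proof -
  have "interlacing (run c (Suc m)) = {run (c + 1) m}"
    using interlacing_run_left[of "{}" c m] by (simp add: interlacing_singleton)
  moreover have "(\<Sum>T\<in>interlacing (run c (Suc m)). ovdm T) = vdm (run c (Suc m)) / (2 ^ m * fact m)"
    by (rule sum_ovdm_interlacing) (auto intro: run_parity simp del: even_diff)
  ultimately show ?thesis by simp
qed

text \<open>Forced points inside a run behave like fixed nodes, so the summation formula remains
  available when part of the nodes is held fixed.\<close>

lemma sum_ovdm_run_left:
  assumes "finite V" "\<And>v. v \<in> V \<Longrightarrow> c + 2 * int m < v \<and> even (v - c)"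
  shows "(\<Sum>S\<in>interlacing (insert (c + 2 * int m) V). ovdm (run (c + 1) m \<union> S)) =
    vdm (run c (Suc m) \<union> V) / (2 ^ (m + card V) * fact (m + card V))"
proof -
  have "\<not> (x \<in> run c (Suc m) \<and> x \<in> V)" for x
    using assms(2)[of x] run_D(2)[of x c "Suc m"] by auto
  then have dis: "run c (Suc m) \<inter> V = {}" by blast
  have gt: "c + 2 * int m < s" if S: "S \<in> interlacing (insert (c + 2 * int m) V)" "s \<in> S" for S s
    by (rule interlacing_ranges[OF S]) (use assms(2) in force)
  have inj: "inj_on ((\<union>) (run (c + 1) m)) (interlacing (insert (c + 2 * int m) V))"
  proof (rule inj_onI)
    fix S S' assume S: "S \<in> interlacing (insert (c + 2 * int m) V)" "S' \<in> interlacing (insert (c + 2 * int m) V)"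
      and eq: "run (c + 1) m \<union> S = run (c + 1) m \<union> S'"
    have "run (c + 1) m \<inter> S = {}" "run (c + 1) m \<inter> S' = {}"
      using gt[OF S(1)] gt[OF S(2)] by (fastforce dest: run_D(2))+
    then show "S = S'" using eq by blast
  qed
  have "(\<Sum>S\<in>interlacing (insert (c + 2 * int m) V). ovdm (run (c + 1) m \<union> S)) =
      (\<Sum>T\<in>interlacing (run c (Suc m) \<union> V). ovdm T)"
    by (subst interlacing_run_left) (use assms in \<open>auto simp: sum.reindex[OF inj]\<close>)
  also have "\<dots> = vdm (run c (Suc m) \<union> V) / (2 ^ (m + card V) * fact (m + card V))"
  proof (rule sum_ovdm_interlacing)
    show "card (run c (Suc m) \<union> V) = Suc (m + card V)"
      using assms(1) dis by (simp add: card_Un_disjoint)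
    have e: "even (v - c)" if "v \<in> run c (Suc m) \<union> V" for v
      using that assms(2)[of v] run_D(3)[of v c "Suc m"] by blast
    show "even (v - w)" if "v \<in> run c (Suc m) \<union> V" "w \<in> run c (Suc m) \<union> V" for v w
      using e[OF that(1)] e[OF that(2)] by presburger
  qed (use assms in simp)
  finally show ?thesis .
qed

lemma sum_ovdm_run_right:
  assumes "finite V" "\<And>v. v \<in> V \<Longrightarrow> v < d \<and> even (v - d)"
  shows "(\<Sum>S\<in>interlacing (insert d V). ovdm (S \<union> run (d + 1) m)) =
    vdm (V \<union> run d (Suc m)) / (2 ^ (m + card V) * fact (m + card V))"
proof -
  have "\<not> (x \<in> run d (Suc m) \<and> x \<in> V)" for x
    using assms(2)[of x] run_D(1)[of x d "Suc m"] by auto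
  then have dis: "V \<inter> run d (Suc m) = {}" by blast
  have lt: "s < d" if S: "S \<in> interlacing (insert d V)" "s \<in> S" for S s
    by (rule interlacing_ranges[OF S]) (use assms(2) in force)
  have inj: "inj_on (\<lambda>S. S \<union> run (d + 1) m) (interlacing (insert d V))"
  proof (rule inj_onI)
    fix S S' assume S: "S \<in> interlacing (insert d V)" "S' \<in> interlacing (insert d V)"
      and eq: "S \<union> run (d + 1) m = S' \<union> run (d + 1) m"
    have "run (d + 1) m \<inter> S = {}" "run (d + 1) m \<inter> S' = {}"
      using lt[OF S(1)] lt[OF S(2)] by (fastforce dest: run_D(1))+
    then show "S = S'" using eq by blast
  qed
  have "(\<Sum>S\<in>interlacing (insert d V). ovdm (S \<union> run (d + 1) m)) =
      (\<Sum>T\<in>interlacing (V \<union> run d (Suc m)). ovdm T)"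
    by (subst interlacing_run_right) (use assms in \<open>auto simp: sum.reindex[OF inj]\<close>)
  also have "\<dots> = vdm (V \<union> run d (Suc m)) / (2 ^ (m + card V) * fact (m + card V))"
  proof (rule sum_ovdm_interlacing)
    show "card (V \<union> run d (Suc m)) = Suc (m + card V)"
      using assms(1) dis by (simp add: card_Un_disjoint)
    have e: "even (v - d)" if "v \<in> V \<union> run d (Suc m)" for v
      using that assms(2)[of v] run_D(3)[of v d "Suc m"] by blast
    show "even (v - w)" if "v \<in> V \<union> run d (Suc m)" "w \<in> V \<union> run d (Suc m)" for v w
      using e[OF that(1)] e[OF that(2)] by presburger
  qed (use assms in simp)
  finally show ?thesis .
qed

text \<open>The nodes \<open>S\<close> range over a run of length \<open>N\<close>, with \<open>m\<close> fixed nodes directly before and \<open>B\<close> directly after it.\<close>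

definition selberg_sum :: "int \<Rightarrow> nat \<Rightarrow> nat \<Rightarrow> nat \<Rightarrow> nat \<Rightarrow> real" where
  "selberg_sum c m N B y = (\<Sum>S | S \<subseteq> run (c + 2 * int m) N \<and> card S = y.
     selberg_weight (run c m \<union> run (c + 2 * int m + 2 * int N) B) S)"

lemma finite_subsets_run: "finite {S. S \<subseteq> run c n \<and> card S = y}"
  by (rule finite_subset[of _ "Pow (run c n)"]) auto

text \<open>Both reductions evaluate a sum over pairs of interlacing sets in its two orders.\<close>

lemma selberg_sum_shift:
  assumes c: "0 < c"
  shows "selberg_sum c (Suc m) N B y =
    fact (m + y) * fact B / (fact m * fact (B + y)) * selberg_sum (c + 1) m N (Suc B) y"
proof -
  \<comment> \<open>\<open>lo\<close> is the last node of the left run before the move, and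
    \<open>hi\<close> the first node of the right run after it. \<open>V\<close> collects the free
    nodes before and \<open>S\<close> those after the move; the whole picture shifts by one.\<close>
  define lo hi where "lo = c + 2 * int m" and "hi = c + 2 * int m + 1 + 2 * int N"
  define X where "X = {V. V \<subseteq> run (lo + 2) N \<and> card V = y}"
  define Y where "Y = {S. S \<subseteq> run (lo + 1) N \<and> card S = y}"
  let ?L = "run (c + 1) m" and ?L' = "run c (Suc m)" and ?R = "run hi (Suc B)" and ?R' = "run (hi + 1) B"
  have finXY: "finite X" "finite Y" by (simp_all add: X_def Y_def finite_subsets_run)
  have Xr: "v \<in> run (lo + 2) N" if "V \<in> X" "v \<in> V" for V v
    using that by (auto simp: X_def)
  have X: "finite V" "card V = y" if "V \<in> X" for V
    using that by (auto simp: X_def intro: finite_subset[OF _ finite_run])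
  have Xv: "lo < v" "lo + 1 < v" "v < hi" "even (v - lo)" "odd (v - hi)" if "V \<in> X" "v \<in> V" for V v
    using Xr[OF that] unfolding run_def mem_Collect_eq lo_def hi_def by presburger+
  note X = X Xv
  have Yr: "v \<in> run (lo + 1) N" if "S \<in> Y" "v \<in> S" for S v
    using that by (auto simp: Y_def)
  have Y: "finite S" "card S = y" if "S \<in> Y" for S
    using that by (auto simp: Y_def intro: finite_subset[OF _ finite_run])
  have Yv: "lo < v" "v < hi" "odd (v - lo)" "even (v - hi)" if "S \<in> Y" "v \<in> S" for S v
    using Yr[OF that] unfolding run_def mem_Collect_eq lo_def hi_def by presburger+
  note Y = Y Yv
  have dual: "S \<in> interlacing (insert lo V) \<longleftrightarrow> V \<in> interlacing (insert hi S)" if "S \<in> Y" "V \<in> X" for S V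
    by (rule interlacing_dual) (use X[OF that(2)] Y[OF that(1)] in blast)+
  have intX: "interlacing (insert lo V) \<subseteq> Y" if V: "V \<in> X" for V
  proof
    fix S assume S: "S \<in> interlacing (insert lo V)"
    have "lo \<notin> V" using X(3)[OF V] by blast
    then have "card S = y" using S X(1,2)[OF V] by (simp add: interlacing_def)
    moreover have "s \<in> run (lo + 1) N" if s: "s \<in> S" for s
    proof -
      have "odd (s - lo)" using S s unfolding interlacing_def by blast
      moreover have "lo < s" "s < hi"
        by (rule interlacing_ranges[OF S s], use X[OF V] in force)+
      ultimately show ?thesis unfolding run_def mem_Collect_eq lo_def hi_def by presburger
    qed
    ultimately show "S \<in> Y" by (auto simp: Y_def)
  qed
  have intY: "interlacing (insert hi S) \<subseteq> X" if S: "S \<in> Y" for S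
  proof
    fix V assume V: "V \<in> interlacing (insert hi S)"
    have "hi \<notin> S" using Y(4)[OF S] by blast
    then have "card V = y" using V Y(1,2)[OF S] by (simp add: interlacing_def)
    moreover have "v \<in> run (lo + 2) N" if v: "v \<in> V" for v
    proof -
      have "odd (v - hi)" using V v unfolding interlacing_def by blast
      moreover have "lo + 1 < v" "v < hi"
        by (rule interlacing_ranges[OF V v], use Y[OF S] in force)+
      ultimately show ?thesis unfolding run_def mem_Collect_eq lo_def hi_def by presburger
    qed
    ultimately show "V \<in> X" by (auto simp: X_def)
  qed
  \<comment> \<open>Summing over \<open>S\<close> turns \<open>ovdm (?L \<union> S)\<close> into
    \<open>vdm (?L' \<union> V)\<close>, summing over \<open>V\<close> turns
    \<open>ovdm (?R' \<union> V)\<close> into \<open>vdm (S \<union> ?R)\<close>. Either way the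
    product of an \<open>ovdm\<close> and a \<open>vdm\<close> over the same free nodes
    appears.\<close>
  have "(\<Sum>V\<in>X. \<Sum>S\<in>interlacing (insert lo V). ovdm (?R' \<union> V) * ovdm (?L \<union> S)) =
      (\<Sum>V\<in>X. \<Sum>S\<in>{S\<in>Y. S \<in> interlacing (insert lo V)}. ovdm (?R' \<union> V) * ovdm (?L \<union> S))"
    using intX by (intro sum.cong refl) blast
  also have "\<dots> = (\<Sum>S\<in>Y. \<Sum>V\<in>{V\<in>X. S \<in> interlacing (insert lo V)}. ovdm (?R' \<union> V) * ovdm (?L \<union> S))"
    by (rule sum.swap_restrict[OF finXY])
  also have "\<dots> = (\<Sum>S\<in>Y. \<Sum>V\<in>interlacing (insert hi S). ovdm (?R' \<union> V) * ovdm (?L \<union> S))"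
    using intY dual by (intro sum.cong refl) blast+
  finally have swap: "(\<Sum>V\<in>X. \<Sum>S\<in>interlacing (insert lo V). ovdm (?R' \<union> V) * ovdm (?L \<union> S)) = \<dots>" .
  have "(\<Sum>V\<in>X. \<Sum>S\<in>interlacing (insert lo V). ovdm (?R' \<union> V) * ovdm (?L \<union> S)) =
      (\<Sum>V\<in>X. ovdm ?R' * vdm ?L' * selberg_weight (?L' \<union> ?R') V / (2 ^ (m + y) * fact (m + y)))"
  proof (rule sum.cong[OF refl])
    fix V assume V: "V \<in> X"
    have "(\<Sum>S\<in>interlacing (insert lo V). ovdm (?R' \<union> V) * ovdm (?L \<union> S)) =
        ovdm (?R' \<union> V) * (\<Sum>S\<in>interlacing (insert (c + 2 * int m) V). ovdm (?L \<union> S))"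
      by (simp add: sum_distrib_left lo_def)
    also have "\<dots> = ovdm (?R' \<union> V) * (vdm (?L' \<union> V) / (2 ^ (m + card V) * fact (m + card V)))"
      by (subst sum_ovdm_run_left) (use X[OF V] in \<open>auto simp: lo_def\<close>)
    also have "\<dots> = ovdm (?R' \<union> V) * vdm (?L' \<union> V) / (2 ^ (m + y) * fact (m + y))"
      by (simp add: X(2)[OF V])
    also have "ovdm (?R' \<union> V) * vdm (?L' \<union> V) = ovdm ?R' * vdm ?L' * selberg_weight (?R' \<union> ?L') V"
    proof (rule ovdm_vdm_selberg)
      show "?R' \<inter> V = {}" using X(5)[OF V] by (fastforce dest: run_D(1))
      show "?L' \<inter> V = {}" using X(3)[OF V] by (fastforce simp: lo_def dest: run_D(2))
      show "?R' \<inter> ?L' = {}" by (auto simp: run_def hi_def)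
      show "0 \<le> x" if "x \<in> ?R' \<union> ?L' \<union> V" for x
        using that c X(3)[OF V, of x] by (auto simp: run_def hi_def lo_def)
    qed (use X(1)[OF V] in auto)
    finally show "(\<Sum>S\<in>interlacing (insert lo V). ovdm (?R' \<union> V) * ovdm (?L \<union> S)) =
      ovdm ?R' * vdm ?L' * selberg_weight (?L' \<union> ?R') V / (2 ^ (m + y) * fact (m + y))"
      by (simp add: Un_commute)
  qed
  also have "\<dots> = ovdm ?R' * vdm ?L' * selberg_sum c (Suc m) N B y / (2 ^ (m + y) * fact (m + y))"
    by (simp add: selberg_sum_def X_def lo_def hi_def sum_distrib_left sum_divide_distrib algebra_simps)
  finally have 1: "(\<Sum>V\<in>X. \<Sum>S\<in>interlacing (insert lo V). ovdm (?R' \<union> V) * ovdm (?L \<union> S)) = \<dots>" .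
  have "(\<Sum>S\<in>Y. \<Sum>V\<in>interlacing (insert hi S). ovdm (?R' \<union> V) * ovdm (?L \<union> S)) =
      (\<Sum>S\<in>Y. ovdm ?L * vdm ?R * selberg_weight (?L \<union> ?R) S / (2 ^ (B + y) * fact (B + y)))"
  proof (rule sum.cong[OF refl])
    fix S assume S: "S \<in> Y"
    have "(\<Sum>V\<in>interlacing (insert hi S). ovdm (?R' \<union> V) * ovdm (?L \<union> S)) =
        ovdm (?L \<union> S) * (\<Sum>V\<in>interlacing (insert hi S). ovdm (V \<union> ?R'))"
      by (simp add: sum_distrib_left Un_commute mult.commute)
    also have "\<dots> = ovdm (?L \<union> S) * (vdm (S \<union> ?R) / (2 ^ (B + card S) * fact (B + card S)))"
      by (subst sum_ovdm_run_right) (use Y[OF S] in auto)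
    also have "\<dots> = ovdm (?L \<union> S) * vdm (?R \<union> S) / (2 ^ (B + y) * fact (B + y))"
      by (simp add: Y(2)[OF S] Un_commute)
    also have "ovdm (?L \<union> S) * vdm (?R \<union> S) = ovdm ?L * vdm ?R * selberg_weight (?L \<union> ?R) S"
    proof (rule ovdm_vdm_selberg)
      show "?R \<inter> S = {}" using Y(4)[OF S] by (fastforce dest: run_D(1))
      show "?L \<inter> S = {}" using Y(3)[OF S] by (fastforce simp: lo_def dest: run_D(2))
      show "?L \<inter> ?R = {}" by (auto simp: run_def hi_def)
      show "0 \<le> x" if "x \<in> ?L \<union> ?R \<union> S" for x
        using that c Y(3)[OF S, of x] by (auto simp: run_def hi_def lo_def)
    qed (use Y(1)[OF S] in auto)
    finally show "(\<Sum>V\<in>interlacing (insert hi S). ovdm (?R' \<union> V) * ovdm (?L \<union> S)) =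
      ovdm ?L * vdm ?R * selberg_weight (?L \<union> ?R) S / (2 ^ (B + y) * fact (B + y))" .
  qed
  also have "\<dots> = ovdm ?L * vdm ?R * selberg_sum (c + 1) m N (Suc B) y / (2 ^ (B + y) * fact (B + y))"
    by (simp add: selberg_sum_def Y_def lo_def hi_def sum_distrib_left sum_divide_distrib algebra_simps)
  finally have 2: "ovdm ?R' * vdm ?L' * selberg_sum c (Suc m) N B y / (2 ^ (m + y) * fact (m + y)) = \<dots>"
    using 1 swap by simp
  have pos: "ovdm ?R' > 0" "ovdm ?L > 0"
    by (rule ovdm_pos; use c in \<open>auto simp: run_def hi_def\<close>)+
  \<comment> \<open>\<open>vdm_run_ovdm\<close> reduces \<open>?L'\<close> to \<open>?L\<close> and
    \<open>?R\<close> to \<open>?R'\<close>; the positive factors \<open>ovdm ?L\<close> and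
    \<open>ovdm ?R'\<close> then cancel and only factorials remain.\<close>
  show ?thesis
    using 2 pos unfolding vdm_run_ovdm by (simp add: field_simps power_add)
qed

lemma selberg_sum_reduce:
  assumes c: "0 < c"
  shows "selberg_sum c 0 (Suc N) B (Suc y) =
    fact y * fact B / (2 * fact (Suc (B + y))) * pochhammer (real (Suc N)) (Suc B) * pochhammer (real_of_int c + real N) (Suc B)
    * selberg_sum (c - 1) 1 N (Suc B) y"
proof -
  \<comment> \<open>With no left run, \<open>V\<close> is placed strictly inside \<open>S\<close>
    and loses one point. The two points closing it off become new fixed nodes: \<open>lo\<close>
    forms a left run of length 1, and \<open>hi\<close> lengthens the right run.\<close>
  define lo hi where "lo = c - 1" and "hi = c + 1 + 2 * int N"
  define X where "X = {V. V \<subseteq> run (c + 1) N \<and> card V = y}"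
  define Y where "Y = {S. S \<subseteq> run c (Suc N) \<and> card S = Suc y}"
  let ?R = "run hi (Suc B)" and ?R' = "run (hi + 1) B"
  have finXY: "finite X" "finite Y" by (simp_all add: X_def Y_def finite_subsets_run)
  have Xr: "v \<in> run (c + 1) N" if "V \<in> X" "v \<in> V" for V v
    using that by (auto simp: X_def)
  have X: "finite V" "card V = y" if "V \<in> X" for V
    using that by (auto simp: X_def intro: finite_subset[OF _ finite_run])
  have Xv: "lo < v" "v < hi" "even (v - lo)" "even (v - hi)" if "V \<in> X" "v \<in> V" for V v
    using Xr[OF that] unfolding run_def mem_Collect_eq lo_def hi_def by presburger+
  note X = X Xv
  have Yr: "v \<in> run c (Suc N)" if "S \<in> Y" "v \<in> S" for S v
    using that by (auto simp: Y_def)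
  have Y: "finite S" "card S = Suc y" if "S \<in> Y" for S
    using that by (auto simp: Y_def intro: finite_subset[OF _ finite_run])
  have Yv: "lo < v" "v < hi" "odd (v - lo)" "odd (v - hi)" if "S \<in> Y" "v \<in> S" for S v
    using Yr[OF that] unfolding run_def mem_Collect_eq lo_def hi_def by presburger+
  note Y = Y Yv
  have lohi: "lo < hi" "even (lo - hi)" by (auto simp: lo_def hi_def)
  have dual: "S \<in> interlacing (insert lo (insert hi V)) \<longleftrightarrow> V \<in> interlacing S" if "S \<in> Y" "V \<in> X" for S V
    by (rule interlacing_dual') (use X[OF that(2)] Y[OF that(1)] lohi in blast)+
  have intX: "interlacing (insert lo (insert hi V)) \<subseteq> Y" if V: "V \<in> X" for V
  proof
    fix S assume S: "S \<in> interlacing (insert lo (insert hi V))"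
    have "lo \<notin> insert hi V" "hi \<notin> V" using X(3,4)[OF V] lohi by blast+
    then have "card S = Suc y" using S X(1,2)[OF V] by (simp add: interlacing_def)
    moreover have "s \<in> run c (Suc N)" if s: "s \<in> S" for s
    proof -
      have "odd (s - lo)" using S s unfolding interlacing_def by blast
      moreover have "lo < s" "s < hi"
        by (rule interlacing_ranges[OF S s], use X[OF V] lohi in force)+
      ultimately show ?thesis unfolding run_def mem_Collect_eq lo_def hi_def by presburger
    qed
    ultimately show "S \<in> Y" by (auto simp: Y_def)
  qed
  have intY: "interlacing S \<subseteq> X" if S: "S \<in> Y" for S
  proof
    fix V assume V: "V \<in> interlacing S"
    have "card V = y" using V Y(1,2)[OF S] by (simp add: interlacing_def)
    moreover have "v \<in> run (c + 1) N" if v: "v \<in> V" for v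
    proof -
      obtain w w' where w: "w \<in> S" "w' \<in> S" "w < v" "v < w'" by (rule interlacing_ranges[OF V v])
      have "odd (v - w)" using V v w unfolding interlacing_def by blast
      then show ?thesis using w Y(3,4,5)[OF S w(1)] Y(3,4,5)[OF S w(2)]
        unfolding run_def mem_Collect_eq lo_def hi_def by presburger
    qed
    ultimately show "V \<in> X" by (auto simp: X_def)
  qed
  have "(\<Sum>V\<in>X. \<Sum>S\<in>interlacing (insert lo (insert hi V)). ovdm V * ovdm (S \<union> ?R')) =
      (\<Sum>V\<in>X. \<Sum>S\<in>{S\<in>Y. S \<in> interlacing (insert lo (insert hi V))}. ovdm V * ovdm (S \<union> ?R'))"
    using intX by (intro sum.cong refl) blast
  also have "\<dots> = (\<Sum>S\<in>Y. \<Sum>V\<in>{V\<in>X. S \<in> interlacing (insert lo (insert hi V))}. ovdm V * ovdm (S \<union> ?R'))"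
    by (rule sum.swap_restrict[OF finXY])
  also have "\<dots> = (\<Sum>S\<in>Y. \<Sum>V\<in>interlacing S. ovdm V * ovdm (S \<union> ?R'))"
    using intY dual by (intro sum.cong refl) blast+
  finally have swap: "(\<Sum>V\<in>X. \<Sum>S\<in>interlacing (insert lo (insert hi V)). ovdm V * ovdm (S \<union> ?R')) = \<dots>" .
  have "(\<Sum>V\<in>X. \<Sum>S\<in>interlacing (insert lo (insert hi V)). ovdm V * ovdm (S \<union> ?R')) =
      (\<Sum>V\<in>X. vdm (insert lo ?R) * selberg_weight (insert lo ?R) V / (2 ^ Suc (B + y) * fact (Suc (B + y))))"
  proof (rule sum.cong[OF refl])
    fix V assume V: "V \<in> X"
    have "lo \<notin> V" using X(3)[OF V] by blast
    then have cV: "card (insert lo V) = Suc y" using X(1,2)[OF V] by simp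
    have "(\<Sum>S\<in>interlacing (insert lo (insert hi V)). ovdm V * ovdm (S \<union> ?R')) =
        ovdm V * (\<Sum>S\<in>interlacing (insert hi (insert lo V)). ovdm (S \<union> ?R'))"
      by (simp add: sum_distrib_left insert_commute)
    also have "\<dots> = ovdm V * (vdm (insert lo V \<union> ?R) / (2 ^ (B + Suc y) * fact (B + Suc y)))"
      unfolding cV[symmetric] by (subst sum_ovdm_run_right) (use X[OF V] lohi in auto)
    also have "\<dots> = ovdm ({} \<union> V) * vdm (insert lo ?R \<union> V) / (2 ^ Suc (B + y) * fact (Suc (B + y)))"
      by (simp add: Un_commute)
    also have "ovdm ({} \<union> V) * vdm (insert lo ?R \<union> V) =
        ovdm {} * vdm (insert lo ?R) * selberg_weight ({} \<union> insert lo ?R) V"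
    proof (rule ovdm_vdm_selberg)
      show "insert lo ?R \<inter> V = {}" using X(3,4)[OF V] by (fastforce dest: run_D(1))
      show "0 \<le> x" if "x \<in> {} \<union> insert lo ?R \<union> V" for x
        using that c X(3)[OF V, of x] by (auto simp: run_def hi_def lo_def)
    qed (use X(1)[OF V] in auto)
    finally show "(\<Sum>S\<in>interlacing (insert lo (insert hi V)). ovdm V * ovdm (S \<union> ?R')) =
      vdm (insert lo ?R) * selberg_weight (insert lo ?R) V / (2 ^ Suc (B + y) * fact (Suc (B + y)))"
      by simp
  qed
  also have "\<dots> = vdm (insert lo ?R) * selberg_sum (c - 1) 1 N (Suc B) y / (2 ^ Suc (B + y) * fact (Suc (B + y)))"
    by (simp add: selberg_sum_def X_def lo_def hi_def sum_distrib_left sum_divide_distrib algebra_simps run_Suc_left[of "c - 1" 0])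
  finally have 1: "(\<Sum>V\<in>X. \<Sum>S\<in>interlacing (insert lo (insert hi V)). ovdm V * ovdm (S \<union> ?R')) = \<dots>" .
  have "(\<Sum>S\<in>Y. \<Sum>V\<in>interlacing S. ovdm V * ovdm (S \<union> ?R')) =
      (\<Sum>S\<in>Y. ovdm ?R' * selberg_weight ?R' S / (2 ^ y * fact y))"
  proof (rule sum.cong[OF refl])
    fix S assume S: "S \<in> Y"
    have "(\<Sum>V\<in>interlacing S. ovdm V * ovdm (S \<union> ?R')) = ovdm (?R' \<union> S) * (\<Sum>V\<in>interlacing S. ovdm V)"
      unfolding sum_distrib_right[symmetric] by (simp add: Un_commute mult.commute)
    also have "(\<Sum>V\<in>interlacing S. ovdm V) = vdm S / (2 ^ y * fact y)"
    proof (rule sum_ovdm_interlacing)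
      show "even (v - w)" if "v \<in> S" "w \<in> S" for v w
        using Y(5)[OF S that(1)] Y(5)[OF S that(2)] by presburger
    qed (use Y[OF S] in auto)
    also have "ovdm (?R' \<union> S) * (vdm S / (2 ^ y * fact y)) = ovdm (?R' \<union> S) * vdm ({} \<union> S) / (2 ^ y * fact y)"
      by simp
    also have "ovdm (?R' \<union> S) * vdm ({} \<union> S) = ovdm ?R' * vdm {} * selberg_weight (?R' \<union> {}) S"
    proof (rule ovdm_vdm_selberg)
      show "?R' \<inter> S = {}" using Y(4)[OF S] by (fastforce dest: run_D(1))
      show "0 \<le> x" if "x \<in> ?R' \<union> {} \<union> S" for x
        using that c Y(3)[OF S, of x] by (auto simp: run_def hi_def lo_def)
    qed (use Y(1)[OF S] in auto)
    finally show "(\<Sum>V\<in>interlacing S. ovdm V * ovdm (S \<union> ?R')) = ovdm ?R' * selberg_weight ?R' S / (2 ^ y * fact y)"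
      by simp
  qed
  also have "\<dots> = ovdm ?R' * selberg_sum c 0 (Suc N) B (Suc y) / (2 ^ y * fact y)"
    by (simp add: selberg_sum_def Y_def lo_def hi_def sum_distrib_left sum_divide_distrib algebra_simps)
  finally have 2: "vdm (insert lo ?R) * selberg_sum (c - 1) 1 N (Suc B) y / (2 ^ Suc (B + y) * fact (Suc (B + y))) = \<dots>"
    using 1 swap by simp
  have "vdm (insert lo ?R) = vdm ?R * (\<Prod>r\<in>?R. \<bar>lam lo - lam r\<bar>)"
    by (rule vdm_insert) (use c in \<open>auto simp: lo_def hi_def dest: run_D(1)\<close>)
  also have "(\<Prod>r\<in>?R. \<bar>lam lo - lam r\<bar>) = (\<Prod>i<Suc B. \<bar>lam lo - lam (hi + 2 * int i)\<bar>)"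
    unfolding run_eq_image by (subst prod.reindex) (auto simp: inj_on_def)
  \<comment> \<open>A difference of squares, with \<open>hi - lo = 2 * N + 2\<close> and
    \<open>hi + lo = 2 * c + 2 * N\<close>; this is the source of both Pochhammer symbols.\<close>
  also have "\<dots> = (\<Prod>i<Suc B. (real (Suc N) + i) * (real_of_int c + N + i))"
  proof (rule prod.cong[OF refl])
    fix i
    have "lam lo < lam (hi + 2 * int i)" by (rule lam_mono) (use c in \<open>auto simp: lo_def hi_def\<close>)
    then show "\<bar>lam lo - lam (hi + 2 * int i)\<bar> = (real (Suc N) + i) * (real_of_int c + N + i)"
      by (simp add: lam_def lo_def hi_def power2_eq_square field_simps)
  qed
  also have "\<dots> = pochhammer (real (Suc N)) (Suc B) * pochhammer (real_of_int c + real N) (Suc B)"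
    unfolding prod.distrib by (simp only: pochhammer_prod lessThan_atLeast0)
  finally have 3: "vdm (insert lo ?R) = 2 ^ B * fact B * ovdm ?R' *
      (pochhammer (real (Suc N)) (Suc B) * pochhammer (real_of_int c + real N) (Suc B))"
    by (simp only: vdm_run_ovdm)
  have pos: "ovdm ?R' > 0"
    by (rule ovdm_pos) (use c in \<open>auto simp: run_def hi_def\<close>)
  have 4: "selberg_sum c 0 (Suc N) B (Suc y) =
    (2 ^ y * fact y) * (2 ^ B * fact B * (pochhammer (real (Suc N)) (Suc B) * pochhammer (real_of_int c + real N) (Suc B)))
      * selberg_sum (c - 1) 1 N (Suc B) y / (2 ^ Suc (B + y) * fact (Suc (B + y)))"
  proof -
    \<comment> \<open>The common factor \<open>r\<close>, standing for \<open>ovdm ?R'\<close>, is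
      cancelled in abstract form, which keeps the Pochhammer symbols unexpanded.\<close>
    have "v = e * (p * q) * v' / d" if "(p * r * q) * v' / d = r * v / e" "0 < r" "e \<noteq> 0"
      for p q r v v' d e :: real
    proof -
      have "r * v = e * ((p * r * q) * v' / d)" using that by simp
      also have "\<dots> = r * (e * (p * q) * v' / d)" by simp
      finally show ?thesis using that(2) by (simp only: mult_cancel_left) simp
    qed
    from this[OF 2[unfolded 3] pos] show ?thesis by simp
  qed
  show ?thesis unfolding 4 by (simp add: power_add del: fact_Suc pochhammer_Suc)
qed

section \<open>Closed form of the Selberg sum\<close>

lemma H_fun_Suc [simp]: "H_fun (Suc n) = H_fun n * fact n"
  by (simp add: H_fun_def)

lemma H_fun_0 [simp]: "H_fun 0 = 1"
  by (simp add: H_fun_def)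

lemma H_fun_pos: "0 < H_fun n"
  unfolding H_fun_def by (intro prod_pos) auto

lemma selberg_sum_0 [simp]: "selberg_sum c m N B 0 = 1"
proof -
  have "{S. S \<subseteq> run (c + 2 * int m) N \<and> card S = 0} = {{}}"
    by (auto simp: card_eq_0_iff dest: finite_subset[OF _ finite_run])
  then show ?thesis unfolding selberg_sum_def by simp
qed

text \<open>Each move raises \<open>c\<close> by one and lengthens the right run by one. The
  factorial quotients of the m moves accumulate to values of \<open>H_fun\<close>.\<close>

lemma selberg_sum_shift_all:
  "0 < c \<Longrightarrow> selberg_sum c m N B y =
    H_fun (m + y) * H_fun (B + m) * H_fun (B + y) / (H_fun m * H_fun y * H_fun B * H_fun (B + m + y))
    * selberg_sum (c + int m) 0 N (B + m) y"
proof (induction m arbitrary: c B)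
  case 0
  have "H_fun k \<noteq> 0" for k using H_fun_pos[of k] by simp
  then show ?case by simp
next
  case (Suc m)
  have nz: "H_fun k \<noteq> 0" for k using H_fun_pos[of k] by simp
  have "selberg_sum c (Suc m) N B y = fact (m + y) * fact B / (fact m * fact (B + y)) *
     (H_fun (m + y) * H_fun (Suc B + m) * H_fun (Suc B + y) / (H_fun m * H_fun y * H_fun (Suc B) * H_fun (Suc B + m + y))
      * selberg_sum (c + 1 + int m) 0 N (Suc B + m) y)"
    using Suc.prems by (subst selberg_sum_shift, simp, subst Suc.IH) auto
  also have "\<dots> = H_fun (Suc m + y) * H_fun (B + Suc m) * H_fun (B + y) /
      (H_fun (Suc m) * H_fun y * H_fun B * H_fun (B + Suc m + y)) * selberg_sum (c + int (Suc m)) 0 N (B + Suc m) y"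
    using nz by (simp add: divide_simps add_ac del: fact_Suc)
  finally show ?case .
qed

text \<open>One reduction trades an element of \<open>S\<close> for the fixed nodes at both ends;
  one shift then moves the node at \<open>c - 1\<close> to the right and brings \<open>c\<close>
  back. So y drops by 1 and B grows by 2, while the excess x of the number of places over y stays
  the same. The shift starts at \<open>c - 1\<close>, which has to be positive.\<close>

lemma selberg_sum_no_left:
  "1 < c \<Longrightarrow> selberg_sum c 0 (x + y) B y = (H_fun y)\<^sup>2 * (H_fun (B + y))\<^sup>2 / (2 ^ y * H_fun B * H_fun (B + 2 * y)) *
    (\<Prod>i<y. pochhammer (real (x + y - i)) (B + 2 * i + 1) * pochhammer (real_of_int c + real (x + y - i) - 1) (B + 2 * i + 1))"
proof (induction y arbitrary: B)
  case 0
  have "H_fun B \<noteq> 0" using H_fun_pos[of B] by simp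
  then show ?case by (simp add: power2_eq_square)
next
  case (Suc y)
  have nz: "H_fun k \<noteq> 0" for k using H_fun_pos[of k] by simp
  let ?p = "\<lambda>z i. pochhammer (real (x + z - i)) (B + 2 * i + 1) * pochhammer (real_of_int c + real (x + z - i) - 1) (B + 2 * i + 1)"
  have "selberg_sum c 0 (x + Suc y) B (Suc y) = selberg_sum c 0 (Suc (x + y)) B (Suc y)" by simp
  also have "\<dots> = fact y * fact B / (2 * fact (Suc (B + y))) * pochhammer (real (Suc (x + y))) (Suc B) *
      pochhammer (real_of_int c + real (x + y)) (Suc B) * selberg_sum (c - 1) 1 (x + y) (Suc B) y"
    using Suc.prems by (intro selberg_sum_reduce) simp
  finally have 1: "selberg_sum c 0 (x + Suc y) B (Suc y) = fact y * fact B / (2 * fact (Suc (B + y))) *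
      pochhammer (real (Suc (x + y))) (Suc B) * pochhammer (real_of_int c + real (x + y)) (Suc B) *
      selberg_sum (c - 1) 1 (x + y) (Suc B) y" .
  have 2: "selberg_sum (c - 1) 1 (x + y) (Suc B) y = fact y * fact (Suc B) / fact (Suc B + y) * selberg_sum c 0 (x + y) (Suc (Suc B)) y"
    using selberg_sum_shift[of "c - 1" 0 "x + y" "Suc B" y] Suc.prems by simp
  have 3: "selberg_sum c 0 (x + y) (Suc (Suc B)) y =
      (H_fun y)\<^sup>2 * (H_fun (Suc (Suc B) + y))\<^sup>2 / (2 ^ y * H_fun (Suc (Suc B)) * H_fun (Suc (Suc B) + 2 * y)) *
      (\<Prod>i<y. ?p (Suc y) (Suc i))"
    by (subst Suc.IH[OF Suc.prems]) simp
  have 4: "pochhammer (real (Suc (x + y))) (Suc B) * pochhammer (real_of_int c + real (x + y)) (Suc B) = ?p (Suc y) 0"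
    by simp
  have "selberg_sum c 0 (x + Suc y) B (Suc y) = fact y * fact B / (2 * fact (Suc (B + y))) *
      (fact y * fact (Suc B) / fact (Suc B + y)) *
      ((H_fun y)\<^sup>2 * (H_fun (Suc (Suc B) + y))\<^sup>2 / (2 ^ y * H_fun (Suc (Suc B)) * H_fun (Suc (Suc B) + 2 * y))) *
      (?p (Suc y) 0 * (\<Prod>i<y. ?p (Suc y) (Suc i)))"
    unfolding 1 2 3 4[symmetric] by (simp only: mult_ac)
  also have "?p (Suc y) 0 * (\<Prod>i<y. ?p (Suc y) (Suc i)) = (\<Prod>i<Suc y. ?p (Suc y) i)"
    by (rule prod.lessThan_Suc_shift[symmetric])
  also have "fact y * fact B / (2 * fact (Suc (B + y))) * (fact y * fact (Suc B) / fact (Suc B + y)) *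
      ((H_fun y)\<^sup>2 * (H_fun (Suc (Suc B) + y))\<^sup>2 / (2 ^ y * H_fun (Suc (Suc B)) * H_fun (Suc (Suc B) + 2 * y))) =
      (H_fun (Suc y))\<^sup>2 * (H_fun (B + Suc y))\<^sup>2 / (2 ^ Suc y * H_fun B * H_fun (B + 2 * Suc y))"
    using nz by (simp add: divide_simps power2_eq_square del: fact_Suc)
  finally show ?case .
qed

text \<open>The factor with index i is (a + n - i)! / (a + i)!, so numerators and denominators each
  form a quotient of superfactorials. The hypothesis keeps \<open>n - 2 * i\<close> from being
  truncated.\<close>

lemma T_fun_closed_form:
  "m = 0 \<or> 2 * (m - 1) \<le> n \<Longrightarrow>
    T_fun (real a + 1) n m = H_fun (a + n + 1) * H_fun a / (H_fun (a + n + 1 - m) * H_fun (a + m))"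
proof (induction m)
  case 0
  have "H_fun k \<noteq> 0" for k using H_fun_pos[of k] by simp
  then show ?case by (simp add: T_fun_def)
next
  case (Suc m)
  have nz: "H_fun k \<noteq> 0" for k using H_fun_pos[of k] by simp
  have m: "2 * m \<le> n" using Suc.prems by simp
  have "fact (a + m + (n - 2 * m)) = fact (a + m) * pochhammer (1 + real (a + m)) (n - 2 * m)"
    by (simp only: pochhammer_fact pochhammer_product')
  then have "pochhammer (1 + real (a + m)) (n - 2 * m) = fact (a + m + (n - 2 * m)) / fact (a + m)"
    by (simp add: field_simps)
  also have "a + m + (n - 2 * m) = a + n - m" using m by simp
  finally have p: "pochhammer (real a + 1 + real m) (n - 2 * m) = fact (a + n - m) / fact (a + m)"
    by (simp add: add_ac)
  have "T_fun (real a + 1) n (Suc m) = T_fun (real a + 1) n m * (fact (a + n - m) / fact (a + m))"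
    using p by (simp add: T_fun_def)
  also have "T_fun (real a + 1) n m = H_fun (a + n + 1) * H_fun a / (H_fun (a + n + 1 - m) * H_fun (a + m))"
    by (rule Suc.IH) (use m in auto)
  also have "a + n + 1 - m = Suc (a + n - m)" using m by simp
  finally show ?case using nz by (simp add: divide_simps)
qed

text \<open>After a - 1 shifts the left run is gone, \<open>c\<close> has become a + 1 and the right
  run has length a + b + z - 1. The quotient of \<open>T_fun\<close> values carries the whole
  dependence on x and is normalised to 1 at x = 0, which is why its denominators must be rewritten
  by \<open>H_fun\<close>.\<close>

lemma selberg_sum_closed_form:
  fixes a b x y z :: nat
  assumes a: "1 \<le> a"
  shows "selberg_sum 2 (a - 1) (x + y) (b + z) y =
     1 / 2 ^ y * (fact (a - 1) / fact (a + y - 1)) *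
     ((H_fun (2 * a + b + 2 * y + z - 1) * H_fun (b + y + z)) / (H_fun (2 * a + b + y + z - 1) * H_fun (b + z))) *
     ((T_fun (x + 1) (2 * a + b + 2 * y + z - 2) y * T_fun (x + a + 1) (b + 2 * y + z - 2) y)
           / (T_fun 1 (2 * a + b + 2 * y + z - 2) y * T_fun (a + 1) (b + 2 * y + z - 2) y))"
proof (cases "y = 0")
  case True
  have "H_fun k \<noteq> 0" for k using H_fun_pos[of k] by simp
  with True show ?thesis by (simp add: T_fun_def)
next
  case False
  have nz: "H_fun k \<noteq> 0" for k using H_fun_pos[of k] by simp
  define a' where "a' = a - 1"
  have a': "a = Suc a'" using a by (simp add: a'_def)
  define B where "B = b + z"
  define \<beta> where "\<beta> = B + a'"
  define n1 n2 where "n1 = 2 * a + b + 2 * y + z - 2" and "n2 = b + 2 * y + z - 2"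
  have n: "n1 = 2 * a' + B + 2 * y" "n2 + 2 = B + 2 * y" "2 * (y - 1) \<le> n2" "2 * (y - 1) \<le> n1"
    using False by (auto simp: n1_def n2_def a' B_def)
  have T1: "T_fun 1 n1 y = H_fun (n1 + 1) / (H_fun (n1 + 1 - y) * H_fun y)"
    using T_fun_closed_form[of y n1 0] n by (simp add: H_fun_def)
  have T2: "T_fun (a + 1) n2 y = H_fun (a + n2 + 1) * H_fun a / (H_fun (a + n2 + 1 - y) * H_fun (a + y))"
    using T_fun_closed_form[of y n2 a] n by (simp add: add_ac)
  \<comment> \<open>The lengths of the Pochhammer symbols grow with i here but decrease in
    \<open>T_fun\<close>; hence the order of the factors is reversed.\<close>
  have "(\<Prod>i<y. pochhammer (real (x + y - i)) (\<beta> + 2 * i + 1) * pochhammer (real_of_int (2 + int a') + real (x + y - i) - 1) (\<beta> + 2 * i + 1)) =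
      (\<Prod>i<y. pochhammer (real (x + y - (y - Suc i))) (\<beta> + 2 * (y - Suc i) + 1) *
         pochhammer (real_of_int (2 + int a') + real (x + y - (y - Suc i)) - 1) (\<beta> + 2 * (y - Suc i) + 1))"
    by (rule prod.nat_diff_reindex[symmetric])
  also have "\<dots> = (\<Prod>i<y. pochhammer (real (x + 1) + real i) (n1 - 2 * i) * pochhammer (real (x + a + 1) + real i) (n2 - 2 * i))"
  proof (rule prod.cong[OF refl])
    fix i assume "i \<in> {..<y}"
    then have i: "i < y" by simp
    have e: "x + y - (y - Suc i) = x + 1 + i" "\<beta> + 2 * (y - Suc i) + 1 = a + (n2 - 2 * i)"
      "n1 - 2 * i = a + (a + (n2 - 2 * i))" "real_of_int (2 + int a') + real (x + 1 + i) - 1 = real (x + a + 1) + real i"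
      using i n by (auto simp: \<beta>_def a')
    have f: "real (x + 1) + real i = real (x + 1 + i)" "real (x + 1 + i) + real a = real (x + a + 1) + real i" by simp_all
    \<comment> \<open>With r = \<open>n2 - 2 * i\<close>, lengths a + r and a + r are to become 2 a
      + r and r. Splitting off the first a factors of the symbols starting at x + 1 + i shows that
      both sides have the same pieces.\<close>
    show "pochhammer (real (x + y - (y - Suc i))) (\<beta> + 2 * (y - Suc i) + 1) *
         pochhammer (real_of_int (2 + int a') + real (x + y - (y - Suc i)) - 1) (\<beta> + 2 * (y - Suc i) + 1) =
        pochhammer (real (x + 1) + real i) (n1 - 2 * i) * pochhammer (real (x + a + 1) + real i) (n2 - 2 * i)"
      unfolding e f(1) pochhammer_product'[of _ a "n2 - 2 * i"] pochhammer_product'[of _ a "a + (n2 - 2 * i)"] f(2)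
      by (simp only: mult_ac)
  qed
  also have "\<dots> = T_fun (real (x + 1)) n1 y * T_fun (real (x + a + 1)) n2 y"
    by (simp only: T_fun_def prod.distrib)
  finally have P: "(\<Prod>i<y. pochhammer (real (x + y - i)) (\<beta> + 2 * i + 1) *
      pochhammer (real_of_int (2 + int a') + real (x + y - i) - 1) (\<beta> + 2 * i + 1)) = \<dots>" .
  have "selberg_sum 2 (a - 1) (x + y) (b + z) y =
      H_fun (a' + y) * H_fun (B + a') * H_fun (B + y) / (H_fun a' * H_fun y * H_fun B * H_fun (B + a' + y)) *
      ((H_fun y)\<^sup>2 * (H_fun (\<beta> + y))\<^sup>2 / (2 ^ y * H_fun \<beta> * H_fun (\<beta> + 2 * y)) *
        (T_fun (real (x + 1)) n1 y * T_fun (real (x + a + 1)) n2 y))"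
    unfolding P[symmetric] a'_def[symmetric] B_def[symmetric]
    by (subst selberg_sum_shift_all, simp, subst selberg_sum_no_left) (simp_all add: \<beta>_def)
  also have "\<dots> = 1 / 2 ^ y * (fact a' / fact (a' + y)) * (H_fun (n1 + 1) * H_fun (B + y) / (H_fun (n1 + 1 - y) * H_fun B)) *
      (T_fun (real (x + 1)) n1 y * T_fun (real (x + a + 1)) n2 y / (T_fun 1 n1 y * T_fun (a + 1) n2 y))"
  proof -
    have e: "a + n2 + 1 = \<beta> + 2 * y" "a + n2 + 1 - y = \<beta> + y" "a + y = Suc (a' + y)" "B + a' = \<beta>" "B + a' + y = \<beta> + y"
      using n by (simp_all add: a' \<beta>_def)
    show ?thesis unfolding T1 T2 e unfolding a' H_fun_Suc
      using nz by (simp add: divide_simps power2_eq_square add.commute[of y \<beta>])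
  qed
  finally have F: "selberg_sum 2 (a - 1) (x + y) (b + z) y = \<dots>" .
  have e: "2 * a + b + 2 * y + z - 1 - y = 2 * a + b + y + z - 1" "n1 + 1 = 2 * a + b + 2 * y + z - 1" "B + y = b + y + z" "a' + y = a + y - 1"
    using n by (simp_all add: a' B_def)
  show ?thesis
    using F unfolding e(2-4) unfolding e(1) n1_def[symmetric] n2_def[symmetric] a'_def[symmetric] B_def[symmetric]
    by (simp only: of_nat_add of_nat_1)
qed

section \<open>Trapezoids with one zigzag side\<close>

text \<open>The pair \<open>(k, c)\<close> stands for the unit triangle between the heights \<open>k\<close> and \<open>k + 1\<close> whose horizontal side
  has its left end at abscissa \<open>c / 2\<close>; it points up iff \<open>c - k\<close> is even. Lozenges become dominoes
  \<open>{(k, c), (k, c + 1)}\<close> and \<open>{(k, c), (k - 1, c)}\<close>.\<close>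

definition bricks :: "(int \<times> int) set set" where
  "bricks = {{(k, c), (k, c + 1)} | k c. True} \<union> {{(k, c), (k - 1, c)} | k c. even (c - k)}"

text \<open>In column 0 the western corner of a vertical lozenge has abscissa 0, so its western
  sides run along a zigzag through the abscissae 0 and 1/2. A region whose wall is at column 1
  contains no such lozenge, so that one weight serves all regions.\<close>

definition brick_weight :: "(int \<times> int) set \<Rightarrow> real" where
  "brick_weight l = (if \<exists>k. l = {(k, 0), (k - 1, 0)} then 1 / 2 else 1)"

abbreviation domino_sum :: "(int \<times> int) set \<Rightarrow> real" where
  "domino_sum \<equiv> matching_sum bricks brick_weight"

section \<open>Dominoes and matchings of a single row\<close>

lemma horizontal_brick: "{(k, c), (k, c + 1)} \<in> bricks"
  by (auto simp: bricks_def)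

lemma vertical_brick: "odd (c - k) \<Longrightarrow> {(k, c), (k + 1, c)} \<in> bricks"
proof -
  assume "odd (c - k)"
  then have "even (c - (k + 1))" by presburger
  then have "{(k + 1, c), (k + 1 - 1, c)} \<in> bricks" unfolding bricks_def by blast
  then show ?thesis by (simp add: insert_commute)
qed

lemma brick_cases:
  assumes "l \<in> bricks" "(k, c) \<in> l"
  obtains "l = {(k, c), (k, c + 1)}" | "l = {(k, c), (k, c - 1)}"
    | "even (c - k)" "l = {(k, c), (k - 1, c)}" | "odd (c - k)" "l = {(k, c), (k + 1, c)}"
  using assms unfolding bricks_def by (auto simp: insert_commute)

lemma brick_weight_horizontal: "brick_weight {(k, c), (k, c + 1)} = 1"
  by (auto simp: brick_weight_def doubleton_eq_iff)

lemma brick_weight_vertical: "brick_weight {(k, c), (k + 1, c)} = (if c = 0 then 1 / 2 else 1)"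
proof -
  have "(\<exists>j. {(k, c), (k + 1, c)} = {(j, 0), (j - 1, 0)}) \<longleftrightarrow> c = 0"
  proof
    assume "c = 0"
    then show "\<exists>j. {(k, c), (k + 1, c)} = {(j, 0), (j - 1, 0)}"
      by (intro exI[of _ "k + 1"]) auto
  qed (auto simp: doubleton_eq_iff)
  then show ?thesis by (simp add: brick_weight_def)
qed

text \<open>A row admits horizontal dominoes only, which all have weight 1. Its matching is unique
  and exists iff all maximal blocks of consecutive cells have even length; the parity of
  \<open>below\<close> at the missing cells expresses this. The domino at the left end is forced,
  which gives the induction.\<close>

lemma matching_sum_row:
  assumes "finite C"
  shows "domino_sum (Pair r ` C) = (if \<forall>x. x \<notin> C \<longrightarrow> even (below C x) then 1 else 0)"
  using assms
proof (induction "card C" arbitrary: C rule: less_induct)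
  case less
  show ?case
  proof (cases "C = {}")
    case True
    then show ?thesis by (simp add: below_def)
  next
    case False
    define m where "m = Min C"
    have m: "m \<in> C" "\<And>c. c \<in> C \<Longrightarrow> m \<le> c" using less.prems False by (auto simp: m_def)
    have row: "l = {(r, m), (r, m + 1)}" if l: "l \<in> bricks" "(r, m) \<in> l" "l \<subseteq> Pair r ` C" for l
      by (rule brick_cases[OF l(1,2)]) (use l(3) m(2)[of "m - 1"] in auto)
    show ?thesis
    proof (cases "m + 1 \<in> C")
      case True
      define C' where "C' = C - {m, m + 1}"
      have "domino_sum (Pair r ` C) =
          brick_weight {(r, m), (r, m + 1)} * domino_sum (Pair r ` C - {(r, m), (r, m + 1)})"
        by (rule matching_sum_forced) (use less.prems m True row horizontal_brick in auto)
      also have "Pair r ` C - {(r, m), (r, m + 1)} = Pair r ` C'" by (auto simp: C'_def)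
      also have "domino_sum (Pair r ` C') = (if \<forall>x. x \<notin> C' \<longrightarrow> even (below C' x) then 1 else 0)"
      proof (rule less.hyps)
        show "card C' < card C" unfolding C'_def using less.prems m by (intro psubset_card_mono) auto
        show "finite C'" using less.prems by (simp add: C'_def)
      qed
      also have "(\<forall>x. x \<notin> C' \<longrightarrow> even (below C' x)) \<longleftrightarrow> (\<forall>x. x \<notin> C \<longrightarrow> even (below C x))"
      proof -
        have C: "C = insert m (insert (m + 1) C')" using m True by (auto simp: C'_def)
        have gt: "m + 1 < x" if "x \<in> C'" for x using m(2)[of x] that by (auto simp: C'_def)
        have fin: "finite C'" using less.prems by (simp add: C'_def)
        have 1: "below C x = Suc (Suc (below C' x))" if "m + 1 < x" for x
          unfolding C using that fin gt by (subst below_insert; force simp: below_insert)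
        have 2: "below C' x = 0" if "x \<le> m + 1" for x
          using that gt by (intro below_none) force
        have 3: "below C x = 0" if "x < m" for x
          using that m(2) by (intro below_none) force
        show ?thesis
        proof
          assume a: "\<forall>x. x \<notin> C' \<longrightarrow> even (below C' x)"
          show "\<forall>x. x \<notin> C \<longrightarrow> even (below C x)"
          proof (intro allI impI)
            fix x assume "x \<notin> C"
            then have "x < m \<or> m + 1 < x" "x \<notin> C'" unfolding C by auto
            then show "even (below C x)" using 1[of x] 3[of x] a by auto
          qed
        next
          assume a: "\<forall>x. x \<notin> C \<longrightarrow> even (below C x)"
          show "\<forall>x. x \<notin> C' \<longrightarrow> even (below C' x)"
          proof (intro allI impI)
            fix x assume x: "x \<notin> C'"
            show "even (below C' x)"
            proof (cases "x \<le> m + 1")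
              case False
              then have "x \<notin> C" using x unfolding C by auto
              then show ?thesis using a 1[of x] False by auto
            qed (simp add: 2)
          qed
        qed
      qed
      finally show ?thesis by (simp add: brick_weight_horizontal)
    next
      case False
      have "domino_sum (Pair r ` C) = 0"
        by (rule matching_sum_zero[of "(r, m)"]) (use m(1) row False in auto)
      moreover have "below C (m + 1) = 1"
      proof -
        have "{c\<in>C. c < m + 1} = {m}" using m by force
        then show ?thesis by (simp add: below_def)
      qed
      ultimately show ?thesis using False by (auto intro!: exI[of _ "m + 1"])
    qed
  qed
qed

text \<open>Left of x there are \<open>x - lo\<close> cells, distributed among the row,
  \<open>W\<close> and \<open>T\<close>. Where a cell is missing, the even count of the row fixes
  the parity of \<open>below W x + below T x\<close>: even at points of \<open>W\<close>, odd at
  points of \<open>T\<close>. This leaves only the alternation of \<open>W\<close> and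
  \<open>T\<close>, with \<open>W\<close> first and last.\<close>

lemma row_matchable_iff:
  fixes lo \<beta> :: int
  assumes le: "lo \<le> \<beta>" "even (\<beta> - lo)" and finW: "finite W" and finT: "finite T"
    and W: "\<And>w. w \<in> W \<Longrightarrow> lo \<le> w \<and> w \<le> \<beta> \<and> even (w - lo)"
    and T: "\<And>t. t \<in> T \<Longrightarrow> lo \<le> t \<and> t \<le> \<beta> \<and> odd (t - lo)"
  shows "(\<forall>x. x \<notin> {lo..\<beta>} - W - T \<longrightarrow> even (below ({lo..\<beta>} - W - T) x)) \<longleftrightarrow> T \<in> interlacing W"
proof -
  define C where "C = {lo..\<beta>} - W - T"
  have WT: "W \<inter> T = {}" using W T by blast
  have odd: "odd (t - w)" if "t \<in> T" "w \<in> W" for t w using W[OF that(2)] T[OF that(1)] by presburger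
  have cnt: "below C x + below W x + below T x = nat (x - lo)" if "x \<le> \<beta> + 1" for x
  proof -
    have finC: "finite C" by (simp add: C_def)
    have "{lo..<x} = {c\<in>C. c < x} \<union> {c\<in>W. c < x} \<union> {c\<in>T. c < x}"
      using that W T by (auto simp: C_def)
    then have "card {lo..<x} = card ({c\<in>C. c < x} \<union> {c\<in>W. c < x}) + card {c\<in>T. c < x}"
      using finW finT finC WT by (simp only:) (rule card_Un_disjoint, auto, auto simp: C_def)
    also have "card ({c\<in>C. c < x} \<union> {c\<in>W. c < x}) = card {c\<in>C. c < x} + card {c\<in>W. c < x}"
      using finW finC by (intro card_Un_disjoint) (auto, auto simp: C_def)
    finally show ?thesis by (simp add: below_def)
  qed
  have end_W: "below W (\<beta> + 1) = card W" and end_T: "below T (\<beta> + 1) = card T"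
    by (rule below_all; use W T in force)+
  show ?thesis
    unfolding C_def[symmetric]
  proof
    assume m: "\<forall>x. x \<notin> C \<longrightarrow> even (below C x)"
    \<comment> \<open>The difference of the two counts changes only at points of \<open>W\<close>
      and \<open>T\<close>, and there the parity tells which of the two cases holds before the
      step.\<close>
    have alt: "below W x = below T x \<or> below W x = Suc (below T x)" if "lo \<le> x" "x \<le> \<beta> + 1" for x
      using that
    proof (induction x rule: int_ge_induct)
      case base
      have "below W lo = 0" "below T lo = 0" using W T by (auto intro!: below_none)
      then show ?case by simp
    next
      case (step x)
      then have IH: "below W x = below T x \<or> below W x = Suc (below T x)" by simp
      have c': "int (below C x) + int (below W x) + int (below T x) = x - lo"
        using cnt[of x] step by simp
      consider "x \<in> W" | "x \<in> T" | "x \<notin> W" "x \<notin> T" by blast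
      then show ?case
      proof cases
        case 1
        then have "even (below C x)" "even (x - lo)" using m W by (auto simp: C_def)
        then have "even (below W x + below T x)"
          using c' by presburger
        then have "below W x = below T x" using IH by auto
        then show ?thesis using 1 WT finW finT by (auto simp: below_step)
      next
        case 2
        then have "even (below C x)" "odd (x - lo)" using m T by (auto simp: C_def)
        then have "odd (below W x + below T x)"
          using c' by presburger
        then have "below W x = Suc (below T x)" using IH by auto
        then show ?thesis using 2 WT finW finT by (auto simp: below_step)
      next
        case 3
        then show ?thesis using IH finW finT by (simp add: below_step)
      qed
    qed
    have c': "int (below C x) + int (below W x) + int (below T x) = x - lo" if "lo \<le> x" "x \<le> \<beta> + 1" for x
      using cnt[of x] that by simp
    have a1: "below T x = below W x" if "x \<in> W" for x
    proof -
      have "even (below C x)" "even (x - lo)" "lo \<le> x" "x \<le> \<beta> + 1" using m W[OF that] that by (auto simp: C_def)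
      then have "even (below W x + below T x)"
        using c'[OF \<open>lo \<le> x\<close> \<open>x \<le> \<beta> + 1\<close>] by presburger
      then show ?thesis using alt[of x] \<open>lo \<le> x\<close> \<open>x \<le> \<beta> + 1\<close> by auto
    qed
    have a2: "below W x = Suc (below T x)" if "x \<in> T" for x
    proof -
      have "even (below C x)" "odd (x - lo)" "lo \<le> x" "x \<le> \<beta> + 1" using m T[OF that] that by (auto simp: C_def)
      then have "odd (below W x + below T x)"
        using c'[OF \<open>lo \<le> x\<close> \<open>x \<le> \<beta> + 1\<close>] by presburger
      then show ?thesis using alt[of x] \<open>lo \<le> x\<close> \<open>x \<le> \<beta> + 1\<close> by auto
    qed
    have "even (below C (\<beta> + 1))" using m by (auto simp: C_def)
    have "odd (\<beta> + 1 - lo)" using le(2) by presburger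
    have "odd (card W + card T)"
    proof -
      have "int (below C (\<beta> + 1)) + int (card W) + int (card T) = \<beta> + 1 - lo"
        using cnt[of "\<beta> + 1"] le(1) unfolding end_W end_T by simp
      then show ?thesis
        using \<open>even (below C (\<beta> + 1))\<close> \<open>odd (\<beta> + 1 - lo)\<close> by presburger
    qed
    then have "card W = Suc (card T)"
      using alt[of "\<beta> + 1"] le(1) unfolding end_W end_T by auto
    then show "T \<in> interlacing W"
      unfolding interlacing_def using finW finT odd a1 a2 by blast
  next
    assume int: "T \<in> interlacing W"
    then have cWT: "card W = Suc (card T)" and iW: "\<And>x. x \<in> W \<Longrightarrow> below T x = below W x"
      and iT: "\<And>x. x \<in> T \<Longrightarrow> below W x = Suc (below T x)"
      unfolding interlacing_def by blast+
    show "\<forall>x. x \<notin> C \<longrightarrow> even (below C x)"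
    proof (intro allI impI)
      fix x assume x: "x \<notin> C"
      consider "x < lo" | "\<beta> < x" | "x \<in> W" | "x \<in> T" using x by (force simp: C_def)
      then show "even (below C x)"
      proof cases
        case 1
        then have "below C x = 0" by (intro below_none) (auto simp: C_def)
        then show ?thesis by simp
      next
        case 2
        then have "below C x = card C" by (intro below_all) (auto simp: C_def)
        also have "\<dots> = below C (\<beta> + 1)" by (rule below_all[symmetric]) (auto simp: C_def)
        finally have b: "below C x = below C (\<beta> + 1)" .
        have "int (below C (\<beta> + 1)) + 2 * int (card T) = \<beta> - lo"
          using cnt[of "\<beta> + 1"] le(1) unfolding end_W end_T cWT by simp
        then show ?thesis using le(2) unfolding b by presburger
      next
        case 3
        then have "int (below C x) + 2 * int (below W x) = x - lo" "even (x - lo)"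
          using cnt[of x] W[OF 3] iW[OF 3] by auto
        then show ?thesis by presburger
      next
        case 4
        then have "int (below C x) + 2 * int (below T x) + 1 = x - lo" "odd (x - lo)"
          using cnt[of x] T[OF 4] iT[OF 4] by auto
        then show ?thesis by presburger
      qed
    qed
  qed
qed

lemma interlacing_subset:
  fixes lo \<beta> :: int
  assumes W: "\<And>w. w \<in> W \<Longrightarrow> lo \<le> w \<and> w \<le> \<beta> \<and> even (w - lo)" and T: "T \<in> interlacing W" "t \<in> T"
  shows "lo < t \<and> t < \<beta> \<and> odd (t - lo)"
proof -
  obtain w w' where w: "w \<in> W" "w' \<in> W" "w < t" "t < w'" by (rule interlacing_ranges[OF T])
  have "odd (t - w)" using T w unfolding interlacing_def by blast
  then show ?thesis using W[OF w(1)] W[OF w(2)] w(3,4) by presburger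
qed

section \<open>Evaluation of a trapezoid\<close>

lemma H2_fun_Suc_Suc: "H2_fun (Suc (Suc n)) = fact n * H2_fun n"
proof -
  have "H2_fun (Suc (Suc n)) = (\<Prod>i=Suc 0..Suc (n div 2). fact (Suc (Suc n) - 2 * i))"
    by (simp add: H2_fun_def)
  also have "\<dots> = fact (Suc (Suc n) - 2 * Suc 0) * (\<Prod>i=Suc (Suc 0)..Suc (n div 2). fact (Suc (Suc n) - 2 * i))"
    by (rule prod.atLeast_Suc_atMost) simp
  also have "(\<Prod>i=Suc (Suc 0)..Suc (n div 2). fact (Suc (Suc n) - 2 * i)) = H2_fun n"
    by (simp add: H2_fun_def prod.shift_bounds_cl_Suc_ivl del: prod.cl_ivl_Suc)
  finally show ?thesis by simp
qed

lemma H2_fun_0 [simp]: "H2_fun 0 = 1" "H2_fun (Suc 0) = 1"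
  by (simp_all add: H2_fun_def)

lemma H2_fun_pos: "0 < H2_fun n"
  unfolding H2_fun_def by (intro prod_pos) auto

text \<open>Quotients of consecutive values of \<open>H2_fun\<close> are the constants in the two
  summation formulas over interlacing sets, here for the step with a wall point and in the next
  lemma for the step without one.\<close>

lemma H2_fun_odd: "H2_fun (Suc (2 * n)) = H2_fun (2 * n) * (\<Prod>j<n. 2 * real j + 1)"
  by (induction n) (simp_all add: H2_fun_Suc_Suc algebra_simps)

lemma H2_fun_even: "H2_fun (Suc (Suc (2 * n))) = H2_fun (Suc (2 * n)) * (2 ^ n * fact n)"
  by (induction n) (simp_all add: H2_fun_Suc_Suc[of "Suc (2 * _)"] H2_fun_Suc_Suc algebra_simps)

text \<open>In these coordinates the zigzag becomes the straight border \<open>lo\<close>, and the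
  eastern side recedes by one column per row.\<close>

definition trapezoid :: "int \<Rightarrow> int \<Rightarrow> int \<Rightarrow> int \<Rightarrow> (int \<times> int) set" where
  "trapezoid lo M r t = {(k, c). r \<le> k \<and> k < t \<and> lo \<le> c \<and> c \<le> 2 * M - 2 - k}"

text \<open>Two rows absorb one removed position, which determines \<open>card U\<close>; for any
  other number of positions there is no tiling.\<close>

definition trapezoid_value :: "nat \<Rightarrow> int set \<Rightarrow> real" where
  "trapezoid_value s U =
     (if odd s then if 2 * card U = Suc s then vdm U / H2_fun (Suc s) else 0
      else if 2 * card U = s then ovdm U / H2_fun (Suc s) else 0)"

lemma finite_trapezoid [simp]: "finite (trapezoid lo M r t)"
  by (rule finite_subset[of _ "{r..<t} \<times> {lo..2 * M - 2 - r}"]) (auto simp: trapezoid_def)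

lemma empty_interlacing_iff: "finite W \<Longrightarrow> {} \<in> interlacing W \<longleftrightarrow> card W = 1"
  by (auto simp: interlacing_def below_def card_eq_0_iff card_1_singleton_iff)

text \<open>Induction on the number of rows: the vertical lozenges leaving the bottom row form the
  set \<open>S\<close> that is removed from the base of the next trapezoid. The condition
  \<open>odd (lo - t)\<close> says that the top row has an odd number of cells, so that it admits a
  matching just if one cell is removed.\<close>

lemma matching_sum_trapezoid:
  fixes lo M r t :: int
  assumes "t = r + int (Suc s)" "lo = 0 \<or> lo = 1" "odd (lo - t)" "lo \<le> 2 * M - 1 - t"
    and "\<And>u. u \<in> U \<Longrightarrow> lo \<le> u \<and> u \<le> 2 * M - 2 - r \<and> even (u - r)"
  shows "domino_sum (trapezoid lo M r t - Pair r ` U) = trapezoid_value (Suc s) U"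
  using assms
proof (induction s arbitrary: r U)
  case 0
  define \<beta> where "\<beta> = 2 * M - 2 - r"
  have finU: "finite U"
    by (rule finite_subset[of _ "{lo..\<beta>}"]) (use "0.prems" in \<open>auto simp: \<beta>_def\<close>)
  have par: "even (lo - r)" using "0.prems"(1,3) by simp
  have "trapezoid lo M r t - Pair r ` U = Pair r ` ({lo..\<beta>} - U - {})"
    using "0.prems"(1) by (auto simp: trapezoid_def \<beta>_def)
  then have "domino_sum (trapezoid lo M r t - Pair r ` U) =
      (if \<forall>x. x \<notin> {lo..\<beta>} - U - {} \<longrightarrow> even (below ({lo..\<beta>} - U - {}) x) then 1 else 0)"
    by (simp only: matching_sum_row finite_Diff finite_atLeastAtMost_int)
  also have "(\<forall>x. x \<notin> {lo..\<beta>} - U - {} \<longrightarrow> even (below ({lo..\<beta>} - U - {}) x)) \<longleftrightarrow> {} \<in> interlacing U"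
  proof (rule row_matchable_iff)
    show "lo \<le> \<beta>" using "0.prems"(1,4) by (simp add: \<beta>_def)
    show "even (\<beta> - lo)" using par unfolding \<beta>_def by presburger
    show "lo \<le> w \<and> w \<le> \<beta> \<and> even (w - lo)" if "w \<in> U" for w
      using "0.prems"(5)[OF that] par unfolding \<beta>_def by presburger
  qed (use finU in auto)
  also have "\<dots> \<longleftrightarrow> card U = 1" by (rule empty_interlacing_iff[OF finU])
  finally have *: "domino_sum (trapezoid lo M r t - Pair r ` U) = (if card U = 1 then 1 else 0)" .
  have "vdm U = 1" if "card U = 1"
  proof -
    obtain u where u: "U = {u}" using \<open>card U = 1\<close> by (rule card_1_singletonE)
    then show ?thesis using vdm_insert[of "{}" u] "0.prems"(2,5) by auto
  qed
  with * show ?case by (auto simp: trapezoid_value_def H2_fun_Suc_Suc)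
next
  case (Suc s)
  define \<beta> where "\<beta> = 2 * M - 2 - r"
  \<comment> \<open>If \<open>lo - r\<close> is odd, the row has an even number of cells. Adding the
    wall as a removed cell at \<open>lo - 1\<close> restores the situation of an odd row.\<close>
  define lo' where "lo' = (if even (lo - r) then lo else lo - 1)"
  define W where "W = (if even (lo - r) then U else insert (lo - 1) U)"
  define X where "X = {c. lo \<le> c \<and> c \<le> 2 * M - 3 - r \<and> odd (c - r)}"
  define om where "om c = (if c = 0 then 1 / 2 else 1 :: real)" for c :: int
  let ?A = "Pair r ` ({lo..\<beta>} - U)" and ?B = "trapezoid lo M (r + 1) t"
  have t: "t = r + 1 + int (Suc s)" using Suc.prems(1) by simp
  have U: "lo \<le> u" "u \<le> \<beta>" "even (u - r)" if "u \<in> U" for u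
    using Suc.prems(5)[OF that] by (auto simp: \<beta>_def)
  have finU: "finite U"
    by (rule finite_subset[of _ "{lo..\<beta>}"]) (use U in auto)
  have finX: "finite X"
    by (rule finite_subset[of _ "{lo..2 * M - 3 - r}"]) (auto simp: X_def)
  have par: "even (lo' - r)" by (simp add: lo'_def)
  have W: "lo' \<le> w \<and> w \<le> \<beta> \<and> even (w - lo')" if "w \<in> W" for w
    using U[of w] that par Suc.prems(1,4) by (auto simp: W_def lo'_def \<beta>_def split: if_splits)
  have split: "trapezoid lo M r t - Pair r ` U = ?A \<union> ?B"
    using t by (auto simp: trapezoid_def \<beta>_def)
  have "domino_sum (?A \<union> ?B) = (\<Sum>S\<in>Pow X. (\<Prod>c\<in>S. brick_weight {(r, c), (r + 1, c)}) *
      domino_sum (?A - Pair r ` S) * domino_sum (?B - Pair (r + 1) ` S))"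
  proof (rule matching_sum_split)
    show "Pair r ` X \<subseteq> ?A" using U(3) by (auto simp: X_def \<beta>_def)
    show "Pair (r + 1) ` X \<subseteq> ?B" using t by (auto simp: X_def trapezoid_def)
    show "{(r, c), (r + 1, c)} \<in> bricks" if "c \<in> X" for c
      using that by (auto simp: X_def intro!: vertical_brick)
    fix l assume l: "l \<in> bricks" "l \<subseteq> ?A \<union> ?B"
    show "l \<subseteq> ?A \<or> l \<subseteq> ?B \<or> (\<exists>c\<in>X. l = {(r, c), (r + 1, c)})"
    proof (cases "\<exists>c. (r, c) \<in> l")
      case True
      then obtain c where c: "(r, c) \<in> l" by auto
      have nB: "(r, x) \<notin> ?B" "(r - 1, x) \<notin> ?A \<union> ?B" for x by (auto simp: trapezoid_def)
      show ?thesis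
      proof (rule brick_cases[OF l(1) c])
        assume e: "l = {(r, c), (r, c + 1)}"
        then have "l \<subseteq> ?A" using l(2) nB by blast
        then show ?thesis by simp
      next
        assume e: "l = {(r, c), (r, c - 1)}"
        then have "l \<subseteq> ?A" using l(2) nB by blast
        then show ?thesis by simp
      next
        assume "l = {(r, c), (r - 1, c)}"
        then show ?thesis using l(2) nB(2)[of c] by blast
      next
        assume e: "odd (c - r)" "l = {(r, c), (r + 1, c)}"
        then have "(r + 1, c) \<in> ?B" "(r, c) \<in> ?A" using l(2) nB by auto
        then have "c \<in> X" using e(1) by (auto simp: X_def trapezoid_def)
        then show ?thesis using e(2) by blast
      qed
    next
      case False
      then have "l \<subseteq> ?B" using l(2) by auto
      then show ?thesis by simp
    qed
  next
    show "?A \<inter> ?B = {}" by (auto simp: trapezoid_def)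
  qed (auto simp: inj_on_def)
  also have "\<dots> = (\<Sum>S\<in>Pow X. if S \<in> interlacing W then (\<Prod>c\<in>S. om c) * trapezoid_value (Suc s) S else 0)"
  proof (rule sum.cong[OF refl])
    fix S assume "S \<in> Pow X"
    then have S: "S \<subseteq> X" by simp
    then have finS: "finite S" using finX finite_subset by blast
    have SX: "lo \<le> c" "c \<le> \<beta>" "odd (c - lo')" "c \<le> 2 * M - 3 - r" "odd (c - r)" if "c \<in> S" for c
      using S that par by (auto simp: X_def \<beta>_def)
    have "?A - Pair r ` S = Pair r ` ({lo'..\<beta>} - W - S)"
      by (auto simp: lo'_def W_def)
    then have "domino_sum (?A - Pair r ` S) = (if \<forall>x. x \<notin> {lo'..\<beta>} - W - S \<longrightarrow> even (below ({lo'..\<beta>} - W - S) x) then 1 else 0)"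
      by (simp only: matching_sum_row finite_Diff finite_atLeastAtMost_int)
    also have "(\<forall>x. x \<notin> {lo'..\<beta>} - W - S \<longrightarrow> even (below ({lo'..\<beta>} - W - S) x)) \<longleftrightarrow> S \<in> interlacing W"
    proof (rule row_matchable_iff)
      show "lo' \<le> \<beta>" using Suc.prems(1,4) by (simp add: \<beta>_def lo'_def)
      show "even (\<beta> - lo')" using par unfolding \<beta>_def by presburger
      show "finite W" using finU by (simp add: W_def)
      show "lo' \<le> c \<and> c \<le> \<beta> \<and> odd (c - lo')" if "c \<in> S" for c
        using SX[OF that] by (simp add: lo'_def)
    qed (use W finS in auto)
    finally have 1: "domino_sum (?A - Pair r ` S) = (if S \<in> interlacing W then 1 else 0)" .
    have 2: "domino_sum (?B - Pair (r + 1) ` S) = trapezoid_value (Suc s) S"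
    proof (rule Suc.IH[OF t Suc.prems(2-4)])
      fix c assume "c \<in> S"
      then show "lo \<le> c \<and> c \<le> 2 * M - 2 - (r + 1) \<and> even (c - (r + 1))"
        using SX(1,4,5)[of c] by presburger
    qed
    show "(\<Prod>c\<in>S. brick_weight {(r, c), (r + 1, c)}) * domino_sum (?A - Pair r ` S) * domino_sum (?B - Pair (r + 1) ` S) =
        (if S \<in> interlacing W then (\<Prod>c\<in>S. om c) * trapezoid_value (Suc s) S else 0)"
      unfolding 1 2 brick_weight_vertical by (simp add: om_def)
  qed
  also have "\<dots> = (\<Sum>S\<in>interlacing W. (\<Prod>c\<in>S. om c) * trapezoid_value (Suc s) S)"
  proof -
    have "interlacing W \<subseteq> Pow X"
    proof
      fix S assume S: "S \<in> interlacing W"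
      have "c \<in> X" if c: "c \<in> S" for c
      proof -
        have a: "lo' < c \<and> c < \<beta> \<and> odd (c - lo')"
          by (rule interlacing_subset[OF W S c])
        moreover have "lo \<le> lo' + 1" by (simp add: lo'_def)
        moreover have "odd (c - r)" using a par by presburger
        ultimately show ?thesis by (auto simp: X_def \<beta>_def)
      qed
      then show "S \<in> Pow X" by auto
    qed
    then show ?thesis
      using finX by (subst sum.inter_restrict[symmetric]) (auto simp: Int_absorb1)
  qed
  also have "\<dots> = trapezoid_value (Suc (Suc s)) U"
  \<comment> \<open>Without a wall point the sum leads from \<open>ovdm\<close> to
    \<open>vdm\<close>, with one it leads from \<open>vdm\<close> to \<open>ovdm\<close>; the two
    cases alternate from row to row.\<close>
  proof (cases "even (lo - r)")
    case True
    have es: "odd s" using True Suc.prems(1,3) by auto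
    then obtain n where n: "Suc s = 2 * n" by (metis evenE even_Suc)
    have WU: "W = U" using True by (simp add: W_def)
    \<comment> \<open>In such a row the interlacing points lie strictly to the right of
      \<open>lo\<close>, so column 0 is not reached and no weight 1/2 occurs.\<close>
    have om1: "(\<Prod>c\<in>S. om c) = 1" if S: "S \<in> interlacing U" for S
    proof (rule prod.neutral, rule ballI)
      fix c assume c: "c \<in> S"
      have "lo' < c" using interlacing_subset[OF W S[folded WU] c] by simp
      then show "om c = 1" using True Suc.prems(2) by (auto simp: om_def lo'_def)
    qed
    show ?thesis
    proof (cases "card U = Suc n")
      case cU: True
      have "(\<Sum>S\<in>interlacing W. (\<Prod>c\<in>S. om c) * trapezoid_value (Suc s) S) = (\<Sum>S\<in>interlacing U. ovdm S / H2_fun (Suc (2 * n)))"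
        unfolding WU
      proof (rule sum.cong[OF refl])
        fix S assume S: "S \<in> interlacing U"
        have "card S = n" using S cU by (simp add: interlacing_def)
        then show "(\<Prod>c\<in>S. om c) * trapezoid_value (Suc s) S = ovdm S / H2_fun (Suc (2 * n))"
          by (simp add: om1[OF S] trapezoid_value_def n)
      qed
      also have "\<dots> = vdm U / (2 ^ n * fact n) / H2_fun (Suc (2 * n))"
        unfolding sum_divide_distrib[symmetric]
      proof (subst sum_ovdm_interlacing[OF finU cU])
        show "even (v - w)" if "v \<in> U" "w \<in> U" for v w
          using U(3)[OF that(1)] U(3)[OF that(2)] by presburger
      qed simp
      also have "\<dots> = vdm U / H2_fun (Suc (Suc (2 * n)))"
        by (simp add: H2_fun_even)
      also have "\<dots> = trapezoid_value (Suc (Suc s)) U"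
        using es by (simp add: trapezoid_value_def n cU)
      finally show ?thesis .
    next
      case cU: False
      have "(\<Sum>S\<in>interlacing W. (\<Prod>c\<in>S. om c) * trapezoid_value (Suc s) S) = 0"
      proof (rule sum.neutral, rule ballI)
        fix S assume S: "S \<in> interlacing W"
        have "card S \<noteq> n" using S cU by (auto simp: interlacing_def WU)
        then show "(\<Prod>c\<in>S. om c) * trapezoid_value (Suc s) S = 0"
          by (simp add: trapezoid_value_def n)
      qed
      then show ?thesis using cU es n by (simp add: trapezoid_value_def)
    qed
  next
    case False
    have es: "even s" using False Suc.prems(1,3) by auto
    then obtain n where n: "s = 2 * n" by (elim evenE)
    have WU: "W = insert (lo - 1) U" using False by (simp add: W_def)
    have cW: "card W = Suc (card U)"
      unfolding WU using finU U(1)[of "lo - 1"] by (subst card_insert_disjoint) auto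
    have cS: "card S = card U" if "S \<in> interlacing W" for S
      using that cW by (simp add: interlacing_def)
    show ?thesis
    proof (cases "card U = Suc n")
      case cU: True
      have "(\<Sum>S\<in>interlacing W. (\<Prod>c\<in>S. om c) * trapezoid_value (Suc s) S) =
          (\<Sum>S\<in>interlacing W. (\<Prod>c\<in>S. om c) * vdm S / H2_fun (2 * Suc n))"
        by (intro sum.cong refl) (simp add: trapezoid_value_def n cS cU)
      also have "\<dots> = ovdm U / (\<Prod>j<Suc n. 2 * real j + 1) / H2_fun (2 * Suc n)"
        unfolding sum_divide_distrib[symmetric] WU om_def
      proof (subst sum_vdm_interlacing_wall[OF finU Suc.prems(2)])
        show "lo \<le> u \<and> odd (u - lo)" if "u \<in> U" for u
          using U[OF that] False by presburger
      qed (simp add: cU)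
      also have "\<dots> = trapezoid_value (Suc (Suc s)) U"
        unfolding trapezoid_value_def using es cU n H2_fun_odd[of "Suc n"] by (simp add: mult.commute)
      finally show ?thesis .
    next
      case cU: False
      have "(\<Sum>S\<in>interlacing W. (\<Prod>c\<in>S. om c) * trapezoid_value (Suc s) S) = 0"
        using cU cS n by (intro sum.neutral ballI) (auto simp: trapezoid_value_def)
      then show ?thesis using cU es n by (simp add: trapezoid_value_def)
    qed
  qed
  finally show ?case unfolding split .
qed

text \<open>Row k goes to row -1 - k, which changes the parity of \<open>c - k\<close>: up- and
  down-pointing triangles are exchanged. The lower part can thus be treated as a trapezoid standing
  on its base.\<close>

lemma matching_sum_reflect:
  "domino_sum ((\<lambda>(k, c). (- 1 - k, c)) ` R) = domino_sum R"
proof (rule matching_sum_image)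
  let ?h = "\<lambda>(k :: int, c :: int). (- 1 - k, c)"
  have hh: "?h ` ?h ` l = l" for l by (force simp: image_iff)
  have br: "?h ` l \<in> bricks" if l: "l \<in> bricks" for l
  proof -
    from l consider k c where "l = {(k, c), (k, c + 1)}" | k c where "l = {(k, c), (k - 1, c)}" "even (c - k)"
      unfolding bricks_def by blast
    then show ?thesis
    proof cases
      case 1
      then show ?thesis using horizontal_brick[of "- 1 - k" c] by simp
    next
      case 2
      then have "odd (c - (- 1 - k))" by presburger
      from vertical_brick[OF this] show ?thesis using 2 by simp
    qed
  qed
  show "inj_on ?h R" by (auto simp: inj_on_def)
  show "?h ` l \<in> bricks \<longleftrightarrow> l \<in> bricks" for l
    using br[of l] br[of "?h ` l"] unfolding hh by blast
  have w: "\<exists>k. ?h ` l = {(k, 0), (k - 1, 0)}" if l: "l = {(k, 0), (k - 1, 0)}" for l k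
    unfolding l by (intro exI[of _ "- k"]) auto
  show "brick_weight (?h ` l) = brick_weight l" for l
    using w[of l] w[of "?h ` l"] unfolding hh brick_weight_def by auto
qed

section \<open>Forced tilings of removed triangles\<close>

definition triangle :: "int \<Rightarrow> int \<Rightarrow> nat \<Rightarrow> (int \<times> int) set" where
  "triangle k c s = {(j, d). k \<le> j \<and> j < k + int s \<and> c + (j - k) \<le> d \<and> d \<le> c + 2 * int s - 2 - (j - k)}"

text \<open>Removing its bottom row of up-pointing unit triangles forces the tiling of the rest of a triangle.\<close>

lemma matching_sum_triangle:
  assumes "finite R" "triangle k c s \<subseteq> R" "even (c - k)" "0 \<le> c"
  shows "domino_sum (R - Pair k ` run c s) = domino_sum (R - triangle k c s)"
  using assms
proof (induction s arbitrary: k c R)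
  case 0
  have "triangle k c 0 = {}" by (auto simp: triangle_def)
  then show ?case by simp
next
  case (Suc s)
  \<comment> \<open>The down-pointing triangles of the bottom row. Both neighbours of each of them
    in the row are removed, so it must be joined to the row above.\<close>
  let ?X = "run (c + 1) s" and ?R0 = "R - Pair k ` run c (Suc s)"
  have in_tri: "(k, d) \<in> R" if "c \<le> d" "d \<le> c + 2 * int s" for d
    using Suc.prems(2) that by (auto simp: triangle_def)
  have in_tri': "(k + 1, d) \<in> R" if "c + 1 \<le> d" "d \<le> c + 2 * int s - 1" for d
    using Suc.prems(2) that by (auto simp: triangle_def)
  have X: "c + 1 \<le> d" "d \<le> c + 2 * int s - 1" "odd (d - k)" "d \<notin> run c (Suc s)" "d + 1 \<in> run c (Suc s)" "d - 1 \<in> run c (Suc s)"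
    if "d \<in> ?X" for d
    using that Suc.prems(3) unfolding run_def mem_Collect_eq of_nat_Suc by presburger+
  have "domino_sum ?R0 =
      domino_sum (?R0 - Pair k ` ?X - Pair (k + 1) ` ?X)"
  proof (rule matching_sum_forced_set)
    show "Pair k ` ?X \<subseteq> ?R0" using X in_tri by fastforce
    show "Pair (k + 1) ` ?X \<subseteq> ?R0" using X in_tri' by fastforce
    show "{(k, d), (k + 1, d)} \<in> bricks \<and> brick_weight {(k, d), (k + 1, d)} = 1" if "d \<in> ?X" for d
      using X(1,3)[OF that] Suc.prems(4) vertical_brick[of d k] by (simp add: brick_weight_vertical)
    show "l = {(k, d), (k + 1, d)}" if d: "d \<in> ?X" and l: "l \<in> bricks" "(k, d) \<in> l" "l \<subseteq> ?R0" for d l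
      by (rule brick_cases[OF l(1,2)]) (use l(3) X[OF d] in auto)
  qed (use Suc.prems in \<open>auto simp: inj_on_def\<close>)
  also have "?R0 - Pair k ` ?X - Pair (k + 1) ` ?X = (R - Pair k ` {c..c + 2 * int s}) - Pair (k + 1) ` ?X"
  proof -
    have "run c (Suc s) \<union> ?X = {c..c + 2 * int s}"
    proof (rule Set.set_eqI)
      show "x \<in> run c (Suc s) \<union> ?X \<longleftrightarrow> x \<in> {c..c + 2 * int s}" for x
        unfolding run_def Un_iff mem_Collect_eq of_nat_Suc atLeastAtMost_iff by presburger
    qed
    then have "Pair k ` {c..c + 2 * int s} = Pair k ` run c (Suc s) \<union> Pair k ` ?X" by (simp only: image_Un[symmetric])
    then show ?thesis by blast
  qed
  also have "domino_sum \<dots> =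
      domino_sum (R - Pair k ` {c..c + 2 * int s} - triangle (k + 1) (c + 1) s)"
  proof (rule Suc.IH)
    show "triangle (k + 1) (c + 1) s \<subseteq> R - Pair k ` {c..c + 2 * int s}"
      using Suc.prems(2) by (auto simp: triangle_def)
  qed (use Suc.prems in auto)
  also have "R - Pair k ` {c..c + 2 * int s} - triangle (k + 1) (c + 1) s = R - triangle k c (Suc s)"
  proof -
    have "triangle k c (Suc s) = Pair k ` {c..c + 2 * int s} \<union> triangle (k + 1) (c + 1) s"
    proof (rule Set.set_eqI)
      fix p :: "int \<times> int"
      obtain j d where "p = (j, d)" by (cases p)
      then show "p \<in> triangle k c (Suc s) \<longleftrightarrow> p \<in> Pair k ` {c..c + 2 * int s} \<union> triangle (k + 1) (c + 1) s"
        by (cases "j = k") (auto simp: triangle_def)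
    qed
    then show ?thesis by blast
  qed
  finally show ?case .
qed

definition half_triangle :: "int \<Rightarrow> nat \<Rightarrow> (int \<times> int) set" where
  "half_triangle k \<beta> = {(j, c). k \<le> j \<and> 1 \<le> c \<and> c \<le> int \<beta> - (j - k)}"

text \<open>The wall replaces the left side of the triangle: a down-pointing cell in column 1 has no
  left neighbour because the region contains nothing in column 0, so the same forcing takes
  place.\<close>

lemma matching_sum_half_triangle:
  assumes "finite R" "half_triangle k \<beta> \<subseteq> R" "even (int \<beta> - k)" "\<And>j c. (j, c) \<in> R \<Longrightarrow> k \<le> j \<Longrightarrow> 1 \<le> c"
  shows "domino_sum (R - Pair k ` {c. 1 \<le> c \<and> c \<le> int \<beta> \<and> even (c - k)}) =
    domino_sum (R - half_triangle k \<beta>)"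
  using assms
proof (induction \<beta> arbitrary: k R)
  case 0
  have "half_triangle k 0 = {}" "{c::int. 1 \<le> c \<and> c \<le> int 0 \<and> even (c - k)} = {}"
    by (auto simp: half_triangle_def)
  then show ?case by (simp only: image_empty)
next
  case (Suc \<beta>)
  define Y where "Y = {c. 1 \<le> c \<and> c \<le> int (Suc \<beta>) \<and> even (c - k)}"
  define X where "X = {c. 1 \<le> c \<and> c \<le> int \<beta> \<and> even (c - (k + 1))}"
  let ?R0 = "R - Pair k ` Y"
  have in_tri: "(k, d) \<in> R" if "1 \<le> d" "d \<le> int \<beta>" for d
    using Suc.prems(2) that by (auto simp: half_triangle_def)
  have in_tri': "(k + 1, d) \<in> R" if "1 \<le> d" "d \<le> int \<beta>" for d
    using Suc.prems(2) that by (auto simp: half_triangle_def)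
  have X: "1 \<le> d" "d \<le> int \<beta>" "odd (d - k)" "d \<notin> Y" "d + 1 \<in> Y" "d - 1 \<in> Y \<or> d - 1 = 0"
    if "d \<in> X" for d
    using that unfolding X_def Y_def mem_Collect_eq of_nat_Suc by presburger+
  have nR: "(k, 0) \<notin> R" using Suc.prems(4)[of k 0] by auto
  have "finite X" by (rule finite_subset[of _ "{1..int \<beta>}"]) (auto simp: X_def)
  have "domino_sum ?R0 =
      domino_sum (?R0 - Pair k ` X - Pair (k + 1) ` X)"
  proof (rule matching_sum_forced_set)
    show "Pair k ` X \<subseteq> ?R0" using X(1,2,4) in_tri by blast
    show "Pair (k + 1) ` X \<subseteq> ?R0" using X(1,2) in_tri' by auto
    show "{(k, d), (k + 1, d)} \<in> bricks \<and> brick_weight {(k, d), (k + 1, d)} = 1" if "d \<in> X" for d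
      using X(1,3)[OF that] vertical_brick[of d k] by (simp add: brick_weight_vertical)
    show "l = {(k, d), (k + 1, d)}" if d: "d \<in> X" and l: "l \<in> bricks" "(k, d) \<in> l" "l \<subseteq> ?R0" for d l
    proof (rule brick_cases[OF l(1,2)])
      assume "l = {(k, d), (k, d + 1)}"
      then show ?thesis using l(3) X(5)[OF d] by blast
    next
      assume "l = {(k, d), (k, d - 1)}"
      then show ?thesis using l(3) X(6)[OF d] nR by auto
    next
      assume "even (d - k)"
      then show ?thesis using X(3)[OF d] by blast
    qed
  qed (use Suc.prems \<open>finite X\<close> in \<open>auto simp: inj_on_def\<close>)
  also have "?R0 - Pair k ` X - Pair (k + 1) ` X = (R - Pair k ` {1..int (Suc \<beta>)}) - Pair (k + 1) ` X"
  proof -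
    have "Y \<union> X = {1..int (Suc \<beta>)}"
    proof (rule Set.set_eqI)
      show "x \<in> Y \<union> X \<longleftrightarrow> x \<in> {1..int (Suc \<beta>)}" for x
        using Suc.prems(3) unfolding X_def Y_def Un_iff mem_Collect_eq of_nat_Suc atLeastAtMost_iff by presburger
    qed
    then have "Pair k ` {1..int (Suc \<beta>)} = Pair k ` Y \<union> Pair k ` X" by (simp only: image_Un[symmetric])
    then show ?thesis by blast
  qed
  also have "domino_sum \<dots> =
      domino_sum (R - Pair k ` {1..int (Suc \<beta>)} - half_triangle (k + 1) \<beta>)"
    unfolding X_def
  proof (rule Suc.IH)
    show "half_triangle (k + 1) \<beta> \<subseteq> R - Pair k ` {1..int (Suc \<beta>)}"
      using Suc.prems(2) by (auto simp: half_triangle_def)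
    show "even (int \<beta> - (k + 1))" using Suc.prems(3) unfolding of_nat_Suc by presburger
    show "1 \<le> c" if "(j, c) \<in> R - Pair k ` {1..int (Suc \<beta>)}" "k + 1 \<le> j" for j c
      using Suc.prems(4)[of j c] that by auto
  qed (use Suc.prems in auto)
  also have "R - Pair k ` {1..int (Suc \<beta>)} - half_triangle (k + 1) \<beta> = R - half_triangle k (Suc \<beta>)"
  proof -
    have "half_triangle k (Suc \<beta>) = Pair k ` {1..int (Suc \<beta>)} \<union> half_triangle (k + 1) \<beta>"
    proof (rule Set.set_eqI)
      fix p :: "int \<times> int"
      obtain j d where "p = (j, d)" by (cases p)
      then show "p \<in> half_triangle k (Suc \<beta>) \<longleftrightarrow> p \<in> Pair k ` {1..int (Suc \<beta>)} \<union> half_triangle (k + 1) \<beta>"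
        by (cases "j = k") (auto simp: half_triangle_def)
    qed
    then show ?thesis by blast
  qed
  finally show ?case unfolding Y_def .
qed

text \<open>An entry \<open>(p, s)\<close> describes a dent of side s whose base has its left end at
  the doubled abscissa p.\<close>

definition dent_codes :: "(int \<times> nat) set \<Rightarrow> int set" where
  "dent_codes D = (\<Union>(p, s)\<in>D. run p s)"

definition dent_triangles :: "(int \<times> nat) set \<Rightarrow> (int \<times> int) set" where
  "dent_triangles D = (\<Union>(p, s)\<in>D. triangle 0 p s)"

definition separated :: "(int \<times> nat) set \<Rightarrow> bool" where
  "separated D \<longleftrightarrow> (\<forall>(p, s)\<in>D. \<forall>(q, r)\<in>D. (p, s) \<noteq> (q, r) \<longrightarrow> p + 2 * int s \<le> q \<or> q + 2 * int r \<le> p)"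

lemma triangle_disjoint: "p + 2 * int s \<le> q \<Longrightarrow> triangle k p s \<inter> triangle k q r = {}"
  by (auto simp: triangle_def)

lemma run_subset_triangle: "Pair k ` run c s \<subseteq> triangle k c s"
proof
  fix p assume "p \<in> Pair k ` run c s"
  then obtain d where "p = (k, d)" "d \<in> run c s" by auto
  then show "p \<in> triangle k c s" using run_D[of d c s] by (auto simp: triangle_def run_def)
qed

lemma matching_sum_dents:
  assumes "finite D" "separated D" "finite R" "dent_triangles D \<subseteq> R" "\<And>p s. (p, s) \<in> D \<Longrightarrow> even p \<and> 0 \<le> p"
  shows "domino_sum (R - Pair 0 ` dent_codes D) = domino_sum (R - dent_triangles D)"
  using assms
proof (induction D arbitrary: R rule: finite_induct)
  case empty
  then show ?case by (simp add: dent_codes_def dent_triangles_def)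
next
  case (insert x D)
  obtain p s where x: "x = (p, s)" by (cases x)
  have sep: "separated D" using insert.prems(1) by (auto simp: separated_def)
  have dis: "triangle 0 p s \<inter> dent_triangles D = {}"
  proof -
    have "triangle 0 p s \<inter> triangle 0 q r = {}" if "(q, r) \<in> D" for q r
    proof -
      have "(p, s) \<noteq> (q, r)" using that insert.hyps(2) x by auto
      then have "p + 2 * int s \<le> q \<or> q + 2 * int r \<le> p"
        using insert.prems(1) that by (auto simp: separated_def x)
      then show ?thesis using triangle_disjoint[of p s q 0 r] triangle_disjoint[of q r p 0 s] by blast
    qed
    then show ?thesis by (auto simp: dent_triangles_def)
  qed
  have T: "dent_triangles (insert x D) = triangle 0 p s \<union> dent_triangles D"
    and C: "dent_codes (insert x D) = run p s \<union> dent_codes D"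
    by (simp_all add: x dent_triangles_def dent_codes_def)
  have "R - Pair 0 ` dent_codes (insert x D) = R - Pair 0 ` run p s - Pair 0 ` dent_codes D"
    unfolding C by blast
  also have "domino_sum \<dots> =
      domino_sum (R - Pair 0 ` run p s - dent_triangles D)"
  proof (rule insert.IH[OF sep])
    show "dent_triangles D \<subseteq> R - Pair 0 ` run p s"
      using insert.prems(3) dis run_subset_triangle[of 0 p s] unfolding T by blast
  qed (use insert.prems in auto)
  also have "R - Pair 0 ` run p s - dent_triangles D = R - dent_triangles D - Pair 0 ` run p s" by blast
  also have "domino_sum \<dots> = domino_sum (R - dent_triangles D - triangle 0 p s)"
    by (rule matching_sum_triangle) (use insert.prems dis T in \<open>auto simp: x\<close>)
  also have "R - dent_triangles D - triangle 0 p s = R - dent_triangles (insert x D)"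
    unfolding T by blast
  finally show ?case .
qed

lemma dent_codes_iff:
  assumes "\<And>p s. (p, s) \<in> D \<Longrightarrow> even p \<and> 0 \<le> p" "even c"
  shows "c \<in> dent_codes D \<longleftrightarrow> (0, c) \<in> dent_triangles D"
proof -
  have "c \<in> run p s \<longleftrightarrow> (0, c) \<in> triangle 0 p s" if "(p, s) \<in> D" for p s
    using assms(1)[OF that] assms(2) unfolding triangle_def run_def mem_Collect_eq prod.case by presburger
  then show ?thesis by (auto simp: dent_codes_def dent_triangles_def)
qed

text \<open>Forced tilings let the triangles be traded for the cells on their bases, to which the
  evaluation of the plain trapezoid applies. The size conditions presuppose \<open>0 < s\<close>, so
  that a part without rows is covered as well.\<close>

lemma matching_sum_dented_trapezoid:
  fixes lo M :: int and s :: nat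
  assumes lo: "lo = 0 \<or> lo = 1" and M: "0 < s \<Longrightarrow> odd (lo - int s)" "0 < s \<Longrightarrow> lo \<le> 2 * M - 1 - int s"
    and D: "finite D" "separated D" "dent_triangles D \<subseteq> trapezoid lo M 0 (int s)" "\<And>p r. (p, r) \<in> D \<Longrightarrow> even p \<and> 0 \<le> p"
    and S: "\<And>c. c \<in> S \<Longrightarrow> lo \<le> c \<and> c \<le> 2 * M - 2 \<and> even c" "S \<inter> dent_codes D = {}" "s = 0 \<Longrightarrow> S = {}"
  shows "domino_sum (trapezoid lo M 0 (int s) - dent_triangles D - Pair 0 ` S) =
    trapezoid_value s (dent_codes D \<union> S)"
proof -
  let ?R = "trapezoid lo M 0 (int s) - Pair 0 ` S"
  have sub: "dent_triangles D \<subseteq> ?R"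
  proof
    fix x assume x: "x \<in> dent_triangles D"
    have "x \<noteq> (0, c)" if "c \<in> S" for c
      using dent_codes_iff[of D c, OF D(4)] S(1)[OF that] S(2) that x by auto
    then show "x \<in> ?R" using x D(3) by blast
  qed
  have "trapezoid lo M 0 (int s) - dent_triangles D - Pair 0 ` S = ?R - dent_triangles D" by blast
  also have "domino_sum \<dots> = domino_sum (?R - Pair 0 ` dent_codes D)"
    by (rule matching_sum_dents[symmetric]) (use D sub in auto)
  also have "?R - Pair 0 ` dent_codes D = trapezoid lo M 0 (int s) - Pair 0 ` (dent_codes D \<union> S)" by blast
  also have "domino_sum \<dots> = trapezoid_value s (dent_codes D \<union> S)"
  proof -
    have codes: "Pair 0 ` dent_codes D \<subseteq> trapezoid lo M 0 (int s)"
      using D(3) run_subset_triangle[of 0] by (fastforce simp: dent_codes_def dent_triangles_def)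
    show ?thesis
    proof (cases s)
      case 0
      then have "trapezoid lo M 0 (int s) = {}" by (auto simp: trapezoid_def)
      moreover from this have "dent_codes D = {}" using codes by auto
      ultimately show ?thesis using S(3) 0 by (simp add: trapezoid_value_def)
    next
      case (Suc s')
      show ?thesis
        unfolding Suc
      proof (rule matching_sum_trapezoid)
        have ev: "even c" if "c \<in> dent_codes D" for c
          using that D(4) by (fastforce simp: dent_codes_def run_def)
        show "lo \<le> u \<and> u \<le> 2 * M - 2 - 0 \<and> even (u - 0)" if "u \<in> dent_codes D \<union> S" for u
          using that codes S(1)[of u] ev[of u] by (auto simp: trapezoid_def)
      qed (use lo M Suc in auto)
    qed
  qed
  finally show ?thesis .
qed

section \<open>Dents prescribed by sequences\<close>

lemma seq_term_Cons: "seq_term (x # xs) (Suc i) = (if i = 0 then x else seq_term xs i)"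
  by (auto simp: seq_term_def nth_Cons')

lemma seq_term_zero: "length xs < i \<Longrightarrow> seq_term xs i = 0"
  by (simp add: seq_term_def)

lemma partial_sum_0 [simp]: "partial_sum xs 0 = 0"
  by (simp add: partial_sum_def)

lemma partial_sum_Suc: "partial_sum xs (Suc k) = partial_sum xs k + seq_term xs (Suc k)"
  by (simp add: partial_sum_def)

lemma partial_sum_Cons: "partial_sum (x # xs) (Suc k) = x + partial_sum xs k"
  by (induction k) (simp_all add: partial_sum_Suc seq_term_Cons)

lemma partial_sum_Nil [simp]: "partial_sum [] k = 0"
  by (simp add: partial_sum_def seq_term_def)

lemma partial_sum_mono: "i \<le> j \<Longrightarrow> partial_sum xs i \<le> partial_sum xs j"
  unfolding partial_sum_def by (rule sum_mono2) auto

lemma partial_sum_all: "length xs \<le> k \<Longrightarrow> partial_sum xs k = sum_list xs"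
proof (induction xs arbitrary: k)
  case (Cons x xs)
  then obtain k' where "k = Suc k'" by (cases k) auto
  then show ?case using Cons by (simp add: partial_sum_Cons)
qed simp

lemma partial_sum_le: "partial_sum xs k \<le> sum_list xs"
  using partial_sum_mono[of k "k + length xs" xs] partial_sum_all[of xs "k + length xs"] by simp

lemma partial_sum_pred: "1 \<le> i \<Longrightarrow> partial_sum xs i = partial_sum xs (i - 1) + seq_term xs i"
  by (cases i) (simp_all add: partial_sum_Suc)

text \<open>Position n is the unit segment from n to n + 1 of the base. Terms are dents and gaps in
  turn, so the flag is flipped at each term.\<close>

fun marks :: "bool \<Rightarrow> nat \<Rightarrow> nat list \<Rightarrow> nat set" where
  "marks d u [] = {}"
| "marks d u (x # xs) = (if d then {u..<u + x} else {}) \<union> marks (\<not> d) (u + x) xs"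

lemma marks_eq: "marks d u xs = (\<Union>i\<in>{i. 1 \<le> i \<and> odd i = d}. {u + partial_sum xs (i - 1)..<u + partial_sum xs i})"
proof (induction xs arbitrary: d u)
  case (Cons x xs)
  have "{i. 1 \<le> i \<and> odd i = d} = (if d then {1} else {}) \<union> Suc ` {i. 1 \<le> i \<and> odd i = (\<not> d)}"
  proof (rule Set.set_eqI)
    show "i \<in> {i. 1 \<le> i \<and> odd i = d} \<longleftrightarrow> i \<in> (if d then {1} else {}) \<union> Suc ` {i. 1 \<le> i \<and> odd i = (\<not> d)}" for i
      by (cases i) (auto simp: image_iff Suc_le_eq odd_pos)
  qed
  then have "(\<Union>i\<in>{i. 1 \<le> i \<and> odd i = d}. {u + partial_sum (x # xs) (i - 1)..<u + partial_sum (x # xs) i}) =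
      (if d then {u..<u + x} else {}) \<union>
      (\<Union>i\<in>{i. 1 \<le> i \<and> odd i = (\<not> d)}. {u + partial_sum (x # xs) i..<u + partial_sum (x # xs) (Suc i)})"
    by (auto simp: partial_sum_Cons[of x xs 0, simplified])
  also have "(\<Union>i\<in>{i. 1 \<le> i \<and> odd i = (\<not> d)}. {u + partial_sum (x # xs) i..<u + partial_sum (x # xs) (Suc i)}) =
      (\<Union>i\<in>{i. 1 \<le> i \<and> odd i = (\<not> d)}. {u + x + partial_sum xs (i - 1)..<u + x + partial_sum xs i})"
  proof (intro SUP_cong refl)
    fix i :: nat assume "i \<in> {i. 1 \<le> i \<and> odd i = (\<not> d)}"
    then obtain j where "i = Suc j" by (cases i) auto
    then show "{u + partial_sum (x # xs) i..<u + partial_sum (x # xs) (Suc i)} =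
        {u + x + partial_sum xs (i - 1)..<u + x + partial_sum xs i}"
      by (simp add: partial_sum_Cons add.assoc)
  qed
  finally show ?case by (simp add: Cons.IH)
qed simp

lemma marks_subset: "marks d u xs \<subseteq> {u..<u + sum_list xs}"
proof (induction xs arbitrary: d u)
  case (Cons x xs)
  show ?case using Cons.IH[of "\<not> d" "u + x"] by (auto split: if_splits simp: subset_iff)
qed simp

lemma marks_Un: "marks d u xs \<union> marks (\<not> d) u xs = {u..<u + sum_list xs}"
proof (induction xs arbitrary: d u)
  case (Cons x xs)
  have "marks d u (x # xs) \<union> marks (\<not> d) u (x # xs) =
      {u..<u + x} \<union> (marks (\<not> d) (u + x) xs \<union> marks (\<not> \<not> d) (u + x) xs)" by auto
  also have "\<dots> = {u..<u + x} \<union> {u + x..<u + x + sum_list xs}" by (simp only: Cons.IH)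
  also have "\<dots> = {u..<u + sum_list (x # xs)}" by auto
  finally show ?case .
qed simp

lemma marks_disjoint: "marks d u xs \<inter> marks (\<not> d) u xs = {}"
proof (induction xs arbitrary: d u)
  case (Cons x xs)
  have "marks e (u + x) xs \<inter> {u..<u + x} = {}" for e using marks_subset[of e "u + x" xs] by auto
  then show ?case using Cons.IH[of "\<not> d" "u + x"] by auto
qed simp

lemma marks_append: "marks d u (xs @ ys) = marks d u xs \<union> marks (if even (length xs) then d else \<not> d) (u + sum_list xs) ys"
  by (induction xs arbitrary: d u) (auto simp: add.assoc)

lemma marks_Suc: "marks d (Suc u) xs = Suc ` marks d u xs"
proof (induction xs arbitrary: d u)
  case (Cons x xs)
  show ?case using Cons.IH[of "\<not> d" "u + x"] by (auto simp: image_Un)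
qed simp

text \<open>Reflection of the base keeps the segments but counts the terms from the other end;
  whether the first of them is marked then depends on the parity of the length.\<close>

lemma marks_rev:
  "marks d u (rev xs) = {n. u \<le> n \<and> n < u + sum_list xs \<and>
     u + sum_list xs - 1 - n \<in> marks (if odd (length xs) then d else \<not> d) 0 xs}"
proof (induction xs arbitrary: d u)
  case (Cons x xs)
  let ?e = "if odd (length (x # xs)) then d else \<not> d"
  have m: "marks e (0 + x) xs = (+) x ` marks e 0 xs" for e x
  proof (induction x)
    case (Suc x)
    then show ?case by (simp add: marks_Suc image_image)
  qed simp
  note m = m[of _ x, simplified]
  have sub: "n < sum_list xs" if "n \<in> marks e 0 xs" for n e using marks_subset[of e 0 xs] that by auto
  have "marks d u (rev (x # xs)) = marks d u (rev xs) \<union> (if ?e then {u + sum_list xs..<u + sum_list xs + x} else {})"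
    by (auto simp: marks_append)
  also have "\<dots> = {n. u \<le> n \<and> n < u + sum_list (x # xs) \<and> u + sum_list (x # xs) - 1 - n \<in> marks ?e 0 (x # xs)}"
  proof (rule Set.set_eqI)
    fix n
    show "n \<in> marks d u (rev xs) \<union> (if ?e then {u + sum_list xs..<u + sum_list xs + x} else {}) \<longleftrightarrow>
      n \<in> {n. u \<le> n \<and> n < u + sum_list (x # xs) \<and> u + sum_list (x # xs) - 1 - n \<in> marks ?e 0 (x # xs)}"
    proof (cases "n < u + sum_list xs")
      case True
      then have "u + sum_list (x # xs) - 1 - n = x + (u + sum_list xs - 1 - n)" by simp
      then have "u + sum_list (x # xs) - 1 - n \<in> marks ?e 0 (x # xs) \<longleftrightarrow> u + sum_list xs - 1 - n \<in> marks (\<not> ?e) 0 xs"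
        by (auto simp: m)
      then show ?thesis using True by (auto simp: Cons.IH)
    next
      case ge: False
      show ?thesis
      proof (cases "n < u + sum_list (x # xs)")
        case True
        then have "u + sum_list (x # xs) - 1 - n < x" using ge by auto
        then have "u + sum_list (x # xs) - 1 - n \<in> marks ?e 0 (x # xs) \<longleftrightarrow> ?e"
          by (auto simp: m)
        then show ?thesis using ge True by (auto simp: Cons.IH)
      next
        case False
        then show ?thesis using ge by (auto simp: Cons.IH)
      qed
    qed
  qed
  finally show ?case .
qed simp

lemma odd_sum_Cons: "odd_sum (x # xs) = x + even_sum xs"
  and even_sum_Cons: "even_sum (x # xs) = odd_sum xs"
proof -
  have 1: "{i. i \<in> {1..length (x # xs)} \<and> odd i} = insert 1 (Suc ` {i. i \<in> {1..length xs} \<and> even i})"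
  proof (rule Set.set_eqI)
    show "i \<in> {i. i \<in> {1..length (x # xs)} \<and> odd i} \<longleftrightarrow> i \<in> insert 1 (Suc ` {i. i \<in> {1..length xs} \<and> even i})" for i
      by (cases i) (auto simp: image_iff Suc_le_eq intro: Nat.gr0I)
  qed
  show "odd_sum (x # xs) = x + even_sum xs"
    unfolding odd_sum_def even_sum_def 1
    by (subst sum.insert) (auto simp: sum.reindex seq_term_Cons intro!: sum.cong)
  have 2: "{i. i \<in> {1..length (x # xs)} \<and> even i} = Suc ` {i. i \<in> {1..length xs} \<and> odd i}"
  proof (rule Set.set_eqI)
    show "i \<in> {i. i \<in> {1..length (x # xs)} \<and> even i} \<longleftrightarrow> i \<in> Suc ` {i. i \<in> {1..length xs} \<and> odd i}" for i
      by (cases i) (auto simp: image_iff Suc_le_eq intro: Nat.gr0I)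
  qed
  show "even_sum (x # xs) = odd_sum xs"
    unfolding odd_sum_def even_sum_def 2 by (auto simp: sum.reindex seq_term_Cons intro!: sum.cong)
qed

lemma odd_even_sum_Nil [simp]: "odd_sum [] = 0" "even_sum [] = 0"
  by (simp_all add: odd_sum_def even_sum_def)

lemma odd_even_sum: "odd_sum xs + even_sum xs = sum_list xs"
  by (induction xs) (simp_all add: odd_sum_Cons even_sum_Cons)

lemma finite_marks [simp]: "finite (marks d u xs)"
  by (rule finite_subset[OF marks_subset]) simp

lemma card_marks: "card (marks d u xs) = (if d then odd_sum xs else even_sum xs)"
proof (induction xs arbitrary: d u)
  case (Cons x xs)
  have "marks e (u + x) xs \<inter> {u..<u + x} = {}" for e using marks_subset[of e "u + x" xs] by auto
  then have "{u..<u + x} \<inter> marks e (u + x) xs = {}" for e by blast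
  then show ?case using Cons.IH[of "\<not> d" "u + x"] by (simp add: card_Un_disjoint odd_sum_Cons even_sum_Cons)
qed simp

lemma seq_term_le_sum:
  "seq_term xs i \<le> (if odd i then odd_sum xs else even_sum xs)"
proof (cases "1 \<le> i \<and> i \<le> length xs")
  case True
  show ?thesis
    unfolding odd_sum_def even_sum_def
    using member_le_sum[of i "{i. i \<in> {1..length xs} \<and> odd i}" "seq_term xs"]
      member_le_sum[of i "{i. i \<in> {1..length xs} \<and> even i}" "seq_term xs"] True by auto
next
  case False
  then show ?thesis by (auto simp: seq_term_def)
qed

lemma seq_term_map: "seq_term (map (seq_term xs) [Suc 0..<N]) i = (if 1 \<le> i \<and> i < N then seq_term xs i else 0)"
  by (auto simp: seq_term_def[of "map _ _"])

lemma partial_sum_map: "partial_sum (map (seq_term xs) [Suc 0..<N]) k = partial_sum xs (min k (N - 1))"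
proof (induction k)
  case (Suc k)
  show ?case
  proof (cases "Suc k < N")
    case True
    then have "min (Suc k) (N - 1) = Suc k" "min k (N - 1) = k" by simp_all
    then show ?thesis using Suc True by (simp add: partial_sum_Suc seq_term_map)
  next
    case False
    then have "min (Suc k) (N - 1) = N - 1" "min k (N - 1) = N - 1" by simp_all
    then show ?thesis using Suc False by (simp add: partial_sum_Suc seq_term_map)
  qed
qed simp

text \<open>Copes with the rounded lengths in t+ and t-: padding by zeros adds nothing, and cutting
  the list loses nothing as long as no nonzero marked term is cut off.\<close>

lemma marks_map:
  assumes "\<And>i. N \<le> i \<Longrightarrow> odd i = d \<Longrightarrow> length xs < i"
  shows "marks d u (map (seq_term xs) [Suc 0..<N]) = marks d u xs"
  unfolding marks_eq
proof (intro SUP_cong refl)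
  fix i :: nat assume i: "i \<in> {i. 1 \<le> i \<and> odd i = d}"
  show "{u + partial_sum (map (seq_term xs) [Suc 0..<N]) (i - 1)..<u + partial_sum (map (seq_term xs) [Suc 0..<N]) i} =
      {u + partial_sum xs (i - 1)..<u + partial_sum xs i}"
  proof (cases "i < N")
    case True
    then have "min i (N - 1) = i" "min (i - 1) (N - 1) = i - 1" by simp_all
    then show ?thesis by (simp only: partial_sum_map)
  next
    case False
    then have "min i (N - 1) = N - 1" "min (i - 1) (N - 1) = N - 1" by simp_all
    moreover have "seq_term xs i = 0" using assms[of i] i False by (simp add: seq_term_zero)
    then have "partial_sum xs i = partial_sum xs (i - 1)" using i by (simp add: partial_sum_pred)
    ultimately show ?thesis by (simp add: partial_sum_map)
  qed
qed

lemma sum_list_map_seq: "sum_list (map (seq_term xs) [Suc 0..<N]) = partial_sum xs (N - 1)"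
  using partial_sum_all[of "map (seq_term xs) [Suc 0..<N]" "N - 1"] by (simp add: partial_sum_map)

text \<open>The positions marked by a sequence that is laid out from \<open>L\<close> to the left.\<close>

definition marks_left :: "bool \<Rightarrow> nat \<Rightarrow> nat list \<Rightarrow> nat set" where
  "marks_left d L xs = {n. n < L \<and> L - 1 - n \<in> marks d 0 xs}"

lemma marks_rev_left:
  assumes "\<And>i. N \<le> i \<Longrightarrow> odd i = d \<Longrightarrow> length bs < i" "u + partial_sum bs (N - 1) = L" "N = 0 \<or> (odd (N - 1) = (d = e))"
  shows "marks e u (map (seq_term bs) (rev [Suc 0..<N])) = marks_left d L bs"
proof -
  have mm: "marks d v (map (seq_term bs) [Suc 0..<N]) = marks d v bs" for v
    by (rule marks_map) (rule assms(1))
  have s: "n < partial_sum bs (N - 1)" if "n \<in> marks d 0 bs" for n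
    using that marks_subset[of d 0 "map (seq_term bs) [Suc 0..<N]"] unfolding mm sum_list_map_seq by auto
  have e: "(if odd (length (map (seq_term bs) [Suc 0..<N])) then e else \<not> e) = d" if "N \<noteq> 0"
    using assms(3) that by auto
  show ?thesis
  proof (cases "N = 0")
    case True
    then have "marks d 0 bs = {}" using s by auto
    then show ?thesis using True by (simp add: marks_left_def)
  next
    case False
    have "marks e u (map (seq_term bs) (rev [Suc 0..<N])) = marks e u (rev (map (seq_term bs) [Suc 0..<N]))"
      by (simp add: rev_map)
    also have "\<dots> = {n. u \<le> n \<and> n < L \<and> L - 1 - n \<in> marks d 0 bs}"
      unfolding marks_rev e[OF False] sum_list_map_seq mm assms(2) ..
    also have "\<dots> = marks_left d L bs"
      using s assms(2) by (fastforce simp: marks_left_def)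
    finally show ?thesis .
  qed
qed

lemma marks_left_eq:
  assumes "sum_list xs \<le> L"
  shows "marks_left d L xs = (\<Union>j\<in>{j. 1 \<le> j \<and> odd j = d}. {L - partial_sum xs j..<L - partial_sum xs (j - 1)})"
proof -
  have le: "partial_sum xs j \<le> L" for j using partial_sum_le[of xs j] assms by simp
  have "n < L \<and> L - 1 - n \<in> {0 + partial_sum xs (j - 1)..<0 + partial_sum xs j} \<longleftrightarrow>
      n \<in> {L - partial_sum xs j..<L - partial_sum xs (j - 1)}" for n j
    using le[of j] le[of "j - 1"] by auto
  then show ?thesis unfolding marks_left_def marks_eq by blast
qed

lemma card_marks_left:
  assumes "sum_list xs \<le> L"
  shows "card (marks_left d L xs) = (if d then odd_sum xs else even_sum xs)"
proof -
  have sub: "n < L" if "n \<in> marks d 0 xs" for n using that marks_subset[of d 0 xs] assms by auto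
  have "bij_betw (\<lambda>n. L - 1 - n) (marks d 0 xs) (marks_left d L xs)"
    by (rule bij_betw_byWitness[of _ "\<lambda>n. L - 1 - n"]) (use sub in \<open>force simp: marks_left_def\<close>)+
  then have "card (marks_left d L xs) = card (marks d 0 xs)" by (simp add: bij_betw_same_card)
  then show ?thesis by (simp add: card_marks)
qed

lemma marks_left_Un:
  assumes "sum_list xs \<le> L"
  shows "marks_left True L xs \<union> marks_left False L xs = {L - sum_list xs..<L}"
proof -
  have "n < L \<and> L - 1 - n \<in> {0..<0 + sum_list xs} \<longleftrightarrow> n \<in> {L - sum_list xs..<L}" for n using assms by auto
  then have "{L - sum_list xs..<L} = {n. n < L \<and> L - 1 - n \<in> marks True 0 xs \<union> marks (\<not> True) 0 xs}"
    unfolding marks_Un by blast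
  then show ?thesis unfolding marks_left_def by auto
qed

lemma marks_left_disjoint: "marks_left True L xs \<inter> marks_left False L xs = {}"
  using marks_disjoint[of True 0 xs] by (auto simp: marks_left_def)

section \<open>The sequences t+ and t-\<close>

lemma t_plus_simp:
  "t_plus x y as bs = (let \<mu> = 2 * ((num_terms as + 1) div 2); \<nu> = 2 * ((num_terms bs + 1) div 2)
      in [0, seq_term as 1 - 1] @ map (seq_term as) [2..<\<mu>]
         @ [seq_term as \<mu> + x + y + seq_term bs \<nu>] @ map (seq_term bs) (rev [Suc 0..<\<nu>]))"
proof -
  have "nat \<lfloor>(real n + 1) / 2\<rfloor> = (n + 1) div 2" for n :: nat
    using floor_divide_of_nat_eq[of "n + 1" 2, where ?'a = real] by (simp add: add.commute)
  then show ?thesis by (simp add: t_plus_def)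
qed

lemma t_minus_simp:
  "t_minus x y z as bs = (let \<mu>' = 2 * (num_terms as div 2); \<nu>' = 2 * (num_terms bs div 2)
      in map (seq_term as) [Suc 0..<\<mu>' + 1] @ [seq_term as (\<mu>' + 1) + x + y + seq_term bs (\<nu>' + 1)]
         @ map (seq_term bs) (rev [Suc 0..<\<nu>' + 1]) @ [z])"
proof -
  have "nat \<lceil>(real n - 1) / 2\<rceil> = n div 2" if "1 \<le> n" for n :: nat
  proof (cases "even n")
    case True
    then obtain k where k: "n = 2 * k" by (elim evenE)
    then have "\<lceil>(real n - 1) / 2\<rceil> = int k" by (intro ceiling_unique) auto
    then show ?thesis by (simp add: k)
  next
    case False
    then obtain k where k: "n = 2 * k + 1" by (elim oddE)
    then show ?thesis by simp
  qed
  moreover have "1 \<le> num_terms xs" for xs by (simp add: num_terms_def Suc_le_eq)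
  ultimately show ?thesis by (simp add: t_minus_def)
qed

text \<open>The leading 0 makes the odd-numbered terms of \<open>as\<close> even-numbered in t+, and
  starting at 1 with a_1 - 1 instead of a_1 drops position 0. The merged middle term is a gap,
  composed of the last gap of each sequence (possibly 0) and the central gap x + y.\<close>

lemma marks_t_plus:
  assumes a1: "1 \<le> seq_term as 1" and L: "L = sum_list as + x + y + sum_list bs"
  shows "marks False 1 (t_plus x y as bs) = (marks True 0 as - {0}) \<union> marks_left True L bs"
    and "sum_list (t_plus x y as bs) = L - 1"
proof -
  define \<mu> \<nu> where "\<mu> = 2 * ((num_terms as + 1) div 2)" and "\<nu> = 2 * ((num_terms bs + 1) div 2)"
  have len: "length as \<le> \<mu>" "2 \<le> \<mu>" "length bs \<le> \<nu>" "2 \<le> \<nu>" "even \<mu>" "even \<nu>"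
    by (auto simp: \<mu>_def \<nu>_def num_terms_def Suc_le_eq)
  let ?M = "map (seq_term as) [2..<\<mu>]" and ?R = "map (seq_term bs) (rev [Suc 0..<\<nu>])"
  let ?g = "seq_term as \<mu> + x + y + seq_term bs \<nu>"
  have t: "t_plus x y as bs = 0 # (seq_term as 1 - 1) # ?M @ ?g # ?R"
    by (simp add: t_plus_simp \<mu>_def \<nu>_def Let_def)
  have M1: "map (seq_term as) [Suc 0..<\<mu>] = seq_term as 1 # ?M"
    using len by (simp add: upt_conv_Cons numeral_2_eq_2)
  have sM: "seq_term as 1 + sum_list ?M = partial_sum as (\<mu> - 1)"
    using sum_list_map_seq[of as \<mu>] unfolding M1 by simp
  have a: "partial_sum as (\<mu> - 1) + seq_term as \<mu> = sum_list as"
    using partial_sum_pred[of \<mu> as] partial_sum_all[of as \<mu>] len by simp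
  have b: "partial_sum bs (\<nu> - 1) + seq_term bs \<nu> = sum_list bs"
    using partial_sum_pred[of \<nu> bs] partial_sum_all[of bs \<nu>] len by simp
  have M2: "marks True 0 as = {0..<seq_term as 1} \<union> marks False (seq_term as 1) ?M"
  proof -
    have "marks True 0 as = marks True 0 (map (seq_term as) [Suc 0..<\<mu>])"
    proof (rule marks_map[symmetric])
      show "length as < i" if "\<mu> \<le> i" "odd i = True" for i
        using that len by (cases "i = \<mu>") auto
    qed
    then show ?thesis unfolding M1 by simp
  qed
  have R: "marks True (seq_term as 1 + sum_list ?M + ?g) ?R = marks_left True L bs"
  proof (rule marks_rev_left)
    show "length bs < i" if "\<nu> \<le> i" "odd i = True" for i using that len by (cases "i = \<nu>") auto
    show "seq_term as 1 + sum_list ?M + ?g + partial_sum bs (\<nu> - 1) = L"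
      using sM a b by (simp add: L)
  qed (use len in auto)
  have "marks False 1 (t_plus x y as bs) = {1..<seq_term as 1} \<union> marks False (seq_term as 1) ?M \<union> marks_left True L bs"
  proof -
    have "marks False 1 (t_plus x y as bs) = {1..<seq_term as 1} \<union> marks False (seq_term as 1) (?M @ ?g # ?R)"
      unfolding t using a1 by simp
    also have "marks False (seq_term as 1) (?M @ ?g # ?R) =
        marks False (seq_term as 1) ?M \<union> marks True (seq_term as 1 + sum_list ?M + ?g) ?R"
      using len by (simp only: marks_append) simp
    finally show ?thesis unfolding R by blast
  qed
  also have "{1..<seq_term as 1} \<union> marks False (seq_term as 1) ?M = marks True 0 as - {0}"
    unfolding M2 using marks_subset[of False "seq_term as 1" ?M] a1 by force
  finally show "marks False 1 (t_plus x y as bs) = (marks True 0 as - {0}) \<union> marks_left True L bs" .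
  have "sum_list ?R = partial_sum bs (\<nu> - 1)"
    using sum_list_map_seq[of bs \<nu>] by (simp add: rev_map[symmetric])
  then show "sum_list (t_plus x y as bs) = L - 1"
    unfolding t using sM a b a1 by (simp add: L)
qed

text \<open>The parities of \<open>as\<close> are kept here. The merged middle term is odd-numbered,
  hence a gap, and the final z is even-numbered, hence a dent to the right of L.\<close>

lemma marks_t_minus:
  assumes L: "L = sum_list as + x + y + sum_list bs"
  shows "marks False 0 (t_minus x y z as bs) = marks False 0 as \<union> marks_left False L bs \<union> {L..<L + z}"
    and "sum_list (t_minus x y z as bs) = L + z"
proof -
  define \<mu> \<nu> where "\<mu> = 2 * (num_terms as div 2)" and "\<nu> = 2 * (num_terms bs div 2)"
  have len: "length as \<le> \<mu> + 1" "length bs \<le> \<nu> + 1" "even \<mu>" "even \<nu>"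
    by (auto simp: \<mu>_def \<nu>_def num_terms_def)
  let ?M = "map (seq_term as) [Suc 0..<\<mu> + 1]" and ?R = "map (seq_term bs) (rev [Suc 0..<\<nu> + 1])"
  let ?g = "seq_term as (\<mu> + 1) + x + y + seq_term bs (\<nu> + 1)"
  have t: "t_minus x y z as bs = ?M @ ?g # ?R @ [z]"
    by (simp add: t_minus_simp \<mu>_def \<nu>_def Let_def del: upt_Suc)
  have sM: "sum_list ?M = partial_sum as \<mu>"
    using sum_list_map_seq[of as "\<mu> + 1"] by simp
  have sR: "sum_list ?R = partial_sum bs \<nu>"
    using sum_list_map_seq[of bs "\<nu> + 1"] by (simp add: rev_map[symmetric])
  have a: "partial_sum as \<mu> + seq_term as (\<mu> + 1) = sum_list as"
    using partial_sum_pred[of "\<mu> + 1" as] partial_sum_all[of as "\<mu> + 1"] len by simp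
  have b: "partial_sum bs \<nu> + seq_term bs (\<nu> + 1) = sum_list bs"
    using partial_sum_pred[of "\<nu> + 1" bs] partial_sum_all[of bs "\<nu> + 1"] len by simp
  have M: "marks False 0 ?M = marks False 0 as"
  proof (rule marks_map)
    show "length as < i" if "\<mu> + 1 \<le> i" "odd i = False" for i
      using that len by (cases "i = \<mu> + 1") auto
  qed
  have R: "marks True (sum_list ?M + ?g) ?R = marks_left False L bs"
  proof (rule marks_rev_left)
    show "length bs < i" if "\<nu> + 1 \<le> i" "odd i = False" for i
      using that len by (cases "i = \<nu> + 1") auto
    show "sum_list ?M + ?g + partial_sum bs (\<nu> + 1 - 1) = L"
      using sM a b by (simp add: L)
  qed (use len in auto)
  have sum: "sum_list ?M + ?g + sum_list ?R = L" unfolding sM sR using a b by (simp add: L)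
  have even: "even (length ?M)" "even (length ?R)" using len by (simp_all del: upt_Suc)
  define m r g where "m = ?M" and "r = ?R" and "g = ?g"
  note mrg = t sum even M R
  note mrg = mrg[folded m_def r_def, folded g_def]
  have "marks False 0 (m @ g # r @ [z]) = marks False 0 m \<union> marks False (0 + sum_list m) (g # r @ [z])"
    using mrg(3) by (simp only: marks_append if_True)
  also have "marks False (0 + sum_list m) (g # r @ [z]) = marks True (sum_list m + g) (r @ [z])"
    by simp
  also have "\<dots> = marks True (sum_list m + g) r \<union> marks True (sum_list m + g + sum_list r) [z]"
    using mrg(4) by (simp only: marks_append if_True)
  finally show "marks False 0 (t_minus x y z as bs) = marks False 0 as \<union> marks_left False L bs \<union> {L..<L + z}"
    unfolding mrg by auto
  show "sum_list (t_minus x y z as bs) = L + z"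
    unfolding mrg(1) using mrg(2) by simp
qed

section \<open>Encoding the unit triangles\<close>

text \<open>A down-pointing triangle is named after the height of its horizontal side, which is its
  upper side; hence \<open>k + 1\<close>.\<close>

definition face_of :: "int \<times> int \<Rightarrow> face" where
  "face_of p = (case p of (k, c) \<Rightarrow>
     if even (c - k) then up_face ((c - k) div 2) k else down_face ((c - k) div 2) (k + 1))"

lemma face_of_up: "face_of (k, 2 * i + k) = up_face i k"
  by (simp add: face_of_def)

lemma face_of_down: "face_of (k, 2 * i + k + 1) = down_face i (k + 1)"
  by (simp add: face_of_def)

lemma code_cases:
  fixes k c :: int
  obtains i where "c = 2 * i + k" | i where "c = 2 * i + k + 1"
proof (cases "even (c - k)")
  case True
  then obtain i where "c - k = 2 * i" by (elim evenE)
  then show ?thesis by (intro that(1)[of i]) simp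
next
  case False
  then obtain i where "c - k = 2 * i + 1" by (elim oddE)
  then show ?thesis by (intro that(2)[of i]) simp
qed

lemma range_face_of: "range face_of = Collect is_face"
proof (intro equalityI subsetI)
  fix t assume "t \<in> range face_of"
  then obtain k c where "t = face_of (k, c)" by auto
  then show "t \<in> Collect is_face"
    by (cases rule: code_cases[of c k]) (auto simp: face_of_up face_of_down is_face_def)
next
  fix t assume "t \<in> Collect is_face"
  then obtain i k where "t = up_face i k \<or> t = down_face i k" by (auto simp: is_face_def)
  then show "t \<in> range face_of"
    using face_of_up[of k i] face_of_down[of "k - 1" i] by (metis diff_add_cancel rangeI)
qed

lemma card_up_face_Int:
  "card (up_face i k \<inter> X) = of_bool ((i, k) \<in> X) + of_bool ((i + 1, k) \<in> X) + of_bool ((i, k + 1) \<in> X)"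
  by (simp add: up_face_def Int_insert_left)

lemma card_down_face_Int:
  "card (down_face i k \<inter> X) = of_bool ((i, k) \<in> X) + of_bool ((i + 1, k) \<in> X) + of_bool ((i + 1, k - 1) \<in> X)"
  by (simp add: down_face_def Int_insert_left)

lemma card_up_up: "card (up_face i k \<inter> up_face j l) \<noteq> 2"
  unfolding card_up_face_Int by (auto simp: up_face_def of_bool_def)

lemma card_down_down: "card (down_face i k \<inter> down_face j l) \<noteq> 2"
  unfolding card_down_face_Int by (auto simp: down_face_def of_bool_def)

lemma card_up_down:
  "card (up_face i k \<inter> down_face j l) = 2 \<longleftrightarrow> l = k \<and> j = i \<or> l = k + 1 \<and> (j = i \<or> j = i - 1)"
  unfolding card_up_face_Int by (auto simp: down_face_def of_bool_def)

lemma inj_face_of: "inj face_of"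
proof (rule injI)
  fix p q assume eq: "face_of p = face_of q"
  obtain k c l d where pq: "p = (k, c)" "q = (l, d)" by (cases p, cases q)
  have uu: "i = j \<and> k = l" if "up_face i k = up_face j l" for i j k l
  proof -
    have "(i, k) \<in> up_face j l" "(i + 1, k) \<in> up_face j l" "(i, k + 1) \<in> up_face j l"
      unfolding that[symmetric] by (auto simp: up_face_def)
    then show ?thesis by (auto simp: up_face_def)
  qed
  have dd: "i = j \<and> k = l" if "down_face i k = down_face j l" for i j k l
  proof -
    have "(i, k) \<in> down_face j l" "(i + 1, k) \<in> down_face j l" "(i + 1, k - 1) \<in> down_face j l"
      unfolding that[symmetric] by (auto simp: down_face_def)
    then show ?thesis by (auto simp: down_face_def)
  qed
  have ud: "up_face i k \<noteq> down_face j l" for i j k l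
  proof
    assume e: "up_face i k = down_face j l"
    have "(i, k) \<in> down_face j l" "(i + 1, k) \<in> down_face j l" "(i, k + 1) \<in> down_face j l"
      unfolding e[symmetric] by (auto simp: up_face_def)
    then show False by (auto simp: down_face_def)
  qed
  show "p = q"
    using eq unfolding pq
    by (cases rule: code_cases[of c k]; cases rule: code_cases[of d l])
      (auto simp: face_of_up face_of_down ud ud[symmetric] dest!: uu dd)
qed

text \<open>An edge always separates an up-pointing from a down-pointing triangle. The up-pointing
  one at \<open>(k, c)\<close> has the neighbours \<open>(k, c - 1)\<close>,
  \<open>(k, c + 1)\<close> and, across its base, \<open>(k - 1, c)\<close>; triangles of equal
  orientation share at most a vertex unless they coincide.\<close>

lemma brick_iff_adjacent: "{p, q} \<in> bricks \<longleftrightarrow> card (face_of p \<inter> face_of q) = 2"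
proof -
  obtain k c l d where pq: "p = (k, c)" "q = (l, d)" by (cases p, cases q)
  have up_down: "{(k, 2 * i + k), (l, 2 * j + l + 1)} \<in> bricks \<longleftrightarrow> card (up_face i k \<inter> down_face j (l + 1)) = 2" for i j k l
  proof -
    have "{(k, 2 * i + k), (l, 2 * j + l + 1)} \<in> bricks \<longleftrightarrow>
        l = k \<and> (2 * j + l + 1 = 2 * i + k + 1 \<or> 2 * j + l + 1 = 2 * i + k - 1) \<or> l = k - 1 \<and> 2 * j + l + 1 = 2 * i + k"
    proof
      assume b: "{(k, 2 * i + k), (l, 2 * j + l + 1)} \<in> bricks"
      show "l = k \<and> (2 * j + l + 1 = 2 * i + k + 1 \<or> 2 * j + l + 1 = 2 * i + k - 1) \<or> l = k - 1 \<and> 2 * j + l + 1 = 2 * i + k"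
        by (rule brick_cases[OF b, of k "2 * i + k"]) (auto simp: doubleton_eq_iff)
    next
      assume "l = k \<and> (2 * j + l + 1 = 2 * i + k + 1 \<or> 2 * j + l + 1 = 2 * i + k - 1) \<or> l = k - 1 \<and> 2 * j + l + 1 = 2 * i + k"
      then show "{(k, 2 * i + k), (l, 2 * j + l + 1)} \<in> bricks"
        using horizontal_brick[of k "2 * i + k"] horizontal_brick[of k "2 * j + k + 1"] vertical_brick[of "2 * i + k" "k - 1"]
        by (auto simp: insert_commute)
    qed
    then show ?thesis unfolding card_up_down by auto
  qed
  have same: "{(k, c), (l, d)} \<notin> bricks" if "even (c - k) = even (d - l)" for k c l d
  proof
    assume b: "{(k, c), (l, d)} \<in> bricks"
    show False
      by (rule brick_cases[OF b, of k c]) (use that in \<open>auto simp: doubleton_eq_iff\<close>)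
  qed
  show ?thesis
    unfolding pq
  proof (cases rule: code_cases[of c k]; cases rule: code_cases[of d l])
    fix i j assume c: "c = 2 * i + k" "d = 2 * j + l"
    show "{(k, c), (l, d)} \<in> bricks \<longleftrightarrow> card (face_of (k, c) \<inter> face_of (l, d)) = 2"
      unfolding c using same[of "2 * i + k" k "2 * j + l" l] by (simp add: face_of_up card_up_up)
  next
    fix i j assume c: "c = 2 * i + k" "d = 2 * j + l + 1"
    show "{(k, c), (l, d)} \<in> bricks \<longleftrightarrow> card (face_of (k, c) \<inter> face_of (l, d)) = 2"
      unfolding c face_of_up face_of_down by (rule up_down)
  next
    fix i j assume c: "c = 2 * i + k + 1" "d = 2 * j + l"
    show "{(k, c), (l, d)} \<in> bricks \<longleftrightarrow> card (face_of (k, c) \<inter> face_of (l, d)) = 2"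
      unfolding c face_of_up face_of_down using up_down[of l j k i] by (simp only: insert_commute Int_commute)
  next
    fix i j assume c: "c = 2 * i + k + 1" "d = 2 * j + l + 1"
    show "{(k, c), (l, d)} \<in> bricks \<longleftrightarrow> card (face_of (k, c) \<inter> face_of (l, d)) = 2"
      unfolding c using same[of "2 * i + k + 1" k "2 * j + l + 1" l] by (simp add: face_of_down card_down_down)
  qed
qed

lemma is_lozenge_face_of: "is_lozenge (face_of ` l) \<longleftrightarrow> l \<in> bricks"
proof
  assume "is_lozenge (face_of ` l)"
  then obtain s t where st: "is_face s" "is_face t" "card (s \<inter> t) = 2" "face_of ` l = {s, t}"
    by (auto simp: is_lozenge_def)
  obtain p q where pq: "s = face_of p" "t = face_of q"
  proof -
    have "s \<in> range face_of" "t \<in> range face_of" using st(1,2) by (simp_all only: range_face_of mem_Collect_eq)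
    then show ?thesis using that by blast
  qed
  have "face_of ` l = face_of ` {p, q}" using st(4) pq by simp
  then have "l = {p, q}" using inj_face_of by (simp only: inj_image_eq_iff)
  then show "l \<in> bricks" using brick_iff_adjacent st(3) pq by simp
next
  assume l: "l \<in> bricks"
  then obtain p q where pq: "l = {p, q}" unfolding bricks_def by blast
  then have "card (face_of p \<inter> face_of q) = 2" using l brick_iff_adjacent by simp
  moreover have "is_face (face_of p)" for p
    using rangeI[of face_of p] unfolding range_face_of by simp
  ultimately show "is_lozenge (face_of ` l)"
    unfolding is_lozenge_def pq by (intro exI[of _ "face_of p"] exI[of _ "face_of q"]) simp
qed

lemma weighted_count_face_of:
  assumes "\<And>l. l \<in> bricks \<Longrightarrow> l \<subseteq> R \<Longrightarrow> w (face_of ` l) = brick_weight l"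
  shows "weighted_count w (face_of ` R) = domino_sum R"
proof -
  have "weighted_count w (face_of ` R) = matching_sum {l. is_lozenge l} w (face_of ` R)"
    unfolding weighted_count_def tilings_def matching_sum_def
    by (intro sum.cong) auto
  also have "\<dots> = domino_sum R"
    by (rule matching_sum_image) (use assms inj_on_subset[OF inj_face_of] is_lozenge_face_of in auto)
  finally show ?thesis .
qed

section \<open>Weights and boundaries in doubled coordinates\<close>

lemma zigzag_iff:
  assumes "height q = height p + 1"
  shows "{p, q} \<in> zigzag c k0 k1 \<longleftrightarrow>
    k0 \<le> height p \<and> height q \<le> k1 \<and> abscissa p = c (height p) \<and> abscissa q = c (height q)"
  using assms unfolding zigzag_def by (cases p; cases q) (auto simp: doubleton_eq_iff)

text \<open>A vertical lozenge in column 0 has its western sides in the two rows that it occupies.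
  The hypothesis on rows guarantees that both lie within the range of heights of the zigzag.\<close>

lemma half_weight_eq_brick_weight:
  assumes l: "l \<in> bricks" and R: "\<And>k. (k, 0) \<in> l \<Longrightarrow> k0 \<le> k \<and> k < k1"
  shows "half_weight (zigzag K_west k0 k1) (face_of ` l) = brick_weight l"
proof -
  \<comment> \<open>At odd heights the zigzag is at 1/2 and its neighbouring points are at 0, to the
    left, so no lozenge can have its western corner there.\<close>
  have west: "abscissa (i, k) = K_west k \<and> abscissa (i, k + 1) = K_west (k + 1) \<and> abscissa (i + 1, k - 1) = K_west (k - 1)
      \<longleftrightarrow> 2 * i + k = 0" for i k
  proof (cases "even k")
    case True
    then obtain j where j: "k = 2 * j" by (elim evenE)
    have "abscissa (i, k) = real_of_int (i + j)" "abscissa (i, k + 1) = real_of_int (i + j) + 1 / 2"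
      "abscissa (i + 1, k - 1) = real_of_int (i + j) + 1 / 2"
      by (simp_all add: j abscissa_def field_simps)
    moreover have "real_of_int (i + j) = 0 \<longleftrightarrow> 2 * i + k = 0" unfolding j by (simp only: of_int_eq_0_iff) presburger
    ultimately show ?thesis using True by (auto simp: K_west_def)
  next
    case False
    then obtain j where j: "k = 2 * j + 1" by (elim oddE)
    have "abscissa (i, k) = real_of_int (i + j) + 1 / 2" "abscissa (i, k + 1) = real_of_int (i + j) + 1"
      by (simp_all add: j abscissa_def field_simps)
    moreover have "2 * i + k \<noteq> 0" unfolding j by presburger
    ultimately show ?thesis using False by (auto simp: K_west_def)
  qed
  have eq: "face_of ` l = {up_face i k, down_face i k} \<longleftrightarrow> l = {(k, 2 * i + k), (k - 1, 2 * i + k)}" for i k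
  proof -
    have "{up_face i k, down_face i k} = face_of ` {(k, 2 * i + k), (k - 1, 2 * i + k)}"
      using face_of_up[of k i] face_of_down[of "k - 1" i] by simp
    then show ?thesis using inj_face_of by (simp only: inj_image_eq_iff)
  qed
  have iff: "(\<exists>i k. face_of ` l = {up_face i k, down_face i k} \<and>
      {(i, k), (i, k + 1)} \<in> zigzag K_west k0 k1 \<and> {(i, k), (i + 1, k - 1)} \<in> zigzag K_west k0 k1) \<longleftrightarrow>
      (\<exists>k. l = {(k, 0), (k - 1, 0)})"
  proof
    assume "\<exists>i k. face_of ` l = {up_face i k, down_face i k} \<and>
      {(i, k), (i, k + 1)} \<in> zigzag K_west k0 k1 \<and> {(i, k), (i + 1, k - 1)} \<in> zigzag K_west k0 k1"
    then obtain i k where ik: "l = {(k, 2 * i + k), (k - 1, 2 * i + k)}"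
      "{(i, k), (i, k + 1)} \<in> zigzag K_west k0 k1" "{(i + 1, k - 1), (i, k)} \<in> zigzag K_west k0 k1"
      unfolding eq by (auto simp: insert_commute)
    have "2 * i + k = 0" using ik(2,3) west[of i k] by (simp add: zigzag_iff)
    then show "\<exists>k. l = {(k, 0), (k - 1, 0)}" using ik(1) by auto
  next
    assume "\<exists>k. l = {(k, 0), (k - 1, 0)}"
    then obtain k where k: "l = {(k, 0), (k - 1, 0)}" by auto
    have "even k"
      by (rule brick_cases[OF l, of k 0]) (use k in \<open>auto simp: doubleton_eq_iff\<close>)
    then obtain j where j: "k = 2 * j" by (elim evenE)
    define i where "i = - j"
    have i: "2 * i + k = 0" by (simp add: i_def j)
    have b: "k0 \<le> k - 1" "k < k1" using R[of k] R[of "k - 1"] k by auto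
    have "{(i, k), (i, k + 1)} \<in> zigzag K_west k0 k1" "{(i + 1, k - 1), (i, k)} \<in> zigzag K_west k0 k1"
      using west[of i k] i b by (simp_all add: zigzag_iff)
    then show "\<exists>i k. face_of ` l = {up_face i k, down_face i k} \<and>
      {(i, k), (i, k + 1)} \<in> zigzag K_west k0 k1 \<and> {(i, k), (i + 1, k - 1)} \<in> zigzag K_west k0 k1"
      unfolding eq using k i by (intro exI[of _ i] exI[of _ k]) (auto simp: insert_commute)
  qed
  show ?thesis unfolding half_weight_def brick_weight_def by (simp only: iff)
qed

text \<open>At integral heights all borders have half-integral abscissae. Doubling turns membership
  into linear integer arithmetic with parities.\<close>

lemma face_of_mem_faces_between:
  assumes lo: "\<And>k. lo k = real_of_int (lo' k) / 2" and hi: "\<And>k. hi k = real_of_int (hi' k) / 2"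
  shows "face_of (k, c) \<in> faces_between lo hi k0 k1 \<longleftrightarrow> k0 \<le> k \<and> k < k1 \<and>
    (if even (c - k) then lo' k \<le> c \<and> c + 2 \<le> hi' k \<and> lo' (k + 1) \<le> c + 1 \<and> c + 1 \<le> hi' (k + 1)
     else lo' (k + 1) \<le> c \<and> c + 2 \<le> hi' (k + 1) \<and> lo' k \<le> c + 1 \<and> c + 1 \<le> hi' k)"
proof -
  have h: "real_of_int p / 2 \<le> real_of_int q / 2 \<longleftrightarrow> p \<le> q" for p q by simp
  have face: "is_face (face_of p)" for p
    using rangeI[of face_of p] unfolding range_face_of by simp
  have abs: "abscissa (i, k) = real_of_int (2 * i + k) / 2" for i k by (simp add: abscissa_def field_simps)
  show ?thesis
  proof (cases rule: code_cases[of c k])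
    case (1 i)
    have "face_of (k, c) \<in> faces_between lo hi k0 k1 \<longleftrightarrow>
        (\<forall>p\<in>up_face i k. k0 \<le> height p \<and> height p \<le> k1 \<and> lo (height p) \<le> abscissa p \<and> abscissa p \<le> hi (height p))"
      using face[of "(k, c)"] unfolding 1 face_of_up by (simp add: faces_between_def)
    also have "\<dots> \<longleftrightarrow> k0 \<le> k \<and> k < k1 \<and> lo' k \<le> c \<and> c + 2 \<le> hi' k \<and> lo' (k + 1) \<le> c + 1 \<and> c + 1 \<le> hi' (k + 1)"
      unfolding up_face_def lo hi ball_simps abs fst_conv snd_conv h 1 by auto
    finally show ?thesis using 1 by simp
  next
    case (2 i)
    have "face_of (k, c) \<in> faces_between lo hi k0 k1 \<longleftrightarrow>
        (\<forall>p\<in>down_face i (k + 1). k0 \<le> height p \<and> height p \<le> k1 \<and> lo (height p) \<le> abscissa p \<and> abscissa p \<le> hi (height p))"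
      using face[of "(k, c)"] unfolding 2 face_of_down by (simp add: faces_between_def)
    also have "\<dots> \<longleftrightarrow> k0 \<le> k \<and> k < k1 \<and> lo' (k + 1) \<le> c \<and> c + 2 \<le> hi' (k + 1) \<and> lo' k \<le> c + 1 \<and> c + 1 \<le> hi' k"
      unfolding down_face_def lo hi ball_simps abs fst_conv snd_conv h 2 by auto
    finally show ?thesis using 2 by simp
  qed
qed

lemma face_of_up_triangle: "face_of (k, c) \<in> up_triangle u s \<longleftrightarrow> (k, c) \<in> triangle 0 (2 * int u) s"
proof -
  have "face_of (k, c) \<in> up_triangle u s \<longleftrightarrow> 0 \<le> k \<and> k < int s \<and>
     (if even (c - k) then 2 * int u + k \<le> c \<and> c + 2 \<le> 2 * int u + 2 * int s - k \<and>
        2 * int u + (k + 1) \<le> c + 1 \<and> c + 1 \<le> 2 * int u + 2 * int s - (k + 1)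
      else 2 * int u + (k + 1) \<le> c \<and> c + 2 \<le> 2 * int u + 2 * int s - (k + 1) \<and>
        2 * int u + k \<le> c + 1 \<and> c + 1 \<le> 2 * int u + 2 * int s - k)"
    unfolding up_triangle_def by (rule face_of_mem_faces_between) (simp_all add: field_simps)
  also have "\<dots> \<longleftrightarrow> (k, c) \<in> triangle 0 (2 * int u) s"
    unfolding triangle_def mem_Collect_eq prod.case by presburger
  finally show ?thesis .
qed

lemma face_of_down_triangle: "face_of (k, c) \<in> down_triangle u s \<longleftrightarrow> (- 1 - k, c) \<in> triangle 0 (2 * int u) s"
proof -
  have "face_of (k, c) \<in> down_triangle u s \<longleftrightarrow> - int s \<le> k \<and> k < 0 \<and>
     (if even (c - k) then 2 * int u - k \<le> c \<and> c + 2 \<le> 2 * int u + 2 * int s + k \<and>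
        2 * int u - (k + 1) \<le> c + 1 \<and> c + 1 \<le> 2 * int u + 2 * int s + (k + 1)
      else 2 * int u - (k + 1) \<le> c \<and> c + 2 \<le> 2 * int u + 2 * int s + (k + 1) \<and>
        2 * int u - k \<le> c + 1 \<and> c + 1 \<le> 2 * int u + 2 * int s + k)"
    unfolding down_triangle_def by (rule face_of_mem_faces_between) (simp_all add: field_simps)
  also have "\<dots> \<longleftrightarrow> (- 1 - k, c) \<in> triangle 0 (2 * int u) s"
    unfolding triangle_def mem_Collect_eq prod.case by presburger
  finally show ?thesis .
qed

lemma region_eq_image:
  assumes "X \<subseteq> Collect is_face"
  shows "X = face_of ` {p. face_of p \<in> X}"
  using assms unfolding range_face_of[symmetric] by auto

section \<open>The quartered hexagons\<close>

abbreviation dbl :: "nat \<Rightarrow> int" where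
  "dbl n \<equiv> 2 * int n"

lemma run_dbl: "run (dbl p) s = dbl ` {p..<p + s}"
proof (induction s)
  case (Suc s)
  have "dbl p + dbl s = dbl (p + s)" by simp
  then show ?case using Suc by (simp only: run_Suc_right add_Suc_right atLeastLessThanSuc) simp
qed simp

text \<open>The offset \<open>u\<close> is 1 for Q, which is shifted by one unit to become a
  trapezoid with wall at column 1, and 0 for K'.\<close>

definition seq_dents :: "nat \<Rightarrow> nat list \<Rightarrow> (int \<times> nat) set" where
  "seq_dents u t = (\<lambda>i. (dbl (u + partial_sum t (2 * i - 1)), seq_term t (2 * i))) ` {1..length t div 2}"

lemma dent_codes_image:
  "dent_codes ((\<lambda>i. (dbl (f i), g i)) ` I) = dbl ` (\<Union>i\<in>I. {f i..<f i + g i})"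
  unfolding dent_codes_def by (auto simp: run_dbl)

lemma dent_codes_seq_dents: "dent_codes (seq_dents u t) = dbl ` marks False u t"
proof -
  have "(\<Union>i\<in>{1..length t div 2}. {u + partial_sum t (2 * i - 1)..<u + partial_sum t (2 * i - 1) + seq_term t (2 * i)}) =
      marks False u t"
    unfolding marks_eq
  proof (intro equalityI subsetI)
    fix n assume "n \<in> (\<Union>i\<in>{1..length t div 2}. {u + partial_sum t (2 * i - 1)..<u + partial_sum t (2 * i - 1) + seq_term t (2 * i)})"
    then obtain i where i: "1 \<le> i" "n \<in> {u + partial_sum t (2 * i - 1)..<u + partial_sum t (2 * i - 1) + seq_term t (2 * i)}" by auto
    then have "n \<in> {u + partial_sum t (2 * i - 1)..<u + partial_sum t (2 * i)}"
      using partial_sum_pred[of "2 * i" t] by simp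
    then show "n \<in> (\<Union>i\<in>{i. 1 \<le> i \<and> odd i = False}. {u + partial_sum t (i - 1)..<u + partial_sum t i})"
      using i(1) by (intro UN_I[of "2 * i"]) auto
  next
    fix n assume "n \<in> (\<Union>i\<in>{i. 1 \<le> i \<and> odd i = False}. {u + partial_sum t (i - 1)..<u + partial_sum t i})"
    then obtain j where j: "1 \<le> j" "even j" "n \<in> {u + partial_sum t (j - 1)..<u + partial_sum t j}" by auto
    then obtain i where i: "j = 2 * i" by (elim evenE)
    have s: "partial_sum t j = partial_sum t (j - 1) + seq_term t j" by (rule partial_sum_pred[OF j(1)])
    then have "seq_term t j \<noteq> 0" using j(3) by auto
    then have "j \<le> length t" using seq_term_zero[of t j] by force
    then have "i \<in> {1..length t div 2}" using j(1) i by auto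
    then show "n \<in> (\<Union>i\<in>{1..length t div 2}. {u + partial_sum t (2 * i - 1)..<u + partial_sum t (2 * i - 1) + seq_term t (2 * i)})"
      using j(3) s unfolding i by (intro UN_I[of i]) auto
  qed
  then show ?thesis unfolding seq_dents_def dent_codes_image by simp
qed

lemma separated_image:
  assumes "\<And>i j. i \<in> I \<Longrightarrow> j \<in> I \<Longrightarrow> i < j \<Longrightarrow> f i + g i \<le> f j \<or> f j + g j \<le> f i"
  shows "separated ((\<lambda>i::nat. (dbl (f i), g i)) ` I)"
proof -
  have "f i + g i \<le> f j \<or> f j + g j \<le> f i" if "i \<in> I" "j \<in> I" "i \<noteq> j" for i j
    using assms[of i j] assms[of j i] that by (cases i j rule: linorder_cases) auto
  then have "dbl (f i) + dbl (g i) \<le> dbl (f j) \<or> dbl (f j) + dbl (g j) \<le> dbl (f i)" if "i \<in> I" "j \<in> I" "i \<noteq> j" for i j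
    using that by (smt (verit) of_nat_add of_nat_le_iff)
  then show ?thesis unfolding separated_def by fastforce
qed

lemma separated_seq_dents: "separated (seq_dents u t)"
  unfolding seq_dents_def
proof (rule separated_image)
  fix i j assume "i \<in> {1..length t div 2}" "j \<in> {1..length t div 2}" "i < j"
  then have "partial_sum t (2 * i) \<le> partial_sum t (2 * j - 1)" "partial_sum t (2 * i) = partial_sum t (2 * i - 1) + seq_term t (2 * i)"
    using partial_sum_pred[of "2 * i" t] partial_sum_mono[of "2 * i" "2 * j - 1" t] by auto
  then show "u + partial_sum t (2 * i - 1) + seq_term t (2 * i) \<le> u + partial_sum t (2 * j - 1) \<or>
      u + partial_sum t (2 * j - 1) + seq_term t (2 * j) \<le> u + partial_sum t (2 * i - 1)" by simp
qed

lemma seq_dents_D: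
  assumes "(p, s) \<in> seq_dents u t"
  shows "dbl u \<le> p" "p + 2 * int s \<le> dbl (u + sum_list t)" "s \<le> even_sum t" "even p \<and> 0 \<le> p"
proof -
  obtain i where i: "1 \<le> i" "p = dbl (u + partial_sum t (2 * i - 1))" "s = seq_term t (2 * i)"
    using assms by (auto simp: seq_dents_def)
  show "dbl u \<le> p" "even p \<and> 0 \<le> p" using i by auto
  show "s \<le> even_sum t" using seq_term_le_sum[of t "2 * i"] i by simp
  have "partial_sum t (2 * i - 1) + s \<le> sum_list t"
    using partial_sum_pred[of "2 * i" t] partial_sum_le[of t "2 * i"] i by simp
  then show "p + 2 * int s \<le> dbl (u + sum_list t)" using i(2) by simp
qed

lemma finite_seq_dents [simp]: "finite (seq_dents u t)"
  by (simp add: seq_dents_def)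

lemma face_of_dents: "face_of (k, c) \<in> dents t \<longleftrightarrow> (k, c + dbl u) \<in> dent_triangles (seq_dents u t)"
  unfolding dents_def dent_triangles_def seq_dents_def
  by (auto simp: face_of_up_triangle triangle_def)

text \<open>Moved one unit to the right, the zigzag through 0 and -1/2 passes through 1 and 1/2.
  This is the wall \<open>lo = 1\<close> of a trapezoid with an even number of rows; column 0 is
  empty, and the unweighted count agrees with the weighted one.\<close>

lemma Q_count_eq: "real (Q_count t) = ovdm (dbl ` marks False 1 t) / H2_fun (2 * even_sum t + 1)"
proof -
  define e M where "e = even_sum t" and "M = int (sum_list t) + 1"
  let ?T = "trapezoid 1 M 0 (int (2 * e))"
  let ?C = "?T - dent_triangles (seq_dents 1 t)"
  let ?h = "\<lambda>(k :: int, c :: int). (k, c - 2)"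
  have s: "odd_sum t + even_sum t = sum_list t" by (rule odd_even_sum)
  have codes: "face_of (k, c) \<in> Q_region t \<longleftrightarrow> (k, c + 2) \<in> ?C" for k c
  proof -
    have "face_of (k, c) \<in> faces_between (\<lambda>k. if even k then 0 else - 1 / 2)
        (\<lambda>k. odd_sum t + even_sum t - k / 2) 0 (2 * int (even_sum t)) \<longleftrightarrow> 0 \<le> k \<and> k < 2 * int e \<and>
       (if even (c - k) then (if even k then 0 else - 1) \<le> c \<and> c + 2 \<le> 2 * int (sum_list t) - k \<and>
          (if even (k + 1) then 0 else - 1) \<le> c + 1 \<and> c + 1 \<le> 2 * int (sum_list t) - (k + 1)
        else (if even (k + 1) then 0 else - 1) \<le> c \<and> c + 2 \<le> 2 * int (sum_list t) - (k + 1) \<and>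
          (if even k then 0 else - 1) \<le> c + 1 \<and> c + 1 \<le> 2 * int (sum_list t) - k)"
      unfolding e_def s[symmetric] by (rule face_of_mem_faces_between) (simp_all add: field_simps)
    also have "\<dots> \<longleftrightarrow> (k, c + 2) \<in> ?T"
      unfolding trapezoid_def M_def mem_Collect_eq prod.case of_nat_mult of_nat_numeral by presburger
    finally show ?thesis
      unfolding Q_region_def using face_of_dents[of k c t 1] by simp
  qed
  have "Q_region t \<subseteq> Collect is_face" by (auto simp: Q_region_def faces_between_def)
  then have "Q_region t = face_of ` {p. face_of p \<in> Q_region t}" by (rule region_eq_image)
  also have "{p. face_of p \<in> Q_region t} = ?h ` ?C"
    using codes by (force simp: image_iff)
  finally have Q: "Q_region t = (\<lambda>p. face_of (?h p)) ` ?C" by (simp only: image_image)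
  \<comment> \<open>One unit is two columns, so the parity of \<open>c - k\<close>, and with it the
    orientation, is preserved.\<close>
  have shift: "?h ` l \<in> bricks \<longleftrightarrow> l \<in> bricks" for l
  proof -
    have *: "(\<lambda>(k, c). (k, c + d)) ` l \<in> bricks" if l: "l \<in> bricks" "even d" for l and d :: int
    proof -
      from l consider k c where "l = {(k, c), (k, c + 1)}" | k c where "l = {(k, c), (k - 1, c)}" "even (c - k)"
        unfolding bricks_def by blast
      then show ?thesis
      proof cases
        case 1
        then show ?thesis using horizontal_brick[of k "c + d"] by (simp add: ac_simps)
      next
        case 2
        then have "odd (c + d - (k - 1))" using l(2) by presburger
        from vertical_brick[OF this] show ?thesis using 2 by (simp add: insert_commute)
      qed
    qed
    have "?h ` l \<in> bricks" if "l \<in> bricks" using *[OF that, of "- 2"] by simp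
    moreover have "(\<lambda>(k, c). (k, c + 2)) ` ?h ` l = l" by (force simp: image_iff)
    ultimately show ?thesis using *[of "?h ` l" 2] by auto
  qed
  have w1: "brick_weight l = 1" if "l \<subseteq> ?C" for l
    using that unfolding brick_weight_def trapezoid_def by auto
  have "real (Q_count t) = matching_sum {l. is_lozenge l} (\<lambda>_. 1) (Q_region t)"
    unfolding Q_count_def tilings_def matching_sum_def by (simp add: subset_eq)
  also have "\<dots> = domino_sum ?C"
    unfolding Q
  proof (rule matching_sum_image)
    show "inj_on (\<lambda>p. face_of (?h p)) ?C"
    proof (rule inj_onI)
      fix p q assume "face_of (?h p) = face_of (?h q)"
      then have "?h p = ?h q" by (rule injD[OF inj_face_of])
      then show "p = q" by (cases p; cases q) auto
    qed
    show "(\<lambda>p. face_of (?h p)) ` l \<in> {l. is_lozenge l} \<longleftrightarrow> l \<in> bricks" for l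
      using is_lozenge_face_of[of "?h ` l"] shift[of l] by (simp add: image_image)
  qed (use w1 in simp)
  also have "?C = ?C - Pair 0 ` {}" by simp
  also have "domino_sum \<dots> = trapezoid_value (2 * e) (dent_codes (seq_dents 1 t) \<union> {})"
  proof (rule matching_sum_dented_trapezoid)
    show "1 \<le> 2 * M - 1 - int (2 * e)" using s by (simp add: M_def e_def)
    show "dent_triangles (seq_dents 1 t) \<subseteq> ?T"
    proof
      fix x assume "x \<in> dent_triangles (seq_dents 1 t)"
      then obtain p r where pr: "(p, r) \<in> seq_dents 1 t" "x \<in> triangle 0 p r" by (auto simp: dent_triangles_def)
      show "x \<in> ?T"
        using pr(2) seq_dents_D[OF pr(1)] by (auto simp: triangle_def trapezoid_def M_def e_def)
    qed
  qed (use seq_dents_D(4) separated_seq_dents in auto)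
  also have "\<dots> = ovdm (dbl ` marks False 1 t) / H2_fun (2 * even_sum t + 1)"
  proof -
    have "card (dbl ` marks False 1 t) = e"
      by (subst card_image) (auto simp: inj_on_def card_marks e_def)
    then show ?thesis by (simp add: trapezoid_value_def dent_codes_seq_dents e_def)
  qed
  finally show ?thesis .
qed

text \<open>A trapezoid with wall \<open>lo = 0\<close> and \<open>2 * e - 1\<close> rows. The case
  of no dents is separate, because the number of rows would be negative; there the conventional
  value 1 is the empty product.\<close>

lemma K_count_eq: "K_count t = vdm (dbl ` marks False 0 t) / H2_fun (2 * even_sum t)"
proof (cases "even_sum t = 0")
  case True
  then have "card (marks False 0 t) = 0" by (simp add: card_marks)
  then have "marks False 0 t = {}" by simp
  then show ?thesis using True by (simp add: K_count_def)
next
  case False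
  define e M where "e = even_sum t" and "M = int (sum_list t)"
  let ?T = "trapezoid 0 M 0 (int (2 * e - 1))"
  let ?C = "?T - dent_triangles (seq_dents 0 t)"
  have e: "1 \<le> e" using False by (simp add: e_def)
  have e': "int (2 * e - 1) = 2 * int e - 1" using e by simp
  have s: "odd_sum t + even_sum t = sum_list t" by (rule odd_even_sum)
  have codes: "face_of (k, c) \<in> K_region t \<longleftrightarrow> (k, c) \<in> ?C" for k c
  proof -
    have "face_of (k, c) \<in> faces_between K_west
        (\<lambda>k. odd_sum t + even_sum t - k / 2) 0 (2 * int (even_sum t) - 1) \<longleftrightarrow> 0 \<le> k \<and> k < 2 * int e - 1 \<and>
       (if even (c - k) then (if even k then 0 else 1) \<le> c \<and> c + 2 \<le> 2 * int (sum_list t) - k \<and>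
          (if even (k + 1) then 0 else 1) \<le> c + 1 \<and> c + 1 \<le> 2 * int (sum_list t) - (k + 1)
        else (if even (k + 1) then 0 else 1) \<le> c \<and> c + 2 \<le> 2 * int (sum_list t) - (k + 1) \<and>
          (if even k then 0 else 1) \<le> c + 1 \<and> c + 1 \<le> 2 * int (sum_list t) - k)"
      unfolding e_def s[symmetric] by (rule face_of_mem_faces_between) (simp_all add: field_simps K_west_def)
    also have "\<dots> \<longleftrightarrow> (k, c) \<in> ?T"
      unfolding trapezoid_def M_def mem_Collect_eq prod.case e' by presburger
    finally show ?thesis
      unfolding K_region_def using face_of_dents[of k c t 0] by simp
  qed
  have "K_region t \<subseteq> Collect is_face" by (auto simp: K_region_def faces_between_def)
  then have "K_region t = face_of ` {p. face_of p \<in> K_region t}" by (rule region_eq_image)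
  also have "{p. face_of p \<in> K_region t} = ?C"
    using codes by auto
  finally have K: "K_region t = face_of ` ?C" .
  have "K_count t = weighted_count (half_weight (zigzag K_west 0 (2 * int (even_sum t) - 1))) (face_of ` ?C)"
    using False by (simp add: K_count_def K)
  also have "\<dots> = domino_sum ?C"
  proof (rule weighted_count_face_of, rule half_weight_eq_brick_weight)
    show "0 \<le> k \<and> k < 2 * int (even_sum t) - 1" if "l \<subseteq> ?C" "(k, 0) \<in> l" for l k
      using that e' by (auto simp: trapezoid_def e_def)
  qed
  also have "?C = ?C - Pair 0 ` {}" by simp
  also have "domino_sum \<dots> = trapezoid_value (2 * e - 1) (dent_codes (seq_dents 0 t) \<union> {})"
  proof (rule matching_sum_dented_trapezoid)
    show "0 \<le> 2 * M - 1 - int (2 * e - 1)" using s e' by (simp add: M_def e_def)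
    show "odd (0 - int (2 * e - 1))" unfolding e' by presburger
    show "dent_triangles (seq_dents 0 t) \<subseteq> ?T"
    proof
      fix x assume "x \<in> dent_triangles (seq_dents 0 t)"
      then obtain p r where pr: "(p, r) \<in> seq_dents 0 t" "x \<in> triangle 0 p r" by (auto simp: dent_triangles_def)
      show "x \<in> ?T"
        using pr(2) seq_dents_D[OF pr(1)] e by (auto simp: triangle_def trapezoid_def M_def e_def[symmetric])
    qed
  qed (use seq_dents_D(4) separated_seq_dents in auto)
  also have "\<dots> = vdm (dbl ` marks False 0 t) / H2_fun (2 * even_sum t)"
  proof -
    have "card (dbl ` marks False 0 t) = e"
      by (subst card_image) (auto simp: inj_on_def card_marks e_def)
    then show ?thesis using e by (simp add: trapezoid_value_def dent_codes_seq_dents e_def)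
  qed
  finally show ?thesis .
qed

section \<open>The region $N^{(4)}$\<close>

text \<open>The first term is left out: it is removed from the upper part as a half triangle along
  the zigzag, not as a dent.\<close>

definition a_dents :: "bool \<Rightarrow> nat list \<Rightarrow> (int \<times> nat) set" where
  "a_dents d xs = (\<lambda>i. (dbl (partial_sum xs (i - 1)), seq_term xs i)) ` {i \<in> {2..length xs}. odd i = d}"

definition b_dents :: "bool \<Rightarrow> nat \<Rightarrow> nat list \<Rightarrow> (int \<times> nat) set" where
  "b_dents d L xs = (\<lambda>j. (dbl (L - partial_sum xs j), seq_term xs j)) ` {j \<in> {1..length xs}. odd j = d}"

lemma finite_a_b_dents [simp]: "finite (a_dents d xs)" "finite (b_dents d L xs)"
  by (simp_all add: a_dents_def b_dents_def)

lemma a_dents_D: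
  assumes "(p, s) \<in> a_dents d xs"
  shows "dbl (seq_term xs 1) \<le> p" "p + dbl s \<le> dbl (sum_list xs)" "even p \<and> 0 \<le> p"
    "s \<le> (if d then odd_sum xs - seq_term xs 1 else even_sum xs)"
proof -
  obtain i where i: "2 \<le> i" "i \<le> length xs" "odd i = d" "p = dbl (partial_sum xs (i - 1))" "s = seq_term xs i"
    using assms by (auto simp: a_dents_def)
  have "partial_sum xs 1 = seq_term xs 1" by (simp add: partial_sum_Suc)
  then have "seq_term xs 1 \<le> partial_sum xs (i - 1)"
    using partial_sum_mono[of 1 "i - 1" xs] i(1) by simp
  then show "dbl (seq_term xs 1) \<le> p" "even p \<and> 0 \<le> p" unfolding i(4) by auto
  have "partial_sum xs (i - 1) + s \<le> sum_list xs"
    using partial_sum_pred[of i xs] partial_sum_le[of xs i] i by simp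
  then show "p + dbl s \<le> dbl (sum_list xs)" using i(4) by simp
  obtain v vs where xs: "xs = v # vs" using i(1,2) by (cases xs) auto
  obtain j where j: "i = Suc j" "j \<noteq> 0" using i(1) by (cases i) auto
  have "s = seq_term vs j" using j i(5) by (simp add: xs seq_term_Cons)
  then have "s \<le> (if odd j then odd_sum vs else even_sum vs)" using seq_term_le_sum[of vs j] by simp
  then show "s \<le> (if d then odd_sum xs - seq_term xs 1 else even_sum xs)"
    using i(3) j(1) by (auto simp: xs odd_sum_Cons even_sum_Cons seq_term_Cons split: if_splits)
qed

lemma b_dents_D:
  assumes "(p, s) \<in> b_dents d L xs" "sum_list xs \<le> L"
  shows "dbl (L - sum_list xs) \<le> p" "p + dbl s \<le> dbl L" "even p \<and> 0 \<le> p"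
    "s \<le> (if d then odd_sum xs else even_sum xs)"
proof -
  obtain i where i: "1 \<le> i" "odd i = d" "p = dbl (L - partial_sum xs i)" "s = seq_term xs i"
    using assms by (auto simp: b_dents_def)
  show "dbl (L - sum_list xs) \<le> p" "even p \<and> 0 \<le> p" using partial_sum_le[of xs i] i(3) by auto
  have "L - partial_sum xs i + s \<le> L"
    using partial_sum_pred[of i xs] partial_sum_le[of xs i] i assms(2) by simp
  then show "p + dbl s \<le> dbl L" using i(3) by simp
  show "s \<le> (if d then odd_sum xs else even_sum xs)" using seq_term_le_sum[of xs i] i by simp
qed

lemma separated_a_dents: "separated (a_dents d xs)"
  unfolding a_dents_def
proof (rule separated_image)
  fix i j assume "i \<in> {i \<in> {2..length xs}. odd i = d}" "j \<in> {i \<in> {2..length xs}. odd i = d}" "i < j"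
  then show "partial_sum xs (i - 1) + seq_term xs i \<le> partial_sum xs (j - 1) \<or>
      partial_sum xs (j - 1) + seq_term xs j \<le> partial_sum xs (i - 1)"
    using partial_sum_pred[of i xs] partial_sum_mono[of i "j - 1" xs] by auto
qed

lemma separated_b_dents:
  assumes "sum_list xs \<le> L"
  shows "separated (b_dents d L xs)"
  unfolding b_dents_def
proof (rule separated_image)
  fix i j assume ij: "i \<in> {j \<in> {1..length xs}. odd j = d}" "j \<in> {j \<in> {1..length xs}. odd j = d}" "i < j"
  then have "i \<le> j - 1" "1 \<le> j" by auto
  then show "L - partial_sum xs i + seq_term xs i \<le> L - partial_sum xs j \<or>
      L - partial_sum xs j + seq_term xs j \<le> L - partial_sum xs i"
    using partial_sum_pred[of j xs] partial_sum_mono[of i "j - 1" xs] partial_sum_le[of xs j] assms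
    by (intro disjI2) (simp add: diff_le_mono2)
qed

lemma separated_Un:
  assumes "separated D" "separated E" "\<And>p s q r. (p, s) \<in> D \<Longrightarrow> (q, r) \<in> E \<Longrightarrow> p + dbl s \<le> q"
  shows "separated (D \<union> E)"
  using assms unfolding separated_def by (auto; blast)

lemma dent_codes_a_dents: "dent_codes (a_dents d xs) = dbl ` (marks d 0 xs - {0..<seq_term xs 1})"
proof -
  have one: "partial_sum xs 1 = seq_term xs 1" by (simp add: partial_sum_Suc)
  have "(\<Union>i\<in>{i \<in> {2..length xs}. odd i = d}. {partial_sum xs (i - 1)..<partial_sum xs (i - 1) + seq_term xs i}) =
      marks d 0 xs - {0..<seq_term xs 1}"
    unfolding marks_eq
  proof (intro equalityI subsetI)
    fix n assume "n \<in> (\<Union>i\<in>{i \<in> {2..length xs}. odd i = d}. {partial_sum xs (i - 1)..<partial_sum xs (i - 1) + seq_term xs i})"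
    then obtain i where i: "2 \<le> i" "odd i = d" "n \<in> {partial_sum xs (i - 1)..<partial_sum xs (i - 1) + seq_term xs i}" by auto
    have "1 \<le> i - 1" "1 \<le> i" using i(1) by simp_all
    then have "n \<in> {0 + partial_sum xs (i - 1)..<0 + partial_sum xs i}" "n \<notin> {0..<seq_term xs 1}"
      using partial_sum_pred[of i xs] partial_sum_mono[of 1 "i - 1" xs] one i(3) by auto
    then show "n \<in> (\<Union>i\<in>{i. 1 \<le> i \<and> odd i = d}. {0 + partial_sum xs (i - 1)..<0 + partial_sum xs i}) - {0..<seq_term xs 1}"
      using i(2) \<open>1 \<le> i\<close> by blast
  next
    fix n assume "n \<in> (\<Union>i\<in>{i. 1 \<le> i \<and> odd i = d}. {0 + partial_sum xs (i - 1)..<0 + partial_sum xs i}) - {0..<seq_term xs 1}"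
    then obtain i where i: "1 \<le> i" "odd i = d" "n \<in> {partial_sum xs (i - 1)..<partial_sum xs i}" "seq_term xs 1 \<le> n" by auto
    then have s: "n \<in> {partial_sum xs (i - 1)..<partial_sum xs (i - 1) + seq_term xs i}"
      using partial_sum_pred[of i xs] by simp
    then have "i \<le> length xs" using seq_term_zero[of xs i] by force
    moreover have "i \<noteq> 1" using i(3,4) one by auto
    ultimately show "n \<in> (\<Union>i\<in>{i \<in> {2..length xs}. odd i = d}. {partial_sum xs (i - 1)..<partial_sum xs (i - 1) + seq_term xs i})"
      using s i(1,2) by (intro UN_I[of i]) auto
  qed
  then show ?thesis unfolding a_dents_def dent_codes_image by simp
qed

lemma dent_codes_b_dents:
  assumes "sum_list xs \<le> L"
  shows "dent_codes (b_dents d L xs) = dbl ` marks_left d L xs"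
proof -
  have e: "{L - partial_sum xs j..<L - partial_sum xs j + seq_term xs j} = {L - partial_sum xs j..<L - partial_sum xs (j - 1)}"
    if "1 \<le> j" for j
    using partial_sum_pred[OF that, of xs] partial_sum_le[of xs j] assms by simp
  have "(\<Union>j\<in>{j \<in> {1..length xs}. odd j = d}. {L - partial_sum xs j..<L - partial_sum xs j + seq_term xs j}) = marks_left d L xs"
    unfolding marks_left_eq[OF assms]
  proof (intro equalityI subsetI)
    fix n assume "n \<in> (\<Union>j\<in>{j \<in> {1..length xs}. odd j = d}. {L - partial_sum xs j..<L - partial_sum xs j + seq_term xs j})"
    then obtain j where "1 \<le> j" "odd j = d" "n \<in> {L - partial_sum xs j..<L - partial_sum xs j + seq_term xs j}" by auto
    then show "n \<in> (\<Union>j\<in>{j. 1 \<le> j \<and> odd j = d}. {L - partial_sum xs j..<L - partial_sum xs (j - 1)})"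
      using e[of j] by blast
  next
    fix n assume "n \<in> (\<Union>j\<in>{j. 1 \<le> j \<and> odd j = d}. {L - partial_sum xs j..<L - partial_sum xs (j - 1)})"
    then obtain j where j: "1 \<le> j" "odd j = d" "n \<in> {L - partial_sum xs j..<L - partial_sum xs j + seq_term xs j}"
      using e by auto
    then have "j \<le> length xs" using seq_term_zero[of xs j] by force
    then show "n \<in> (\<Union>j\<in>{j \<in> {1..length xs}. odd j = d}. {L - partial_sum xs j..<L - partial_sum xs j + seq_term xs j})"
      using j by (intro UN_I[of j]) auto
  qed
  then show ?thesis unfolding b_dents_def dent_codes_image by simp
qed

lemma dent_triangles_nonneg: "(k, c) \<in> dent_triangles D \<Longrightarrow> 0 \<le> k"
  by (auto simp: dent_triangles_def triangle_def)

lemma dent_triangles_Un: "dent_triangles (D \<union> E) = dent_triangles D \<union> dent_triangles E"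
  by (simp add: dent_triangles_def)

lemma dent_codes_Un: "dent_codes (D \<union> E) = dent_codes D \<union> dent_codes E"
  by (simp add: dent_codes_def)

lemma face_of_a_removed:
  "face_of (k, c) \<in> a_removed xs \<longleftrightarrow>
    (k, c) \<in> dent_triangles (a_dents True xs) \<or> (- 1 - k, c) \<in> dent_triangles (a_dents False xs)"
proof -
  have "face_of (k, c) \<in> a_removed xs \<longleftrightarrow> (\<exists>i\<in>{2..length xs}.
      (odd i \<and> (k, c) \<in> triangle 0 (dbl (partial_sum xs (i - 1))) (seq_term xs i)) \<or>
      (even i \<and> (- 1 - k, c) \<in> triangle 0 (dbl (partial_sum xs (i - 1))) (seq_term xs i)))"
    unfolding a_removed_def UN_iff
    by (intro bex_cong refl) (simp add: face_of_up_triangle face_of_down_triangle)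
  then show ?thesis unfolding dent_triangles_def a_dents_def by auto
qed

lemma face_of_b_removed:
  "face_of (k, c) \<in> b_removed L xs \<longleftrightarrow>
    (k, c) \<in> dent_triangles (b_dents True L xs) \<or> (- 1 - k, c) \<in> dent_triangles (b_dents False L xs)"
proof -
  have "face_of (k, c) \<in> b_removed L xs \<longleftrightarrow> (\<exists>j\<in>{1..length xs}.
      (odd j \<and> (k, c) \<in> triangle 0 (dbl (L - partial_sum xs j)) (seq_term xs j)) \<or>
      (even j \<and> (- 1 - k, c) \<in> triangle 0 (dbl (L - partial_sum xs j)) (seq_term xs j)))"
    unfolding b_removed_def UN_iff
    by (intro bex_cong refl) (simp add: face_of_up_triangle face_of_down_triangle)
  then show ?thesis unfolding dent_triangles_def b_dents_def by auto
qed

text \<open>In row k the cut by the line through [a_1 - k/2; k] removes just the columns up to 2 a_1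
  - 2 - k.\<close>

lemma face_of_N4_upper:
  assumes "1 \<le> seq_term as 1"
  shows "face_of (k, c) \<in> N4_upper x y as bs \<longleftrightarrow>
    (k, c) \<in> trapezoid 1 (int (N4_L x y as bs)) 0 (N4_A y as bs) - half_triangle 0 (2 * seq_term as 1 - 2)"
proof -
  define M where "M = int (N4_L x y as bs)"
  define s where "s = seq_term as 1"
  have s: "int (2 * s - 2) = 2 * int s - 2" using assms by (simp add: s_def)
  have abs: "abscissa (i, k) = real_of_int (2 * i + k) / 2" for i k by (simp add: abscissa_def field_simps)
  have lt: "real_of_int p / 2 < real s - real_of_int q / 2 \<longleftrightarrow> p + q < 2 * int s" for p q
  proof -
    have "real_of_int p / 2 < real s - real_of_int q / 2 \<longleftrightarrow> real_of_int (p + q) < real_of_int (2 * int s)" by auto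
    then show ?thesis by (simp only: of_int_less_iff)
  qed
  have cut: "(\<exists>p\<in>face_of (k, c). abscissa p < real s - height p / 2) \<longleftrightarrow>
      (if even (c - k) then c + k < 2 * int s else c + k + 1 < 2 * int s)"
  proof (cases rule: code_cases[of c k])
    case (1 i)
    then show ?thesis unfolding 1 face_of_up up_face_def bex_simps abs fst_conv snd_conv lt by auto
  next
    case (2 i)
    then show ?thesis unfolding 2 face_of_down down_face_def bex_simps abs fst_conv snd_conv lt by auto
  qed
  have "face_of (k, c) \<in> faces_between (\<lambda>k. if even k then 1 else 1 / 2) (\<lambda>k. N4_L x y as bs - k / 2) 0 (N4_A y as bs)
      \<longleftrightarrow> 0 \<le> k \<and> k < N4_A y as bs \<and>
       (if even (c - k) then (if even k then 2 else 1) \<le> c \<and> c + 2 \<le> 2 * M - k \<and>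
          (if even (k + 1) then 2 else 1) \<le> c + 1 \<and> c + 1 \<le> 2 * M - (k + 1)
        else (if even (k + 1) then 2 else 1) \<le> c \<and> c + 2 \<le> 2 * M - (k + 1) \<and>
          (if even k then 2 else 1) \<le> c + 1 \<and> c + 1 \<le> 2 * M - k)"
    unfolding M_def by (rule face_of_mem_faces_between) (simp_all add: field_simps)
  also have "\<dots> \<longleftrightarrow> (k, c) \<in> trapezoid 1 M 0 (N4_A y as bs)"
    unfolding trapezoid_def mem_Collect_eq prod.case by presburger
  finally have F: "face_of (k, c) \<in> faces_between (\<lambda>k. if even k then 1 else 1 / 2) (\<lambda>k. N4_L x y as bs - k / 2) 0 (N4_A y as bs)
      \<longleftrightarrow> (k, c) \<in> trapezoid 1 M 0 (N4_A y as bs)" .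
  have "face_of (k, c) \<in> N4_upper x y as bs \<longleftrightarrow> (k, c) \<in> trapezoid 1 M 0 (N4_A y as bs) \<and>
      \<not> (if even (c - k) then c + k < 2 * int s else c + k + 1 < 2 * int s)"
    unfolding N4_upper_def Diff_iff mem_Collect_eq F s_def[symmetric] cut ..
  also have "\<dots> \<longleftrightarrow> (k, c) \<in> trapezoid 1 M 0 (N4_A y as bs) - half_triangle 0 (2 * s - 2)"
    unfolding trapezoid_def half_triangle_def Diff_iff mem_Collect_eq prod.case s by presburger
  finally show ?thesis unfolding M_def s_def .
qed

text \<open>The eastern border goes out to [L + z/2; -z] before it turns back. Extending its second
  segment up to the base gives a trapezoid with base L + z, from which a triangle of side z at the
  right end is missing. This is the origin of the last term of t-.\<close>

lemma face_of_N4_lower: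
  "face_of (k, c) \<in> N4_lower x y z as bs \<longleftrightarrow>
    (- 1 - k, c) \<in> trapezoid 0 (int (N4_L x y as bs + z)) 0 (N4_B y z as bs) - triangle 0 (dbl (N4_L x y as bs)) z"
proof -
  define M B where "M = int (N4_L x y as bs)" and "B = N4_B y z as bs"
  define hi' where "hi' h = (if - h \<le> int z then 2 * M - h else 2 * M + 2 * int z + h)" for h
  have "face_of (k, c) \<in> N4_lower x y z as bs \<longleftrightarrow> - B \<le> k \<and> k < 0 \<and>
     (if even (c - k) then (if even k then 0 else 1) \<le> c \<and> c + 2 \<le> hi' k \<and>
        (if even (k + 1) then 0 else 1) \<le> c + 1 \<and> c + 1 \<le> hi' (k + 1)
      else (if even (k + 1) then 0 else 1) \<le> c \<and> c + 2 \<le> hi' (k + 1) \<and>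
        (if even k then 0 else 1) \<le> c + 1 \<and> c + 1 \<le> hi' k)"
    unfolding N4_lower_def B_def hi'_def M_def
    by (rule face_of_mem_faces_between) (simp_all add: field_simps N4_west_def)
  also have "\<dots> \<longleftrightarrow> (- 1 - k, c) \<in> trapezoid 0 (M + int z) 0 B - triangle 0 (2 * M) z"
    unfolding trapezoid_def triangle_def Diff_iff mem_Collect_eq prod.case hi'_def by presburger
  finally show ?thesis unfolding M_def B_def by simp
qed

section \<open>The upper and the lower part as dented trapezoids\<close>

lemma marks_minus_first:
  "marks False u xs - {u..<u + seq_term xs 1} = marks False u xs"
  "{u..<u + seq_term xs 1} \<subseteq> marks True u xs"
proof -
  show "marks False u xs - {u..<u + seq_term xs 1} = marks False u xs"
  proof (cases xs)
    case (Cons v vs)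
    then show ?thesis using marks_subset[of True "u + v" vs] by (auto simp: seq_term_def)
  qed simp
  show "{u..<u + seq_term xs 1} \<subseteq> marks True u xs"
    by (cases xs) (auto simp: seq_term_def)
qed

lemma dent_codes_upper:
  assumes "sum_list bs \<le> L" "1 \<le> seq_term as 1"
  shows "dent_codes (a_dents True as \<union> b_dents True L bs) \<union> dbl ` {1..<seq_term as 1} =
    dbl ` ((marks True 0 as - {0}) \<union> marks_left True L bs)"
proof -
  have "marks True 0 as - {0} = {1..<seq_term as 1} \<union> (marks True 0 as - {0..<seq_term as 1})"
    using marks_minus_first(2)[of 0 as] assms(2) by force
  then show ?thesis
    unfolding dent_codes_Un dent_codes_a_dents dent_codes_b_dents[OF assms(1)] by (simp only: image_Un Un_ac)
qed

lemma dent_codes_lower: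
  assumes "sum_list bs \<le> L"
  shows "dent_codes (a_dents False as \<union> (b_dents False L bs \<union> {(dbl L, z)})) =
    dbl ` (marks False 0 as \<union> marks_left False L bs \<union> {L..<L + z})"
proof -
  have "dent_codes {(dbl L, z)} = dbl ` {L..<L + z}" by (simp add: dent_codes_def run_dbl)
  then show ?thesis
    using marks_minus_first(1)[of 0 as]
    unfolding dent_codes_Un dent_codes_a_dents dent_codes_b_dents[OF assms(1)] by (simp only: image_Un Un_ac add_0)
qed

text \<open>The half triangle is first traded for the positions 1, ..., a_1 - 1 on its base;
  together with \<open>S\<close> they are then removed from the base of a dented trapezoid. As a_1
  is at least 1, the subtraction in \<open>n\<close> is not truncated.\<close>

lemma matching_sum_N4_upper:
  fixes as bs :: "nat list" and L y :: nat
  assumes a1: "1 \<le> seq_term as 1" and L: "L = sum_list as + x + y + sum_list bs"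
    and n: "n = y + odd_sum as + odd_sum bs - 1"
    and S: "Pair 0 ` S \<subseteq> trapezoid 1 (int L) 0 (int (2 * n)) - half_triangle 0 (2 * seq_term as 1 - 2) -
      dent_triangles (a_dents True as \<union> b_dents True L bs)" "\<And>c. c \<in> S \<Longrightarrow> even c"
  shows "domino_sum (trapezoid 1 (int L) 0 (int (2 * n)) - half_triangle 0 (2 * seq_term as 1 - 2) -
      dent_triangles (a_dents True as \<union> b_dents True L bs) - Pair 0 ` S) =
    trapezoid_value (2 * n) (dbl ` ((marks True 0 as - {0}) \<union> marks_left True L bs) \<union> S)"
proof -
  define D where "D = a_dents True as \<union> b_dents True L bs"
  define a1 where "a1 = seq_term as 1"
  let ?T = "trapezoid 1 (int L) 0 (int (2 * n))" and ?H = "half_triangle 0 (2 * a1 - 2)"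
  let ?Y = "{c. 1 \<le> c \<and> c \<le> int (2 * a1 - 2) \<and> even (c - 0)}"
  have a1': "1 \<le> a1" "int (2 * a1 - 2) = 2 * int a1 - 2" using a1 by (simp_all add: a1_def)
  have Y: "?Y = dbl ` {1..<a1}"
  proof -
    have "?Y = run 2 (a1 - 1)"
      using a1' unfolding run_def by (auto simp: of_nat_diff)
    also have "\<dots> = dbl ` {1..<a1}" using run_dbl[of 1 "a1 - 1"] a1' by simp
    finally show ?thesis .
  qed
  have oa: "a1 \<le> odd_sum as" using seq_term_le_sum[of as 1] by (simp add: a1_def)
  have bL: "sum_list bs \<le> L" using L by simp
  have D: "dbl a1 \<le> p" "p + dbl s \<le> dbl L" "even p \<and> 0 \<le> p" "s \<le> 2 * n" if ps: "(p, s) \<in> D" for p s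
  proof -
    consider "(p, s) \<in> a_dents True as" | "(p, s) \<in> b_dents True L bs" using ps by (auto simp: D_def)
    then have "dbl a1 \<le> p \<and> p + dbl s \<le> dbl L \<and> (even p \<and> 0 \<le> p) \<and> s \<le> 2 * n"
    proof cases
      case 1
      show ?thesis using a_dents_D[OF 1] oa a1' L n by (simp add: a1_def)
    next
      case 2
      have "a1 \<le> sum_list as" using oa odd_even_sum[of as] by simp
      then show ?thesis using b_dents_D[OF 2 bL] oa a1' L n by simp
    qed
    then show "dbl a1 \<le> p" "p + dbl s \<le> dbl L" "even p \<and> 0 \<le> p" "s \<le> 2 * n" by auto
  qed
  have finD: "finite D" by (simp add: D_def)
  have sepD: "separated D"
    unfolding D_def
  proof (rule separated_Un[OF separated_a_dents separated_b_dents[OF bL]])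
    fix p s q r assume "(p, s) \<in> a_dents True as" "(q, r) \<in> b_dents True L bs"
    then show "p + dbl s \<le> q" using a_dents_D(2)[of p s] b_dents_D(1)[OF _ bL, of q r] L by fastforce
  qed
  have DT: "dent_triangles D \<subseteq> ?T"
  proof
    fix v assume "v \<in> dent_triangles D"
    then obtain p s where ps: "(p, s) \<in> D" "v \<in> triangle 0 p s" by (auto simp: dent_triangles_def)
    show "v \<in> ?T" using ps(2) D[OF ps(1)] a1' by (auto simp: triangle_def trapezoid_def)
  qed
  have HT: "?H \<subseteq> ?T"
  proof -
    have "2 * int a1 - 2 \<le> int (2 * n)" "int a1 \<le> int L"
      using oa n a1' L odd_even_sum[of as] by auto
    then show ?thesis using a1' by (auto simp: half_triangle_def trapezoid_def)
  qed
  have HD: "?H \<inter> dent_triangles D = {}"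
  proof -
    have "?H \<inter> triangle 0 p s = {}" if "(p, s) \<in> D" for p s
      using D(1)[OF that] a1' by (auto simp: half_triangle_def triangle_def)
    then show ?thesis by (auto simp: dent_triangles_def)
  qed
  have YH: "Pair 0 ` ?Y \<subseteq> ?H" by (auto simp: half_triangle_def)
  have S': "Pair 0 ` S \<subseteq> ?T - ?H - dent_triangles D"
    using S(1) unfolding D_def[symmetric] a1_def[symmetric] .
  let ?R = "?T - dent_triangles D - Pair 0 ` S"
  have "?T - ?H - dent_triangles D - Pair 0 ` S = ?R - ?H" by blast
  also have "domino_sum \<dots> = domino_sum (?R - Pair 0 ` ?Y)"
  proof (rule matching_sum_half_triangle[symmetric])
    show "?H \<subseteq> ?R" using HT HD S' by blast
    show "1 \<le> c" if "(j, c) \<in> ?R" for j c using that by (auto simp: trapezoid_def)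
  qed (use a1' in auto)
  also have "?R - Pair 0 ` ?Y = ?T - dent_triangles D - Pair 0 ` (S \<union> ?Y)" by blast
  also have "domino_sum \<dots> = trapezoid_value (2 * n) (dent_codes D \<union> (S \<union> ?Y))"
  proof (rule matching_sum_dented_trapezoid)
    show "1 \<le> 2 * int L - 1 - int (2 * n)"
      using n L odd_even_sum[of as] odd_even_sum[of bs] oa a1' by simp
    have SYT: "Pair 0 ` (S \<union> ?Y) \<subseteq> ?T" using S' YH HT by blast
    show "1 \<le> c \<and> c \<le> 2 * int L - 2 \<and> even c" if "c \<in> S \<union> ?Y" for c
    proof -
      have "(0, c) \<in> ?T" using SYT that by blast
      then show ?thesis using that S(2)[of c] by (auto simp: trapezoid_def)
    qed
    show "(S \<union> ?Y) \<inter> dent_codes D = {}"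
    proof -
      have "c \<notin> dent_codes D" if "c \<in> S \<union> ?Y" for c
      proof -
        have "even c" using that S(2)[of c] by auto
        moreover have "(0, c) \<notin> dent_triangles D" using that S' YH HD by blast
        ultimately show ?thesis using dent_codes_iff[of D c] D(3) by blast
      qed
      then show ?thesis by blast
    qed
    show "S \<union> ?Y = {}" if "2 * n = 0"
    proof -
      have "?T = {}" using that by (auto simp: trapezoid_def)
      then show ?thesis using SYT by blast
    qed
  qed (use finD sepD DT D(3) in auto)
  also have "dent_codes D \<union> (S \<union> ?Y) = dbl ` ((marks True 0 as - {0}) \<union> marks_left True L bs) \<union> S"
    unfolding Y unfolding D_def a1_def dent_codes_upper[OF bL a1, symmetric] by (simp only: Un_ac)
  finally show ?thesis unfolding D_def a1_def .
qed

text \<open>For \<open>n = 0\<close> the truncated \<open>2 * n - 1\<close> is 0, the number of rows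
  of the empty lower part, whose depth B is -1 by convention.\<close>

lemma matching_sum_N4_lower:
  fixes as bs :: "nat list" and L y z :: nat
  assumes L: "L = sum_list as + x + y + sum_list bs" and n: "n = y + z + even_sum as + even_sum bs"
    and S: "Pair 0 ` S \<subseteq> trapezoid 0 (int (L + z)) 0 (int (2 * n - 1)) -
      dent_triangles (a_dents False as \<union> (b_dents False L bs \<union> {(dbl L, z)}))" "\<And>c. c \<in> S \<Longrightarrow> even c"
  shows "domino_sum (trapezoid 0 (int (L + z)) 0 (int (2 * n - 1)) -
      dent_triangles (a_dents False as \<union> (b_dents False L bs \<union> {(dbl L, z)})) - Pair 0 ` S) =
    trapezoid_value (2 * n - 1) (dbl ` (marks False 0 as \<union> marks_left False L bs \<union> {L..<L + z}) \<union> S)"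
proof -
  define D where "D = a_dents False as \<union> (b_dents False L bs \<union> {(dbl L, z)})"
  let ?T = "trapezoid 0 (int (L + z)) 0 (int (2 * n - 1))"
  have bL: "sum_list bs \<le> L" using L by simp
  have D: "p + dbl s \<le> dbl (L + z)" "even p \<and> 0 \<le> p" "s \<le> n" if ps: "(p, s) \<in> D" for p s
  proof -
    consider "(p, s) \<in> a_dents False as" | "(p, s) \<in> b_dents False L bs" | "p = dbl L" "s = z"
      using ps by (auto simp: D_def)
    then have "p + dbl s \<le> dbl (L + z) \<and> (even p \<and> 0 \<le> p) \<and> s \<le> n"
    proof cases
      case 1
      show ?thesis using a_dents_D[OF 1] L n by simp
    next
      case 2
      show ?thesis using b_dents_D[OF 2 bL] L n by simp
    qed (use n in simp)
    then show "p + dbl s \<le> dbl (L + z)" "even p \<and> 0 \<le> p" "s \<le> n" by auto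
  qed
  have finD: "finite D" by (simp add: D_def)
  have sepD: "separated D"
    unfolding D_def
  proof (rule separated_Un[OF separated_a_dents separated_Un[OF separated_b_dents[OF bL]]])
    show "separated {(dbl L, z)}" by (simp add: separated_def)
    show "p + dbl s \<le> q" if "(p, s) \<in> b_dents False L bs" "(q, r) \<in> {(dbl L, z)}" for p s q r
      using b_dents_D(2)[OF that(1) bL] that(2) by simp
    show "p + dbl s \<le> q" if "(p, s) \<in> a_dents False as" "(q, r) \<in> b_dents False L bs \<union> {(dbl L, z)}" for p s q r
      using a_dents_D(2)[OF that(1)] b_dents_D(1)[OF _ bL, of q r False] that(2) L by fastforce
  qed
  have DT: "dent_triangles D \<subseteq> ?T"
  proof
    fix v assume "v \<in> dent_triangles D"
    then obtain p s where ps: "(p, s) \<in> D" "v \<in> triangle 0 p s" by (auto simp: dent_triangles_def)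
    obtain k c where v: "v = (k, c)" by (cases v)
    \<comment> \<open>A dent of side 0 contains nothing. Otherwise \<open>1 \<le> s \<le> n\<close>,
      so that the dent fits into the \<open>2 * n - 1\<close> rows.\<close>
    have "0 < s" using ps(2) by (auto simp: v triangle_def)
    then have "int s \<le> int (2 * n - 1)" using D(3)[OF ps(1)] by auto
    then show "v \<in> ?T" using ps(2) D[OF ps(1)] by (auto simp: v triangle_def trapezoid_def)
  qed
  have S': "Pair 0 ` S \<subseteq> ?T - dent_triangles D" using S(1) unfolding D_def[symmetric] .
  have "domino_sum (?T - dent_triangles D - Pair 0 ` S) = trapezoid_value (2 * n - 1) (dent_codes D \<union> S)"
  proof (rule matching_sum_dented_trapezoid)
    show "0 \<le> 2 * int (L + z) - 1 - int (2 * n - 1)" if "0 < 2 * n - 1"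
      using that n L odd_even_sum[of as] odd_even_sum[of bs] by (simp add: of_nat_diff)
    show "odd (0 - int (2 * n - 1))" if "0 < 2 * n - 1"
      using that by (simp add: of_nat_diff)
    show "0 \<le> c \<and> c \<le> 2 * int (L + z) - 2 \<and> even c" if "c \<in> S" for c
    proof -
      have "(0, c) \<in> ?T" using S' that by blast
      then show ?thesis using that S(2)[of c] by (auto simp: trapezoid_def)
    qed
    show "S \<inter> dent_codes D = {}"
    proof -
      have "c \<notin> dent_codes D" if "c \<in> S" for c
      proof -
        have "(0, c) \<notin> dent_triangles D" using S' that by blast
        then show ?thesis using dent_codes_iff[of D c] D(2) S(2)[OF that] by simp
      qed
      then show ?thesis by blast
    qed
    show "S = {}" if "2 * n - 1 = 0"
    proof -
      have "?T = {}" unfolding that by (auto simp: trapezoid_def)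
      then show ?thesis using S' by blast
    qed
  qed (use finD sepD DT D(2) in auto)
  moreover have "dent_codes D = dbl ` (marks False 0 as \<union> marks_left False L bs \<union> {L..<L + z})"
    unfolding D_def by (rule dent_codes_lower[OF bL])
  ultimately show ?thesis unfolding D_def by simp
qed

lemma marks_left_subset: "sum_list xs \<le> L \<Longrightarrow> marks_left d L xs \<subseteq> {L - sum_list xs..<L}"
  using marks_left_Un[of xs L] by (cases d) auto

lemma finite_marks_left [simp]: "finite (marks_left d L xs)"
  by (rule finite_subset[of _ "{..<L}"]) (auto simp: marks_left_def)

lemma card_upper_marks:
  assumes L: "sum_list bs \<le> L" "sum_list as \<le> L - sum_list bs" and a1: "1 \<le> seq_term as 1"
  shows "card ((marks True 0 as - {0}) \<union> marks_left True L bs) = odd_sum as + odd_sum bs - 1"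
proof -
  have "0 \<in> marks True 0 as"
    by (rule subsetD[OF marks_minus_first(2)]) (use a1 in simp)
  then have "card (marks True 0 as - {0}) = odd_sum as - 1" by (simp add: card_marks)
  moreover have "(marks True 0 as - {0}) \<inter> marks_left True L bs = {}"
    using marks_subset[of True 0 as] marks_left_subset[OF L(1), of True] L(2) by fastforce
  moreover have "1 \<le> odd_sum as" using seq_term_le_sum[of as 1] a1 by simp
  ultimately show ?thesis
    by (subst card_Un_disjoint) (auto simp: card_marks_left[OF L(1)])
qed

lemma card_lower_marks:
  assumes L: "sum_list bs \<le> L" "sum_list as \<le> L - sum_list bs"
  shows "card (marks False 0 as \<union> marks_left False L bs \<union> {L..<L + z}) = even_sum as + even_sum bs + z"
proof -
  have "marks False 0 as \<inter> marks_left False L bs = {}"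
    using marks_subset[of False 0 as] marks_left_subset[OF L(1), of False] L(2) by fastforce
  then have "card (marks False 0 as \<union> marks_left False L bs) = even_sum as + even_sum bs"
    by (subst card_Un_disjoint) (auto simp: card_marks card_marks_left[OF L(1)])
  moreover have "(marks False 0 as \<union> marks_left False L bs) \<inter> {L..<L + z} = {}"
    using marks_subset[of False 0 as] marks_left_subset[OF L(1), of False] L by fastforce
  ultimately show ?thesis by (subst card_Un_disjoint) auto
qed

text \<open>\<open>X\<close> contains the positions that are free on both sides of k = 0. The number
  of crossings is forced: the upper trapezoid has \<open>2 * n\<close> rows and absorbs n positions,
  of which \<open>odd_sum as + odd_sum bs - 1\<close> are taken by dents, which leaves y. The lower
  part leads to the same number.\<close>

lemma N4_count_eq_selberg_sum:
  fixes as bs :: "nat list" and x y z :: nat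
  assumes a1: "1 \<le> seq_term as 1"
  defines "L \<equiv> sum_list as + x + y + sum_list bs"
  shows "N4_count x y z as bs =
    ovdm (dbl ` ((marks True 0 as - {0}) \<union> marks_left True L bs)) *
    vdm (dbl ` (marks False 0 as \<union> marks_left False L bs \<union> {L..<L + z})) /
    (H2_fun (2 * odd_sum as + 2 * odd_sum bs + 2 * y - 1) * H2_fun (2 * even_sum as + 2 * even_sum bs + 2 * y + 2 * z)) *
    selberg_sum 2 (sum_list as - 1) (x + y) (sum_list bs + z) y"
proof -
  define n m where "n = y + odd_sum as + odd_sum bs - 1" and "m = y + z + even_sum as + even_sum bs"
  define Du Dl where "Du = a_dents True as \<union> b_dents True L bs"
    and "Dl = a_dents False as \<union> (b_dents False L bs \<union> {(dbl L, z)})"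
  define PU PD where "PU = (marks True 0 as - {0}) \<union> marks_left True L bs"
    and "PD = marks False 0 as \<union> marks_left False L bs \<union> {L..<L + z}"
  define Up where "Up = trapezoid 1 (int L) 0 (int (2 * n)) - half_triangle 0 (2 * seq_term as 1 - 2) - dent_triangles Du"
  define Lo' where "Lo' = trapezoid 0 (int (L + z)) 0 (int (2 * m - 1)) - dent_triangles Dl"
  define rf where "rf = (\<lambda>(k :: int, c :: int). (- 1 - k, c))"
  define X where "X = {c. even c \<and> (0, c) \<in> Up \<and> (0, c) \<in> Lo'}"
  have bL: "sum_list bs \<le> L" "sum_list as \<le> L - sum_list bs" by (simp_all add: L_def)
  have oa: "seq_term as 1 \<le> odd_sum as" using seq_term_le_sum[of as 1] by simp
  have a: "1 \<le> sum_list as" using oa a1 odd_even_sum[of as] by simp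
  have NL: "N4_L x y as bs = L" by (simp add: N4_L_def L_def)
  have NA: "N4_A y as bs = int (2 * n)" using oa a1 by (simp add: N4_A_def n_def)
  \<comment> \<open>B and the truncated \<open>2 * m - 1\<close> differ only for
    \<open>m = 0\<close>, and both trapezoids are empty then.\<close>
  have NB: "trapezoid lo M 0 (N4_B y z as bs) = trapezoid lo M 0 (int (2 * m - 1))" for lo M
    by (auto simp: N4_B_def m_def trapezoid_def of_nat_diff)
  have up: "face_of (k, c) \<in> N4_upper x y as bs \<longleftrightarrow>
      (k, c) \<in> trapezoid 1 (int L) 0 (int (2 * n)) - half_triangle 0 (2 * seq_term as 1 - 2)" for k c
    unfolding face_of_N4_upper[OF a1] NL NA ..
  have low: "face_of (k, c) \<in> N4_lower x y z as bs \<longleftrightarrow>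
      (- 1 - k, c) \<in> trapezoid 0 (int (L + z)) 0 (int (2 * m - 1)) - triangle 0 (dbl L) z" for k c
    unfolding face_of_N4_lower NL NB ..
  have "face_of (k, c) \<in> N4_region x y z as bs \<longleftrightarrow> (k, c) \<in> Up \<or> (- 1 - k, c) \<in> Lo'" for k c
  proof -
    have "dent_triangles {(dbl L, z)} = triangle 0 (dbl L) z" by (simp add: dent_triangles_def)
    then have T: "dent_triangles Du = dent_triangles (a_dents True as) \<union> dent_triangles (b_dents True L bs)"
      "dent_triangles Dl = dent_triangles (a_dents False as) \<union> dent_triangles (b_dents False L bs) \<union> triangle 0 (dbl L) z"
      by (simp_all only: Du_def Dl_def dent_triangles_Un Un_assoc)
    have neg: "(j, c) \<in> trapezoid lo M 0 t \<Longrightarrow> 0 \<le> j" for j lo M t by (simp add: trapezoid_def)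
    show ?thesis
      unfolding N4_region_def Diff_iff Un_iff face_of_a_removed face_of_b_removed up low NL Up_def Lo'_def T
      using dent_triangles_nonneg[of k c] dent_triangles_nonneg[of "- 1 - k" c]
        neg[of k 1 "int L" "int (2 * n)"] neg[of "- 1 - k" 0 "int (L + z)" "int (2 * m - 1)"]
      by (cases "0 \<le> k") (auto simp: dent_triangles_nonneg)
  qed
  then have codes: "{p. face_of p \<in> N4_region x y z as bs} = Up \<union> rf ` Lo'"
    unfolding rf_def by (force simp: image_iff)
  have "N4_region x y z as bs \<subseteq> Collect is_face"
    by (auto simp: N4_region_def N4_upper_def N4_lower_def faces_between_def)
  then have region: "N4_region x y z as bs = face_of ` (Up \<union> rf ` Lo')"
    unfolding codes[symmetric] by (rule region_eq_image)
  have "N4_west = K_west" by (rule ext) (simp add: N4_west_def K_west_def)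
  then have "N4_count x y z as bs = weighted_count (half_weight (zigzag K_west (- N4_B y z as bs) 0)) (face_of ` (Up \<union> rf ` Lo'))"
    by (simp add: N4_count_def region)
  also have "\<dots> = domino_sum (Up \<union> rf ` Lo')"
  proof (rule weighted_count_face_of, rule half_weight_eq_brick_weight)
    show "- N4_B y z as bs \<le> k \<and> k < 0" if "l \<subseteq> Up \<union> rf ` Lo'" "(k, 0) \<in> l" for l k
    proof -
      have "(k, 0) \<in> rf ` Lo'" using that by (auto simp: Up_def trapezoid_def)
      then have "(- 1 - k, 0) \<in> Lo'" by (auto simp: rf_def)
      then have "(- 1 - k, 0) \<in> trapezoid 0 (int (L + z)) 0 (N4_B y z as bs)" unfolding NB Lo'_def by blast
      then show ?thesis by (auto simp: trapezoid_def)
    qed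
  qed
  also have "\<dots> = (\<Sum>S\<in>Pow X. (\<Prod>c\<in>S. brick_weight {(0, c), (- 1, c)}) * domino_sum (Up - Pair 0 ` S) * domino_sum (rf ` Lo' - Pair (- 1) ` S))"
  proof (rule matching_sum_split)
    show "Pair (- 1) ` X \<subseteq> rf ` Lo'" by (force simp: X_def rf_def image_iff)
    show "{(0, c), (- 1, c)} \<in> bricks" if "c \<in> X" for c
      using that vertical_brick[of c "- 1"] by (auto simp: X_def insert_commute)
    have UL: "(k, c) \<in> Up \<Longrightarrow> 0 \<le> k" "(k, c) \<in> rf ` Lo' \<Longrightarrow> k < 0" for k c
      by (auto simp: Up_def Lo'_def trapezoid_def rf_def)
    show "Up \<inter> rf ` Lo' = {}"
    proof -
      have False if "p \<in> Up" "p \<in> rf ` Lo'" for p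
        using UL(1)[of "fst p" "snd p"] UL(2)[of "fst p" "snd p"] that by simp
      then show ?thesis by blast
    qed
    fix l assume l: "l \<in> bricks" "l \<subseteq> Up \<union> rf ` Lo'"
    from l(1) consider k c where "l = {(k, c), (k, c + 1)}" | k c where "l = {(k, c), (k - 1, c)}" "even (c - k)"
      unfolding bricks_def by blast
    then show "l \<subseteq> Up \<or> l \<subseteq> rf ` Lo' \<or> (\<exists>c\<in>X. l = {(0, c), (- 1, c)})"
    proof cases
      case (1 k c)
      show ?thesis
      proof (cases "0 \<le> k")
        case True
        then have "(k, c) \<in> Up" "(k, c + 1) \<in> Up" using l(2) 1 UL(2)[of k] by auto
        then show ?thesis using 1 by simp
      next
        case False
        then have "(k, c) \<in> rf ` Lo'" "(k, c + 1) \<in> rf ` Lo'" using l(2) 1 UL(1)[of k] by auto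
        then show ?thesis using 1 by simp
      qed
    next
      case (2 k c)
      consider "1 \<le> k" | "k \<le> - 1" | "k = 0" by linarith
      then show ?thesis
      proof cases
        case 1
        then have "(k, c) \<in> Up" "(k - 1, c) \<in> Up" using l(2) 2 UL(2)[of k] UL(2)[of "k - 1"] by auto
        then show ?thesis using 2 by simp
      next
        case b: 2
        then have "(k, c) \<in> rf ` Lo'" "(k - 1, c) \<in> rf ` Lo'" using l(2) 2 UL(1)[of k] UL(1)[of "k - 1"] by auto
        then show ?thesis using 2 by simp
      next
        case 3
        then have "(0, c) \<in> Up" "(- 1, c) \<in> rf ` Lo'" using l(2) 2 UL(2)[of 0] UL(1)[of "- 1"] by auto
        then have "(0, c) \<in> Up" "(0, c) \<in> Lo'" by (auto simp: rf_def)
        then have "c \<in> X" using 2 3 by (simp add: X_def)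
        then show ?thesis using 2 3 by auto
      qed
    qed
  qed (auto simp: Up_def Lo'_def X_def inj_on_def)
  also have "\<dots> = (\<Sum>S\<in>Pow X. trapezoid_value (2 * n) (dbl ` PU \<union> S) * trapezoid_value (2 * m - 1) (dbl ` PD \<union> S))"
  proof (rule sum.cong[OF refl])
    fix S assume "S \<in> Pow X"
    then have S: "S \<subseteq> X" by simp
    \<comment> \<open>The upper part begins at column 1, so no crossing lozenge touches the weighted
      wall.\<close>
    have "brick_weight {(0, c), (- 1, c)} = 1" if "c \<in> S" for c
    proof -
      have "c \<noteq> 0" using that S by (auto simp: X_def Up_def trapezoid_def)
      then show ?thesis using brick_weight_vertical[of "- 1" c] by (simp add: insert_commute)
    qed
    then have 1: "(\<Prod>c\<in>S. brick_weight {(0, c), (- 1, c)}) = 1" by (rule prod.neutral[OF ballI])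
    have 2: "domino_sum (Up - Pair 0 ` S) = trapezoid_value (2 * n) (dbl ` PU \<union> S)"
      unfolding Up_def PU_def Du_def
    proof (rule matching_sum_N4_upper[OF a1 L_def[THEN meta_eq_to_obj_eq] n_def])
      show "Pair 0 ` S \<subseteq> trapezoid 1 (int L) 0 (int (2 * n)) - half_triangle 0 (2 * seq_term as 1 - 2) -
        dent_triangles (a_dents True as \<union> b_dents True L bs)"
        using S unfolding X_def Up_def Du_def by blast
    qed (use S in \<open>auto simp: X_def\<close>)
    have "rf ` Lo' - Pair (- 1) ` S = rf ` (Lo' - Pair 0 ` S)" by (auto simp: rf_def)
    then have "domino_sum (rf ` Lo' - Pair (- 1) ` S) = domino_sum (Lo' - Pair 0 ` S)"
      unfolding rf_def by (simp add: matching_sum_reflect)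
    also have "\<dots> = trapezoid_value (2 * m - 1) (dbl ` PD \<union> S)"
      unfolding Lo'_def PD_def Dl_def
    proof (rule matching_sum_N4_lower[OF L_def[THEN meta_eq_to_obj_eq] m_def])
      show "Pair 0 ` S \<subseteq> trapezoid 0 (int (L + z)) 0 (int (2 * m - 1)) -
        dent_triangles (a_dents False as \<union> (b_dents False L bs \<union> {(dbl L, z)}))"
        using S unfolding X_def Lo'_def Dl_def by blast
    qed (use S in \<open>auto simp: X_def\<close>)
    finally show "(\<Prod>c\<in>S. brick_weight {(0, c), (- 1, c)}) * domino_sum (Up - Pair 0 ` S) * domino_sum (rf ` Lo' - Pair (- 1) ` S) =
        trapezoid_value (2 * n) (dbl ` PU \<union> S) * trapezoid_value (2 * m - 1) (dbl ` PD \<union> S)"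
      by (simp add: 1 2)
  qed
  finally have count: "N4_count x y z as bs = \<dots>" .
  have injd: "inj_on dbl P" for P by (auto simp: inj_on_def)
  have finP: "finite PU" "finite PD"
    using bL by (simp_all add: PU_def PD_def)
  have cPU: "card PU = odd_sum as + odd_sum bs - 1"
    unfolding PU_def by (rule card_upper_marks[OF bL a1])
  have cPD: "card PD = even_sum as + even_sum bs + z"
    unfolding PD_def by (rule card_lower_marks[OF bL])
  have PUD: "PU \<inter> PD = {}"
    using marks_disjoint[of True 0 as] marks_left_disjoint[of L bs] marks_subset[of _ 0 as] marks_left_subset[OF bL(1)] bL
    unfolding PU_def PD_def by fastforce
  \<comment> \<open>Each position under a sequence carries a dent on exactly one side of the line,
    so the dents fill an interval at either end. The dent of side z continues the right interval
    beyond L, and position 0 is missing on the left.\<close>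
  have PUnion: "PU \<union> PD = {1..<sum_list as} \<union> {L - sum_list bs..<L + z}"
  proof -
    have "0 \<notin> marks False 0 as"
      using marks_minus_first(1)[of 0 as] a1 by force
    then have "(marks True 0 as - {0}) \<union> marks False 0 as = {0..<sum_list as} - {0}"
      using marks_Un[of True 0 as] by auto
    also have "\<dots> = {1..<sum_list as}" by auto
    finally have "PU \<union> PD = {1..<sum_list as} \<union> (marks_left True L bs \<union> marks_left False L bs) \<union> {L..<L + z}"
      unfolding PU_def PD_def by blast
    moreover have "{L - sum_list bs..<L} \<union> {L..<L + z} = {L - sum_list bs..<L + z}" by auto
    ultimately show ?thesis unfolding marks_left_Un[OF bL(1)] by (simp only: Un_assoc)
  qed
  let ?K = "run 2 (sum_list as - 1) \<union> run (dbl (L - sum_list bs)) (sum_list bs + z)"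
  have K: "dbl ` PU \<union> dbl ` PD = ?K"
    using run_dbl[of 1 "sum_list as - 1"] run_dbl[of "L - sum_list bs" "sum_list bs + z"] a bL
    unfolding image_Un[symmetric] PUnion by (simp add: image_Un)
  let ?G = "run (dbl (sum_list as)) (x + y)"
  have int_L: "int (L - sum_list bs) = int (sum_list as) + int x + int y" "int (sum_list as - 1) = int (sum_list as) - 1"
    "int L = int (sum_list as) + int x + int y + int (sum_list bs)"
    using a by (simp_all add: L_def)
  have G: "c \<in> ?G \<longleftrightarrow> even c \<and> 1 \<le> c \<and> c \<le> 2 * int L - 2 \<and> c \<notin> ?K" for c
    using a unfolding run_def Un_iff mem_Collect_eq of_nat_add int_L by presburger
  have X: "c \<in> X \<longleftrightarrow> even c \<and> (0, c) \<in> trapezoid 1 (int L) 0 (int (2 * n)) \<and>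
      (0, c) \<in> trapezoid 0 (int (L + z)) 0 (int (2 * m - 1)) \<and> c \<notin> ?K" for c
  proof (cases "even c")
    case True
    have evD: "even p \<and> 0 \<le> p" if "(p, s) \<in> Du \<or> (p, s) \<in> Dl" for p s
      using that a_dents_D(3)[of p s] b_dents_D(3)[OF _ bL(1), of p s] by (auto simp: Du_def Dl_def)
    have "c \<in> dbl ` {1..<seq_term as 1} \<longleftrightarrow> (0, c) \<in> half_triangle 0 (2 * seq_term as 1 - 2)"
    proof -
      have "dbl ` {1..<seq_term as 1} = run 2 (seq_term as 1 - 1)"
        using run_dbl[of 1 "seq_term as 1 - 1"] a1 by simp
      then show ?thesis using True a1 by (auto simp: run_def half_triangle_def of_nat_diff)
    qed
    then have "c \<in> dbl ` PU \<longleftrightarrow> (0, c) \<in> half_triangle 0 (2 * seq_term as 1 - 2) \<or> (0, c) \<in> dent_triangles Du"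
      unfolding PU_def dent_codes_upper[OF bL(1) a1, symmetric] Du_def[symmetric]
      using dent_codes_iff[of Du c] evD True by blast
    moreover have "c \<in> dbl ` PD \<longleftrightarrow> (0, c) \<in> dent_triangles Dl"
      unfolding PD_def dent_codes_lower[OF bL(1), symmetric] Dl_def[symmetric]
      using dent_codes_iff[of Dl c] evD True by blast
    ultimately show ?thesis
      unfolding K[symmetric] X_def Up_def Lo'_def using True by blast
  qed (simp add: X_def)
  have XG: "X \<subseteq> ?G"
    using X G by (auto simp: trapezoid_def)
  \<comment> \<open>For \<open>y = 0\<close> one of the parts may have no rows, and then
    \<open>X\<close> can be smaller than the gap; but in that case only the empty \<open>S\<close>
    contributes.\<close>
  have GX: "X = ?G" if "0 < y"
  proof -
    have "0 < n" "0 < 2 * m - 1" using that oa a1 by (auto simp: n_def m_def)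
    then show ?thesis using X G by (auto simp: trapezoid_def)
  qed
  have Sets: "{S \<in> Pow X. card S = y} = {S. S \<subseteq> ?G \<and> card S = y}"
  proof (cases "y = 0")
    case True
    have "card S = y \<longleftrightarrow> S = {}" if "S \<subseteq> ?G" for S
      using finite_subset[OF that finite_run] True by simp
    then show ?thesis using XG by auto
  qed (use GX in auto)
  have finX: "finite X" by (rule finite_subset[OF XG]) simp
  have val: "trapezoid_value (2 * n) (dbl ` PU \<union> S) * trapezoid_value (2 * m - 1) (dbl ` PD \<union> S) =
      (if card S = y then ovdm (dbl ` PU) * vdm (dbl ` PD) * selberg_weight ?K S / (H2_fun (2 * n + 1) * H2_fun (2 * m)) else 0)"
    if S: "S \<subseteq> X" for S
  proof -
    have finS: "finite S" by (rule finite_subset[OF S finX])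
    have SK: "1 \<le> c" "c \<notin> dbl ` PU" "c \<notin> dbl ` PD" if c: "c \<in> S" for c
    proof -
      have "c \<in> ?G" using c S XG by blast
      then have "1 \<le> c" "c \<notin> ?K" using G[of c] by simp_all
      then show "1 \<le> c" "c \<notin> dbl ` PU" "c \<notin> dbl ` PD" unfolding K[symmetric] by blast+
    qed
    have dis: "dbl ` PU \<inter> S = {}" "dbl ` PD \<inter> S = {}" "dbl ` PU \<inter> dbl ` PD = {}"
      using SK image_Int[OF injd[of UNIV], of PU PD] PUD by (blast, blast, simp)
    have cU: "card (dbl ` PU \<union> S) = odd_sum as + odd_sum bs - 1 + card S"
      using finP finS dis by (simp add: card_Un_disjoint card_image[OF injd] cPU)
    have cD: "card (dbl ` PD \<union> S) = even_sum as + even_sum bs + z + card S"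
      using finP finS dis by (simp add: card_Un_disjoint card_image[OF injd] cPD)
    show ?thesis
    proof (cases "card S = y")
      case True
      have "trapezoid_value (2 * n) (dbl ` PU \<union> S) = ovdm (dbl ` PU \<union> S) / H2_fun (2 * n + 1)"
        using oa a1 by (simp add: trapezoid_value_def cU True n_def)
      moreover have "trapezoid_value (2 * m - 1) (dbl ` PD \<union> S) = vdm (dbl ` PD \<union> S) / H2_fun (2 * m)"
      proof (cases "m = 0")
        case m0: True
        then have "card (dbl ` PD \<union> S) = 0" unfolding cD by (simp add: m_def True)
        then have e: "dbl ` PD \<union> S = {}" using finP finS by simp
        show ?thesis unfolding e m0 by (simp add: trapezoid_value_def)
      next
        case False
        then have "odd (2 * m - 1)" "Suc (2 * m - 1) = 2 * m" by auto
        then show ?thesis using cD True by (simp add: trapezoid_value_def m_def)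
      qed
      moreover have "ovdm (dbl ` PU \<union> S) * vdm (dbl ` PD \<union> S) = ovdm (dbl ` PU) * vdm (dbl ` PD) * selberg_weight (dbl ` PU \<union> dbl ` PD) S"
      proof (rule ovdm_vdm_selberg)
        show "0 \<le> v" if "v \<in> dbl ` PU \<union> dbl ` PD \<union> S" for v
          using that SK(1)[of v] by auto
      qed (use finP finS dis in auto)
      ultimately show ?thesis unfolding K using True by simp
    next
      case False
      then have "2 * card (dbl ` PU \<union> S) \<noteq> 2 * n" using oa a1 unfolding cU n_def by simp
      then show ?thesis using False by (simp add: trapezoid_value_def)
    qed
  qed
  have "N4_count x y z as bs = (\<Sum>S\<in>Pow X. if card S = y then
      ovdm (dbl ` PU) * vdm (dbl ` PD) * selberg_weight ?K S / (H2_fun (2 * n + 1) * H2_fun (2 * m)) else 0)"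
    unfolding count by (intro sum.cong refl val) simp
  also have "\<dots> = (\<Sum>S\<in>{S \<in> Pow X. card S = y}.
      ovdm (dbl ` PU) * vdm (dbl ` PD) * selberg_weight ?K S / (H2_fun (2 * n + 1) * H2_fun (2 * m)))"
    by (rule sum.inter_filter[symmetric]) (use finX in simp)
  also have "\<dots> = ovdm (dbl ` PU) * vdm (dbl ` PD) / (H2_fun (2 * n + 1) * H2_fun (2 * m)) *
      (\<Sum>S | S \<subseteq> ?G \<and> card S = y. selberg_weight ?K S)"
    unfolding Sets by (simp add: sum_distrib_left)
  also have "(\<Sum>S | S \<subseteq> ?G \<and> card S = y. selberg_weight ?K S) =
      selberg_sum 2 (sum_list as - 1) (x + y) (sum_list bs + z) y"
  proof -
    have "2 + 2 * int (sum_list as - 1) = dbl (sum_list as)" "dbl (sum_list as) + 2 * int (x + y) = dbl (L - sum_list bs)"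
      using int_L by simp_all
    then show ?thesis unfolding selberg_sum_def by simp
  qed
  also have "2 * n + 1 = 2 * odd_sum as + 2 * odd_sum bs + 2 * y - 1" using oa a1 by (simp add: n_def)
  also have "2 * m = 2 * even_sum as + 2 * even_sum bs + 2 * y + 2 * z" by (simp add: m_def)
  finally show ?thesis unfolding PU_def PD_def .
qed

section \<open>The product formula and the first identity\<close>

lemma T_fun_pos: "0 < x \<Longrightarrow> 0 < T_fun x n m"
  unfolding T_fun_def by (intro prod_pos) (auto intro!: pochhammer_pos)

text \<open>Q has the dents of the upper part but no rows for the y crossing lozenges: the
  Vandermonde product is the same and only the value of \<open>H2_fun\<close> changes.\<close>

lemma Q_count_t_plus:
  assumes a1: "1 \<le> seq_term as 1" and L: "L = sum_list as + x + y + sum_list bs"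
  shows "real (Q_count (t_plus x y as bs)) =
    ovdm (dbl ` ((marks True 0 as - {0}) \<union> marks_left True L bs)) / H2_fun (2 * odd_sum as + 2 * odd_sum bs - 1)"
proof -
  have bL: "sum_list bs \<le> L" "sum_list as \<le> L - sum_list bs" by (simp_all add: L)
  have "even_sum (t_plus x y as bs) = card (marks False 1 (t_plus x y as bs))" by (simp add: card_marks)
  also have "\<dots> = odd_sum as + odd_sum bs - 1"
    unfolding marks_t_plus(1)[OF a1 L] by (rule card_upper_marks[OF bL a1])
  finally have "2 * even_sum (t_plus x y as bs) + 1 = 2 * odd_sum as + 2 * odd_sum bs - 1"
    using seq_term_le_sum[of as 1] a1 by simp
  then show ?thesis unfolding Q_count_eq marks_t_plus(1)[OF a1 L] by simp
qed

lemma K_count_t_minus: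
  assumes L: "L = sum_list as + x + y + sum_list bs"
  shows "K_count (t_minus x y z as bs) =
    vdm (dbl ` (marks False 0 as \<union> marks_left False L bs \<union> {L..<L + z})) / H2_fun (2 * even_sum as + 2 * even_sum bs + 2 * z)"
proof -
  have bL: "sum_list bs \<le> L" "sum_list as \<le> L - sum_list bs" by (simp_all add: L)
  have "even_sum (t_minus x y z as bs) = card (marks False 0 (t_minus x y z as bs))" by (simp add: card_marks)
  also have "\<dots> = even_sum as + even_sum bs + z"
    unfolding marks_t_minus(1)[OF L] by (rule card_lower_marks[OF bL])
  finally show ?thesis unfolding K_count_eq marks_t_minus(1)[OF L] by simp
qed

lemma N4_count_product_formula:
  fixes as bs :: "nat list" and x y z :: nat
  assumes a1: "1 \<le> seq_term as 1"
  defines "a \<equiv> sum_list as" and "b \<equiv> sum_list bs"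
    and "oa \<equiv> odd_sum as" and "ea \<equiv> even_sum as" and "ob \<equiv> odd_sum bs" and "eb \<equiv> even_sum bs"
  shows "N4_count x y z as bs =
    1 / 2 ^ y * Q_count (t_plus x y as bs) * K_count (t_minus x y z as bs)
          * (fact (a - 1) / fact (a + y - 1))
          * ((H2_fun (2 * oa + 2 * ob - 1) * H2_fun (2 * ea + 2 * eb + 2 * z))
             / (H2_fun (2 * oa + 2 * ob + 2 * y - 1) * H2_fun (2 * ea + 2 * eb + 2 * y + 2 * z)))
          * ((H_fun (2 * a + b + 2 * y + z - 1) * H_fun (b + y + z))
             / (H_fun (2 * a + b + y + z - 1) * H_fun (b + z)))
          * ((T_fun (x + 1) (2 * a + b + 2 * y + z - 2) y * T_fun (x + a + 1) (b + 2 * y + z - 2) y)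
           / (T_fun 1 (2 * a + b + 2 * y + z - 2) y * T_fun (a + 1) (b + 2 * y + z - 2) y))"
proof -
  define L where "L = sum_list as + x + y + sum_list bs"
  have a: "1 \<le> a" using seq_term_le_sum[of as 1] a1 odd_even_sum[of as] by (simp add: a_def)
  have nz: "H2_fun k \<noteq> 0" for k using H2_fun_pos[of k] by simp
  have Q: "ovdm (dbl ` ((marks True 0 as - {0}) \<union> marks_left True L bs)) =
      Q_count (t_plus x y as bs) * H2_fun (2 * oa + 2 * ob - 1)"
    using nz by (simp add: Q_count_t_plus[OF a1 L_def] oa_def ob_def)
  have K: "vdm (dbl ` (marks False 0 as \<union> marks_left False L bs \<union> {L..<L + z})) =
      K_count (t_minus x y z as bs) * H2_fun (2 * ea + 2 * eb + 2 * z)"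
    using nz by (simp add: K_count_t_minus[OF L_def] ea_def eb_def)
  have "N4_count x y z as bs = (Q_count (t_plus x y as bs) * H2_fun (2 * oa + 2 * ob - 1)) *
      (K_count (t_minus x y z as bs) * H2_fun (2 * ea + 2 * eb + 2 * z)) /
      (H2_fun (2 * oa + 2 * ob + 2 * y - 1) * H2_fun (2 * ea + 2 * eb + 2 * y + 2 * z)) *
      selberg_sum 2 (a - 1) (x + y) (b + z) y"
    unfolding N4_count_eq_selberg_sum[OF a1] L_def[symmetric] Q K oa_def ob_def ea_def eb_def a_def b_def ..
  then show ?thesis unfolding selberg_sum_closed_form[OF a, of x y b z] 
    by (simp only: divide_inverse inverse_mult_distrib mult_ac mult_1 of_nat_add of_nat_1)
qed

lemma t_plus_t_minus_add:
  "t_plus x y as bs = t_plus (x + y) 0 as bs" "t_minus x y z as bs = t_minus (x + y) 0 z as bs"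
  by (simp_all add: t_plus_def t_minus_def Let_def add.assoc)

theorem theorem2p15:
  fixes x y z :: nat and as bs :: "nat list"
  assumes "length as \<ge> 1" and "seq_term as 1 \<ge> 1"
  shows
    "let a = sum_list as; b = sum_list bs;
         oa = odd_sum as; ea = even_sum as; ob = odd_sum bs; eb = even_sum bs;
         T_ratio =
           (T_fun (x + 1) (2 * a + b + 2 * y + z - 2) y * T_fun (x + a + 1) (b + 2 * y + z - 2) y)
           / (T_fun 1 (2 * a + b + 2 * y + z - 2) y * T_fun (a + 1) (b + 2 * y + z - 2) y)
     in N4_count x y z as bs =
          (N4_count (x + y) 0 z as bs * N4_count 0 y z as bs) / N4_count y 0 z as bs * T_ratio
        \<and> N4_count x y z as bs =
          1 / 2 ^ y * Q_count (t_plus x y as bs) * K_count (t_minus x y z as bs)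
          * (fact (a - 1) / fact (a + y - 1))
          * ((H2_fun (2 * oa + 2 * ob - 1) * H2_fun (2 * ea + 2 * eb + 2 * z))
             / (H2_fun (2 * oa + 2 * ob + 2 * y - 1) * H2_fun (2 * ea + 2 * eb + 2 * y + 2 * z)))
          * ((H_fun (2 * a + b + 2 * y + z - 1) * H_fun (b + y + z))
             / (H_fun (2 * a + b + y + z - 1) * H_fun (b + z)))
          * T_ratio"
proof -
  define a b where "a = sum_list as" and "b = sum_list bs"
  \<comment> \<open>Both sequences contain x and y only in the sum x + y, so the product of Q and K'
    is a function of the gap width \<open>w\<close>.\<close>
  define QK where "QK w = real (Q_count (t_plus w 0 as bs)) * K_count (t_minus w 0 z as bs)" for w
  define c where "c = 1 / 2 ^ y * (fact (a - 1) / fact (a + y - 1))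
      * ((H2_fun (2 * odd_sum as + 2 * odd_sum bs - 1) * H2_fun (2 * even_sum as + 2 * even_sum bs + 2 * z))
         / (H2_fun (2 * odd_sum as + 2 * odd_sum bs + 2 * y - 1) * H2_fun (2 * even_sum as + 2 * even_sum bs + 2 * y + 2 * z)))
      * ((H_fun (2 * a + b + 2 * y + z - 1) * H_fun (b + y + z)) / (H_fun (2 * a + b + y + z - 1) * H_fun (b + z)))"
  define T where "T w = (T_fun (real w + 1) (2 * a + b + 2 * y + z - 2) y * T_fun (real w + real a + 1) (b + 2 * y + z - 2) y)
           / (T_fun 1 (2 * a + b + 2 * y + z - 2) y * T_fun (real a + 1) (b + 2 * y + z - 2) y)" for w :: nat
  have H: "H_fun k \<noteq> 0" "H2_fun k \<noteq> 0" for k using H_fun_pos[of k] H2_fun_pos[of k] by simp_all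
  have main: "N4_count w y z as bs = QK (w + y) * c * T w" for w
    unfolding N4_count_product_formula[OF assms(2)] QK_def c_def T_def a_def b_def
      t_plus_t_minus_add[of w y]
    
    by (simp only: divide_inverse inverse_mult_distrib mult_ac mult_1 of_nat_add of_nat_1)
  have y0: "N4_count w 0 z as bs = QK w" for w
    unfolding N4_count_product_formula[OF assms(2)] QK_def using H by (simp add: T_fun_def)
  have T0: "T 0 = 1"
  proof -
    have "T_fun 1 (2 * a + b + 2 * y + z - 2) y \<noteq> 0" "T_fun (real a + 1) (b + 2 * y + z - 2) y \<noteq> 0"
      using T_fun_pos[of 1] T_fun_pos[of "real a + 1"] by (auto simp: less_imp_neq[symmetric] add_nonneg_pos)
    then show ?thesis by (simp add: T_def)
  qed
  \<comment> \<open>The quotient in the first identity contains \<open>QK y\<close> in numerator and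
    denominator. It is positive, being a product of Vandermonde products over positions that are
    positive above and non-negative below.\<close>
  have QK0: "QK y \<noteq> 0"
  proof -
    define L where "L = sum_list as + y + 0 + sum_list bs"
    have "1 \<le> sum_list as" using seq_term_le_sum[of as 1] assms(2) odd_even_sum[of as] by simp
    then have "0 < u" if "u \<in> dbl ` ((marks True 0 as - {0}) \<union> marks_left True L bs)" for u
      using that marks_left_subset[of bs L True] by (fastforce simp: L_def)
    then have "0 < ovdm (dbl ` ((marks True 0 as - {0}) \<union> marks_left True L bs))" by (rule ovdm_pos)
    moreover have "0 < vdm (dbl ` (marks False 0 as \<union> marks_left False L bs \<union> {L..<L + z}))"
      by (rule vdm_pos) auto
    ultimately show ?thesis
      unfolding QK_def Q_count_t_plus[OF assms(2) L_def] K_count_t_minus[OF L_def] using H by simp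
  qed
  \<comment> \<open>The four values are \<open>QK (x + y) * c * T x\<close>,
    \<open>QK (x + y)\<close>, \<open>QK y * c\<close> and \<open>QK y\<close>.\<close>
  have "N4_count x y z as bs = (N4_count (x + y) 0 z as bs * N4_count 0 y z as bs) / N4_count y 0 z as bs * T x"
    using QK0 by (simp add: main y0 T0)
  note eqs = this N4_count_product_formula[OF assms(2), of x y z bs]
  show ?thesis
    unfolding Let_def of_nat_add of_nat_1
    by (intro conjI eqs[unfolded T_def a_def b_def of_nat_add of_nat_1])
qed

end
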